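(* Let $n\ge2$ be an integer, let $X=K^+\cup K^-\subset\mathbb{R}^n$ be the union of two copies of the $n$-dimensional standard Sierpiński gasket glued at the vertex $o=(0,\dots,0)$, equipped with the Euclidean metric and the $d_{\mathrm f}$-dimensional Hausdorff measure $\mu$, where $d_{\mathrm f}=\log(n+1)/\log2$. Then $$\theta_p(X)=\theta_p^*(X)=\frac{d_{\mathrm w,p}}{p}\qquad\text{for }1<p<\infty,$$ where $d_{\mathrm w,p}=\log((n+1)\rho_p)/\log2$ is the $p$-walk dimension of the $n$-dimensional standard Sierpiński gasket.
   Context: For a metric measure space $(X,d,\mu)$, $B(x,r)=\{y\in X:d(x,y)<r\}$, and for $\theta>0$, $B^\theta_{p,p}(X)$ is the vector space of $u\in L^p(X)$ (functions identified $\mu$-a.e.) with $$\|u\|_{B^\theta_{p,p}(X)}^p:=\int_X\int_X\frac{|u(y)-u(x)|^p}{d(x,y)^{\theta p}\,\mu(B(x,d(x,y)))}\,d\mu(y)\,d\mu(x)<\infty$$ (the integrand is taken to be $0$ when $x=y$). The critical exponents are $$\theta_p(X):=\sup\{\theta>0: B^\theta_{p,p}(X)\text{ contains non-constant functions}\},$$ $$\theta_p^*(X):=\sup\{\theta>0: B^\theta_{p,p}(X)\text{ is dense in }L^p(X)\}.$$ Gasket: let $q_0=o,q_1,\dots,q_n\in\mathbb{R}^n$ be the vertices of a regular $n$-simplex of side length $1$, placed symmetrically about the $x_n$-axis and contained in the half-space $\{x_n\ge0\}$ (so the centroid lies on the positive $x_n$-axis). Let $F_i(x)=(x+q_i)/2$,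 $i=0,\dots,n$. The standard $n$-dimensional Sierpiński gasket $K$ is the unique non-empty compact set with $K=\bigcup_{i=0}^nF_i(K)$. Set $K^+=K$ and let $K^-$ be the reflection of $K$ in the hyperplane $\{x_n=0\}$. The $p$-scaling factor $\rho_p$ of the gasket: let $V_0=\{q_0,\dots,q_n\}$ with all pairs of distinct points joined by an edge, and let $V_m=\bigcup_{w}F_w(V_0)$ over words $w\in\{0,\dots,n\}^m$, with $F_w=F_{w_1}\circ\cdots\circ F_{w_m}$, where distinct $x,y\in V_m$ are joined by an edge iff $x,y\in F_w(V_0)$ for some such $w$. Let $\mathcal{C}_p^{(m)}$ be the minimum of $\sum_{\{x,y\}}|f(x)-f(y)|^p$ (sum over edges of $V_m$) over $f:V_m\to\mathbb{R}$ with $f(q_0)=0$, $f(q_1)=1$. Then $\rho_p:=\lim_{m\to\infty}\left(\mathcal{C}_p^{(m)}\right)^{-1/m}\in(0,\infty)$. *)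

theory Defs
  imports "HOL-Analysis.Analysis"
begin

section \<open>Hausdorff measure\<close>

text \<open>
  Coverings are restricted to bounded sets because \<^const>\<open>diameter\<close> takes an unspecified value
  on unbounded ones. The definition is meant for \<open>s > 0\<close>: for \<open>s = 0\<close> points would get mass
  \<open>0\<close>, since \<open>0 powr 0 = 0\<close>. No normalising constant is included.
\<close>

definition hausdorff_outer :: "real \<Rightarrow> 'a::metric_space set \<Rightarrow> ennreal" where
  "hausdorff_outer s A =
     (SUP \<delta>\<in>{0<..}.
        INF U\<in>{U :: nat \<Rightarrow> 'a set. A \<subseteq> (\<Union>i. U i) \<and> (\<forall>i. bounded (U i) \<and> diameter (U i) \<le> \<delta>)}.
          (\<Sum>i. ennreal (diameter (U i) powr s)))"

definition hausdorff_measure :: "real \<Rightarrow> 'a::metric_space measure" where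
  "hausdorff_measure s = measure_of UNIV (sets borel) (hausdorff_outer s)"


section \<open>Besov spaces and critical exponents of a metric measure space\<close>

text \<open>
  A metric measure space is a measure \<open>M\<close> on a metric type; the underlying space is
  \<^term>\<open>space M\<close> with the restricted metric. Elements of \<open>L\<^sup>p\<close> are handled through representatives,
  all notions below being invariant under almost everywhere equality.
\<close>

definition Lp_fun :: "real \<Rightarrow> 'a measure \<Rightarrow> ('a \<Rightarrow> real) set" where
  "Lp_fun p M = {u \<in> borel_measurable M. integrable M (\<lambda>x. \<bar>u x\<bar> powr p)}"

definition Lp_norm :: "real \<Rightarrow> 'a measure \<Rightarrow> ('a \<Rightarrow> real) \<Rightarrow> real" where
  "Lp_norm p M u = (\<integral>x. \<bar>u x\<bar> powr p \<partial>M) powr (1 / p)"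

definition besov_energy ::
    "real \<Rightarrow> real \<Rightarrow> 'a::metric_space measure \<Rightarrow> ('a \<Rightarrow> real) \<Rightarrow> ennreal" where
  "besov_energy p \<theta> M u =
     (\<integral>\<^sup>+x. (\<integral>\<^sup>+y.
        (if x = y then 0
         else ennreal (\<bar>u y - u x\<bar> powr p) /
              (ennreal (dist x y powr (\<theta> * p)) * emeasure M (ball x (dist x y) \<inter> space M)))
      \<partial>M) \<partial>M)"

definition besov :: "real \<Rightarrow> real \<Rightarrow> 'a::metric_space measure \<Rightarrow> ('a \<Rightarrow> real) set" where
  "besov p \<theta> M = {u \<in> Lp_fun p M. besov_energy p \<theta> M u < \<infinity>}"

definition ae_constant :: "'a measure \<Rightarrow> ('a \<Rightarrow> real) \<Rightarrow> bool" where
  "ae_constant M u \<longleftrightarrow> (\<exists>c. AE x in M. u x = c)"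

definition dense_in_Lp :: "real \<Rightarrow> 'a measure \<Rightarrow> ('a \<Rightarrow> real) set \<Rightarrow> bool" where
  "dense_in_Lp p M D \<longleftrightarrow>
     (\<forall>f\<in>Lp_fun p M. \<forall>\<epsilon>>0. \<exists>u\<in>D. Lp_norm p M (\<lambda>x. f x - u x) < \<epsilon>)"

text \<open>The suprema are taken in \<^typ>\<open>ereal\<close>, as the sets of exponents may be unbounded in general.\<close>

definition crit_exp :: "real \<Rightarrow> 'a::metric_space measure \<Rightarrow> ereal" where
  "crit_exp p M = (SUP \<theta>\<in>{\<theta>. 0 < \<theta> \<and> (\<exists>u\<in>besov p \<theta> M. \<not> ae_constant M u)}. ereal \<theta>)"

definition crit_exp_dense :: "real \<Rightarrow> 'a::metric_space measure \<Rightarrow> ereal" where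
  "crit_exp_dense p M = (SUP \<theta>\<in>{\<theta>. 0 < \<theta> \<and> dense_in_Lp p M (besov p \<theta> M)}. ereal \<theta>)"


section \<open>The Sierpinski gasket\<close>

text \<open>
  Throughout, \<open>n = CARD('n)\<close>, the coordinate \<open>k :: 'n\<close> plays the role of the last coordinate
  \<open>x\<^sub>n\<close>, and the vertices \<open>q 0, \<dots>, q n\<close> are the values of \<open>q\<close> on \<open>{..CARD('n)}\<close>.
  A regular simplex with one vertex at the origin is symmetric about an axis through the origin
  iff its centroid lies on that axis.
\<close>

definition gasket_simplex :: "'n::finite \<Rightarrow> (nat \<Rightarrow> real^'n) \<Rightarrow> bool" where
  "gasket_simplex k q \<longleftrightarrow>
     q 0 = 0 \<and>
     (\<forall>i\<le>CARD('n). \<forall>j\<le>CARD('n). i \<noteq> j \<longrightarrow> dist (q i) (q j) = 1) \<and>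
     convex hull (q ` {..CARD('n)}) \<subseteq> {x. 0 \<le> x $ k} \<and>
     (\<exists>c>0. (1 / (real CARD('n) + 1)) *\<^sub>R (\<Sum>i\<le>CARD('n). q i) = c *\<^sub>R axis k 1)"

definition gasket_map :: "(nat \<Rightarrow> real^'n) \<Rightarrow> nat \<Rightarrow> real^'n \<Rightarrow> real^'n" where
  "gasket_map q i x = (1 / 2) *\<^sub>R (x + q i)"

definition gasket :: "(nat \<Rightarrow> real^'n::finite) \<Rightarrow> (real^'n) set" where
  "gasket q = (THE K. K \<noteq> {} \<and> compact K \<and> K = (\<Union>i\<le>CARD('n). gasket_map q i ` K))"

definition reflect_coord :: "'n::finite \<Rightarrow> real^'n \<Rightarrow> real^'n" where
  "reflect_coord k x = (\<chi> i. if i = k then - (x $ i) else x $ i)"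

definition double_gasket :: "'n::finite \<Rightarrow> (nat \<Rightarrow> real^'n) \<Rightarrow> (real^'n) set" where
  "double_gasket k q = gasket q \<union> reflect_coord k ` gasket q"

definition gasket_dim :: "'n::finite itself \<Rightarrow> real" where
  "gasket_dim _ = ln (real CARD('n) + 1) / ln 2"

definition double_gasket_measure :: "'n::finite \<Rightarrow> (nat \<Rightarrow> real^'n) \<Rightarrow> (real^'n) measure" where
  "double_gasket_measure k q =
     restrict_space (hausdorff_measure (gasket_dim TYPE('n))) (double_gasket k q)"


section \<open>The \<open>p\<close>-scaling factor and the \<open>p\<close>-walk dimension\<close>

definition words :: "nat \<Rightarrow> nat \<Rightarrow> nat list set" where
  "words N m = {w. length w = m \<and> set w \<subseteq> {..N}}"

definition word_map :: "(nat \<Rightarrow> real^'n) \<Rightarrow> nat list \<Rightarrow> real^'n \<Rightarrow> real^'n" where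
  "word_map q w = foldr (gasket_map q) w"

definition cell :: "(nat \<Rightarrow> real^'n::finite) \<Rightarrow> nat list \<Rightarrow> (real^'n) set" where
  "cell q w = word_map q w ` (q ` {..CARD('n)})"

text \<open>
  Edges as ordered pairs, so that every undirected edge occurs exactly twice; the vertex set
  \<open>V\<^sub>m\<close> is the union of the cells of level \<open>m\<close>.
\<close>

definition gasket_edges :: "(nat \<Rightarrow> real^'n::finite) \<Rightarrow> nat \<Rightarrow> ((real^'n) \<times> (real^'n)) set" where
  "gasket_edges q m =
     {(x, y). x \<noteq> y \<and> (\<exists>w\<in>words CARD('n) m. x \<in> cell q w \<and> y \<in> cell q w)}"

definition graph_energy ::
    "(nat \<Rightarrow> real^'n::finite) \<Rightarrow> real \<Rightarrow> nat \<Rightarrow> (real^'n \<Rightarrow> real) \<Rightarrow> real" where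
  "graph_energy q p m f = (\<Sum>(x, y)\<in>gasket_edges q m. \<bar>f x - f y\<bar> powr p) / 2"

text \<open>
  Functions on \<open>V\<^sub>m\<close> are represented by functions on the whole space, whose values off \<open>V\<^sub>m\<close> do not
  enter the energy. The infimum is a minimum, by continuity and finite dimensionality.
\<close>

definition conductance :: "(nat \<Rightarrow> real^'n::finite) \<Rightarrow> real \<Rightarrow> nat \<Rightarrow> real" where
  "conductance q p m = Inf {graph_energy q p m f | f. f (q 0) = 0 \<and> f (q 1) = 1}"

definition scaling_factor :: "(nat \<Rightarrow> real^'n::finite) \<Rightarrow> real \<Rightarrow> real" where
  "scaling_factor q p = lim (\<lambda>m. conductance q p m powr (- 1 / real m))"

definition walk_dim :: "(nat \<Rightarrow> real^'n::finite) \<Rightarrow> real \<Rightarrow> real" where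
  "walk_dim q p = ln ((real CARD('n) + 1) * scaling_factor q p) / ln 2"

end

theory Submission
  imports Defs
begin

text \<open>
  Let \<open>N = n + 1\<close>, let \<open>c m\<close> be the conductance of level \<open>m\<close> and \<open>\<lambda> = N * 2 powr (- \<theta> p)\<close>; then \<open>\<theta>\<close> is above or
  below \<open>d\<^sub>w / p\<close> according to whether \<open>\<lambda> \<rho> < 1\<close> or \<open>\<lambda> \<rho> > 1\<close>. Gluing rescaled near-minimisers cell by cell gives
  \<open>c (l + m) \<le> C * c l * c m\<close>, so the limit defining \<open>\<rho>\<close> exists by Fekete's lemma. Barycentric coordinates are
  integers at the vertices of level \<open>m\<close> after scaling by \<open>2 ^ m\<close>; hence two cells of level \<open>m\<close> that are closer than
  a constant times \<open>2 ^ (- m)\<close> share a vertex, also across the two halves of the double gasket.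

  Above the threshold, the averages of a Besov function over cells of level \<open>m\<close> have discrete energy
  \<open>O(\<lambda> ^ m)\<close>. Comparing with \<open>c m\<close>, which is about \<open>\<rho> powr (- m)\<close>, the averages near any two vertices of a cell
  have the same limit, and this forces the function to be constant. Since vertices are shared between neighbouring cells, in
  particular at \<open>o\<close>, the constant is the same everywhere.

  Below the threshold, fix \<open>m\<close> with \<open>C * c m < \<lambda> ^ m\<close> and extend the vertex values of a continuous function
  self-similarly, \<open>m\<close> levels at a time, by near-minimisers obeying the maximum principle. Since \<open>\<rho> > 1\<close> the limit is
  continuous; it is uniformly close to the given function, and its energies decay fast enough for it to be in
  the Besov space. So that space is dense.
\<close>

section \<open>Hausdorff measure\<close>

text \<open>The number \<lambda> comes from a balance of masses. On pairs at distance about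
  \<open>2 powr (- m)\<close> the denominator of the Besov integrand is about
  \<open>2 powr (- m * \<theta> * p) * N powr (- m)\<close>, which bounds the unweighted double
  integral over such pairs. Passing to averages over two cells divides by both masses,
  \<open>N powr (- 2 * m)\<close> together, and leaves \<open>\<lambda> ^ m\<close>. The obstacle is
  that conductances are submultiplicative only up to the constant \<open>C\<close>. The limit in
  Fekete's lemma is an infimum, so \<open>C * c m \<ge> \<rho> powr (- m)\<close> holds at every
  positive level, and this suffices above the threshold. Below it, refining one level at a time
  would pay \<open>C\<close> at each step; refining by blocks pays it once per block, and
  \<open>m\<close> is chosen so that \<open>C * c m\<close> is below 1 as well. A Besov function has
  no point values a priori. Above the threshold \<rho> > 1 forces \<lambda> < 1, so averages over
  cells shrinking to a given point converge geometrically, and their limits serve as point values.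
  Below the threshold the maximum principle lets the values at the vertices of a cell control the
  limit function on the whole cell.\<close>

definition hausdorff_pre :: "real \<Rightarrow> real \<Rightarrow> 'a::metric_space set \<Rightarrow> ennreal" where
  "hausdorff_pre s \<delta> A =
     (INF U\<in>{U :: nat \<Rightarrow> 'a set. A \<subseteq> (\<Union>i. U i) \<and> (\<forall>i. bounded (U i) \<and> diameter (U i) \<le> \<delta>)}.
        (\<Sum>i. ennreal (diameter (U i) powr s)))"

lemma hausdorff_outer_eq_SUP_pre: "hausdorff_outer s A = (SUP \<delta>\<in>{0<..}. hausdorff_pre s \<delta> A)"
  unfolding hausdorff_outer_def hausdorff_pre_def ..

lemma hausdorff_pre_le:
  assumes "A \<subseteq> (\<Union>i. U i)" "\<And>i. bounded (U i)" "\<And>i. diameter (U i) \<le> \<delta>"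
  shows "hausdorff_pre s \<delta> A \<le> (\<Sum>i. ennreal (diameter (U i) powr s))"
  unfolding hausdorff_pre_def using assms by (intro INF_lower) auto

lemma hausdorff_pre_greatest:
  assumes "\<And>U :: nat \<Rightarrow> 'a::metric_space set.
      A \<subseteq> (\<Union>i. U i) \<Longrightarrow> (\<And>i. bounded (U i)) \<Longrightarrow> (\<And>i. diameter (U i) \<le> \<delta>) \<Longrightarrow>
      c \<le> (\<Sum>i. ennreal (diameter (U i) powr s))"
  shows "c \<le> hausdorff_pre s \<delta> A"
  unfolding hausdorff_pre_def using assms by (intro INF_greatest) auto

lemma hausdorff_pre_antimono: "\<delta> \<le> \<delta>' \<Longrightarrow> hausdorff_pre s \<delta>' A \<le> hausdorff_pre s \<delta> A"
  by (rule hausdorff_pre_greatest, rule hausdorff_pre_le) (auto intro: order_trans)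

lemma hausdorff_pre_mono: "A \<subseteq> B \<Longrightarrow> hausdorff_pre s \<delta> A \<le> hausdorff_pre s \<delta> B"
  by (rule hausdorff_pre_greatest, rule hausdorff_pre_le) auto

lemma hausdorff_pre_empty: "0 \<le> \<delta> \<Longrightarrow> hausdorff_pre s \<delta> {} = 0"
  using hausdorff_pre_le[of "{}" "\<lambda>_. {}" \<delta> s] by simp

lemma hausdorff_pre_le_outer: "0 < \<delta> \<Longrightarrow> hausdorff_pre s \<delta> A \<le> hausdorff_outer s A"
  unfolding hausdorff_outer_eq_SUP_pre by (intro SUP_upper) auto

lemma hausdorff_outer_least:
  "(\<And>\<delta>. 0 < \<delta> \<Longrightarrow> hausdorff_pre s \<delta> A \<le> c) \<Longrightarrow> hausdorff_outer s A \<le> c"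
  unfolding hausdorff_outer_eq_SUP_pre by (intro SUP_least) auto

lemma hausdorff_outer_mono: "A \<subseteq> B \<Longrightarrow> hausdorff_outer s A \<le> hausdorff_outer s B"
  by (meson hausdorff_outer_least hausdorff_pre_le_outer hausdorff_pre_mono order_trans)

lemma hausdorff_outer_empty: "hausdorff_outer s {} = 0"
  using hausdorff_outer_least[of s "{}" 0] hausdorff_pre_empty by (metis le_zero_eq less_le_not_le)

lemma hausdorff_pre_approx:
  assumes "hausdorff_pre s \<delta> A < c"
  obtains U :: "nat \<Rightarrow> 'a::metric_space set" where "A \<subseteq> (\<Union>i. U i)" "\<And>i. bounded (U i)"
    "\<And>i. diameter (U i) \<le> \<delta>" "(\<Sum>i. ennreal (diameter (U i) powr s)) < c"
  using assms unfolding hausdorff_pre_def INF_less_iff by auto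

lemma hausdorff_pre_countably_subadditive:
  fixes A :: "nat \<Rightarrow> 'a::metric_space set"
  shows "hausdorff_pre s \<delta> (\<Union>i. A i) \<le> (\<Sum>i. hausdorff_pre s \<delta> (A i))"
proof (cases "(\<Sum>i. hausdorff_pre s \<delta> (A i)) = \<infinity>")
  case False
  show ?thesis
  proof (rule ennreal_le_epsilon)
    fix e :: real assume e: "0 < e"
    have fin: "hausdorff_pre s \<delta> (A i) < \<infinity>" for i
      using False by (metis ennreal_suminf_lessD infinity_ennreal_def less_top)
    have "\<exists>U. A i \<subseteq> (\<Union>j. U j) \<and> (\<forall>j. bounded (U j)) \<and> (\<forall>j. diameter (U j) \<le> \<delta>) \<and>
        (\<Sum>j. ennreal (diameter (U j) powr s)) \<le> hausdorff_pre s \<delta> (A i) + ennreal (e * (1/2) ^ Suc i)" for i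
    proof -
      have pos: "0 < ennreal (e * (1/2) ^ Suc i)" using e by simp
      have "hausdorff_pre s \<delta> (A i) + 0 < hausdorff_pre s \<delta> (A i) + ennreal (e * (1/2) ^ Suc i)"
        using fin[of i] pos unfolding ennreal_add_left_cancel_less by (simp add: less_top)
      then obtain U where "A i \<subseteq> (\<Union>j. U j)" "\<And>j. bounded (U j)" "\<And>j. diameter (U j) \<le> \<delta>"
          "(\<Sum>j. ennreal (diameter (U j) powr s)) < hausdorff_pre s \<delta> (A i) + ennreal (e * (1/2) ^ Suc i)"
        by (metis add.right_neutral hausdorff_pre_approx)
      then show ?thesis by (meson less_imp_le)
    qed
    then obtain U where U: "\<And>i. A i \<subseteq> (\<Union>j. U i j)" "\<And>i j. bounded (U i j)" "\<And>i j. diameter (U i j) \<le> \<delta>"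
        "\<And>i. (\<Sum>j. ennreal (diameter (U i j) powr s)) \<le> hausdorff_pre s \<delta> (A i) + ennreal (e * (1/2) ^ Suc i)"
      by metis
    define V where "V i = (case prod_decode i of (a, b) \<Rightarrow> U a b)" for i
    have cov: "(\<Union>i. A i) \<subseteq> (\<Union>i. V i)"
    proof
      fix x assume "x \<in> (\<Union>i. A i)"
      then obtain a b where "x \<in> U a b" using U(1) by blast
      then have "x \<in> V (prod_encode (a, b))" by (simp add: V_def)
      then show "x \<in> (\<Union>i. V i)" by blast
    qed
    have "hausdorff_pre s \<delta> (\<Union>i. A i) \<le> (\<Sum>i. ennreal (diameter (V i) powr s))"
      by (rule hausdorff_pre_le[OF cov]) (auto simp: V_def U split: prod.splits)
    also have "\<dots> = (\<Sum>i. (\<lambda>(a,b). ennreal (diameter (U a b) powr s)) (prod_decode i))"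
      by (intro suminf_cong) (auto simp: V_def split: prod.splits)
    also have "\<dots> = (\<Sum>a. \<Sum>b. ennreal (diameter (U a b) powr s))"
      by (rule suminf_ennreal_2dimen) simp
    also have "\<dots> \<le> (\<Sum>a. hausdorff_pre s \<delta> (A a) + ennreal (e * (1/2) ^ Suc a))"
      by (intro suminf_le U) auto
    also have "\<dots> = (\<Sum>a. hausdorff_pre s \<delta> (A a)) + (\<Sum>a. ennreal (e * (1/2) ^ Suc a))"
      by (intro suminf_add[symmetric]) auto
    also have "(\<Sum>a. ennreal (e * (1/2) ^ Suc a)) = ennreal e"
    proof (rule suminf_ennreal_eq)
      show "(\<lambda>a. e * (1/2) ^ Suc a) sums e"
        using sums_mult[OF power_half_series, of e] by simp
    qed (use e in auto)
    finally show "hausdorff_pre s \<delta> (\<Union>i. A i) \<le> (\<Sum>i. hausdorff_pre s \<delta> (A i)) + ennreal e" .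
  qed
qed auto

lemma hausdorff_outer_countably_subadditive:
  fixes A :: "nat \<Rightarrow> 'a::metric_space set"
  shows "hausdorff_outer s (\<Union>i. A i) \<le> (\<Sum>i. hausdorff_outer s (A i))"
proof (rule hausdorff_outer_least)
  fix \<delta> :: real assume "0 < \<delta>"
  then have "(\<Sum>i. hausdorff_pre s \<delta> (A i)) \<le> (\<Sum>i. hausdorff_outer s (A i))"
    by (intro suminf_le hausdorff_pre_le_outer) auto
  then show "hausdorff_pre s \<delta> (\<Union>i. A i) \<le> (\<Sum>i. hausdorff_outer s (A i))"
    using hausdorff_pre_countably_subadditive order_trans by blast
qed

lemma hausdorff_outer_measure_space: "outer_measure_space UNIV (hausdorff_outer s)"
  unfolding outer_measure_space_def positive_def increasing_def countably_subadditive_def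
  using hausdorff_outer_empty hausdorff_outer_mono hausdorff_outer_countably_subadditive by blast

text \<open>A set of diameter at most \<delta> is too small to meet both \<open>A\<close> and
  \<open>B\<close>, so a cover of the union splits into two covers without common members. Discarded
  members become \<open>{}\<close>, which costs \<open>0 powr s = 0\<close>.\<close>

lemma hausdorff_pre_separated:
  assumes "\<delta> < d" and sep: "\<And>x y. x \<in> A \<Longrightarrow> y \<in> B \<Longrightarrow> d \<le> dist x y"
  shows "hausdorff_pre s \<delta> A + hausdorff_pre s \<delta> B \<le> hausdorff_pre s \<delta> (A \<union> B)"
proof (rule hausdorff_pre_greatest)
  fix U :: "nat \<Rightarrow> 'a set"
  assume cov: "A \<union> B \<subseteq> (\<Union>i. U i)" and bd: "\<And>i. bounded (U i)" and di: "\<And>i. diameter (U i) \<le> \<delta>"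
  define V where "V S i = (if U i \<inter> S = {} then {} else U i)" for S i
  have one: "U i \<inter> A = {} \<or> U i \<inter> B = {}" for i
  proof (rule ccontr)
    assume "\<not> ?thesis"
    then obtain x y where xy: "x \<in> U i" "x \<in> A" "y \<in> U i" "y \<in> B" by auto
    then have "dist x y \<le> \<delta>" using diameter_bounded_bound[OF bd, of x i y] di[of i] by linarith
    then show False using sep[of x y] xy assms(1) by auto
  qed
  have le: "hausdorff_pre s \<delta> S \<le> (\<Sum>i. ennreal (diameter (V S i) powr s))" if "S \<subseteq> A \<union> B" for S
  proof (rule hausdorff_pre_le)
    show "S \<subseteq> (\<Union>i. V S i)" using cov that by (fastforce simp: V_def)
    show "diameter (V S i) \<le> \<delta>" for i
      using di[of i] diameter_ge_0[OF bd, of i] by (auto simp: V_def)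
  qed (use bd in \<open>auto simp: V_def\<close>)
  have "hausdorff_pre s \<delta> A + hausdorff_pre s \<delta> B
      \<le> (\<Sum>i. ennreal (diameter (V A i) powr s)) + (\<Sum>i. ennreal (diameter (V B i) powr s))"
    by (intro add_mono le) auto
  also have "\<dots> = (\<Sum>i. ennreal (diameter (V A i) powr s) + ennreal (diameter (V B i) powr s))"
    by (intro suminf_add) auto
  also have "\<dots> \<le> (\<Sum>i. ennreal (diameter (U i) powr s))"
    by (intro suminf_le) (use one in \<open>auto simp: V_def\<close>)
  finally show "hausdorff_pre s \<delta> A + hausdorff_pre s \<delta> B \<le> (\<Sum>i. ennreal (diameter (U i) powr s))" .
qed

text \<open>The pre-measures grow as \<delta> shrinks, so the two suprema can be taken along a
  common \<delta>, and only values below the separation \<open>d\<close> matter.\<close>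

lemma hausdorff_outer_separated:
  assumes "0 < d" and sep: "\<And>x y. x \<in> A \<Longrightarrow> y \<in> B \<Longrightarrow> d \<le> dist x y"
  shows "hausdorff_outer s A + hausdorff_outer s B \<le> hausdorff_outer s (A \<union> B)"
proof -
  have "hausdorff_outer s A + hausdorff_outer s B =
      (SUP \<delta>\<in>{0<..}. hausdorff_pre s \<delta> A + hausdorff_pre s \<delta> B)"
    unfolding hausdorff_outer_eq_SUP_pre
  proof (rule SUP_add_directed_ennreal[symmetric])
    fix \<delta>1 \<delta>2 :: real assume "\<delta>1 \<in> {0<..}" "\<delta>2 \<in> {0<..}"
    then show "\<exists>\<delta>\<in>{0<..}. hausdorff_pre s \<delta>1 A + hausdorff_pre s \<delta>2 B
        \<le> hausdorff_pre s \<delta> A + hausdorff_pre s \<delta> B"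
      by (intro bexI[of _ "min \<delta>1 \<delta>2"] add_mono hausdorff_pre_antimono) auto
  qed
  also have "\<dots> \<le> hausdorff_outer s (A \<union> B)"
  proof (rule SUP_least)
    fix \<delta> :: real assume "\<delta> \<in> {0<..}"
    define \<delta>' where "\<delta>' = min \<delta> (d / 2)"
    have *: "0 < \<delta>'" "\<delta>' \<le> \<delta>" "\<delta>' < d" using \<open>\<delta> \<in> _\<close> assms(1) by (auto simp: \<delta>'_def)
    have "hausdorff_pre s \<delta> A + hausdorff_pre s \<delta> B \<le> hausdorff_pre s \<delta>' A + hausdorff_pre s \<delta>' B"
      using * by (intro add_mono hausdorff_pre_antimono) auto
    also have "\<dots> \<le> hausdorff_pre s \<delta>' (A \<union> B)"
      by (rule hausdorff_pre_separated[OF *(3) sep])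
    also have "\<dots> \<le> hausdorff_outer s (A \<union> B)" by (rule hausdorff_pre_le_outer[OF *(1)])
    finally show "hausdorff_pre s \<delta> A + hausdorff_pre s \<delta> B \<le> hausdorff_outer s (A \<union> B)" .
  qed
  finally show ?thesis .
qed

text \<open>Each set has one positive distance from all its predecessors, so superadditivity for two
  separated sets can be iterated. It is applied to distance shells below.\<close>

lemma outer_finite_Union_separated:
  fixes f :: "'a::metric_space set \<Rightarrow> ennreal" and R :: "nat \<Rightarrow> 'a set"
  assumes emp: "f {} = 0"
    and metr: "\<And>A B d. 0 < d \<Longrightarrow> (\<And>x y. x \<in> A \<Longrightarrow> y \<in> B \<Longrightarrow> d \<le> dist x y) \<Longrightarrow> f A + f B \<le> f (A \<union> B)"
    and sep: "\<And>k. \<exists>d>0. \<forall>i<k. \<forall>x\<in>R i. \<forall>y\<in>R k. d \<le> dist x y"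
  shows "(\<Sum>i<k. f (R i)) \<le> f (\<Union>i<k. R i)"
proof (induction k)
  case (Suc k)
  obtain d where d: "d > 0" "\<forall>i<k. \<forall>x\<in>R i. \<forall>y\<in>R k. d \<le> dist x y" using sep by blast
  have "(\<Sum>i<Suc k. f (R i)) \<le> f (\<Union>i<k. R i) + f (R k)" using Suc by (simp add: add_right_mono)
  also have "\<dots> \<le> f ((\<Union>i<k. R i) \<union> R k)" by (rule metr[OF d(1)]) (use d(2) in auto)
  also have "(\<Union>i<k. R i) \<union> R k = (\<Union>i<Suc k. R i)" by (auto simp: less_Suc_eq)
  finally show ?case .
qed (simp add: emp)

text \<open>
  Caratheodory's criterion for metric outer measures: the distance shells around a closed set
  with indices of the same parity are positively separated, which makes the series of their outer measures converge.
\<close>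

lemma metric_outer_measure_closed:
  fixes f :: "'a::metric_space set \<Rightarrow> ennreal"
  assumes om: "outer_measure_space UNIV f"
    and metr: "\<And>A B d. 0 < d \<Longrightarrow> (\<And>x y. x \<in> A \<Longrightarrow> y \<in> B \<Longrightarrow> d \<le> dist x y) \<Longrightarrow> f A + f B \<le> f (A \<union> B)"
    and F: "closed F"
  shows "f (A \<inter> F) + f (A - F) = f A"
proof -
  have emp: "f {} = 0" using om by (simp add: outer_measure_space_def positive_def)
  have mono: "X \<subseteq> Y \<Longrightarrow> f X \<le> f Y" for X Y
    using om by (simp add: outer_measure_space_def increasing_def)
  have csub: "f (\<Union>i. X i) \<le> (\<Sum>i. f (X i))" for X :: "nat \<Rightarrow> 'a set"
  proof -
    have "f (\<Union>i. disjointed X i) \<le> (\<Sum>i. f (disjointed X i))"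
      using om disjoint_family_disjointed[of X]
      by (simp add: outer_measure_space_def countably_subadditive_def)
    also have "\<dots> \<le> (\<Sum>i. f (X i))" by (intro suminf_le mono disjointed_subset) auto
    finally show ?thesis by (simp add: UN_disjointed_eq)
  qed
  have sub2: "f (X \<union> Y) \<le> f X + f Y" for X Y
  proof -
    have "f (\<Union>i. binaryset X Y i) \<le> (\<Sum>i. f (binaryset X Y i))" by (rule csub)
    then show ?thesis by (simp add: UN_binaryset_eq suminf_binaryset_eq emp)
  qed
  have ge: "f A \<le> f (A \<inter> F) + f (A - F)" using sub2[of "A \<inter> F" "A - F"] by (simp add: Int_Diff_Un)
  show ?thesis
  proof (cases "F = {} \<or> f A = \<infinity>")
    case True
    then show ?thesis using ge emp by (auto simp: top_unique)
  next
    case False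
    then have Fne: "F \<noteq> {}" and fin: "f A < \<infinity>" by (auto simp: less_top)
    define D where "D x = infdist x F" for x
    \<comment> \<open>\<open>An m\<close> keeps a distance from \<open>F\<close>; the shells
      \<open>R i\<close> with \<open>m \<le> i\<close> fill the gap between \<open>An m\<close> and
      \<open>F\<close>.\<close>
    define An where "An m = {x \<in> A. 1 / (real m + 1) \<le> D x}" for m
    define R where "R m = {x \<in> A. 1 / (real m + 2) \<le> D x \<and> D x < 1 / (real m + 1)}" for m
    have Dpos: "0 < D x" if "x \<notin> F" for x
      using in_closed_iff_infdist_zero[OF F Fne] infdist_nonneg[of x F] that unfolding D_def
      by (metis less_eq_real_def)
    have Dlip: "\<bar>D x - D y\<bar> \<le> dist x y" for x y
      unfolding D_def by (rule infdist_triangle_abs)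
    have cover: "A - F \<subseteq> An m \<union> (\<Union>i. R (i + m))" for m
    proof
      fix x assume x: "x \<in> A - F"
      then have D: "0 < D x" using Dpos by auto
      show "x \<in> An m \<union> (\<Union>i. R (i + m))"
      proof (cases "1 / (real m + 1) \<le> D x")
        case False
        obtain N where N: "1 / (real N + 1) \<le> D x"
          by (metis D add.commute inverse_eq_divide less_imp_le of_nat_Suc reals_Archimedean)
        define k where "k = (LEAST k. 1 / (real k + 1) \<le> D x)"
        have k: "1 / (real k + 1) \<le> D x" unfolding k_def by (rule LeastI[of _ N]) (rule N)
        have km: "k > m"
        proof (rule ccontr)
          assume "\<not> k > m"
          then have "1 / (real m + 1) \<le> 1 / (real k + 1)" by (intro divide_left_mono) auto
          with k False show False by linarith
        qed
        then obtain k' where k': "k = Suc k'" by (cases k) auto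
        have "\<not> 1 / (real k' + 1) \<le> D x"
          using not_less_Least[of k' "\<lambda>k. 1 / (real k + 1) \<le> D x"] k' by (simp add: k_def)
        moreover have "1 / (real k' + 2) \<le> D x" using k by (simp add: k' algebra_simps)
        ultimately have "x \<in> R (k - 1)" using x by (simp add: R_def k')
        then have "x \<in> R ((k - 1 - m) + m)" using km by simp
        then show ?thesis by blast
      qed (use x in \<open>auto simp: An_def\<close>)
    qed
    \<comment> \<open>Between two shells of equal parity lies a whole skipped shell, and its width
      is the gap. For \<open>k = 0\<close> the claim is vacuous and 1 is a placeholder, as the
      formula could involve \<open>1 / 0\<close>.\<close>
    have Rsep: "\<exists>d>0. \<forall>i<k. \<forall>x\<in>R (2 * i + c). \<forall>y\<in>R (2 * k + c). d \<le> dist x y" for k c :: nat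
    proof (intro exI conjI allI impI ballI)
      have "1 / (real (2 * k + c) + 1) < 1 / real (2 * k + c)" if "k > 0"
        using that by (intro divide_strict_left_mono) auto
      then show "0 < (if k > 0 then 1 / (real (2 * k + c)) - 1 / (real (2 * k + c) + 1) else 1)"
        by auto
      fix i x y assume i: "i < k" and x: "x \<in> R (2 * i + c)" and y: "y \<in> R (2 * k + c)"
      have "1 / (real (2 * k + c)) \<le> 1 / (real (2 * i + c) + 2)"
        using i by (intro divide_left_mono) auto
      then have "1 / (real (2 * k + c)) \<le> D x" using x by (auto simp: R_def)
      moreover have "D y < 1 / (real (2 * k + c) + 1)" using y by (auto simp: R_def)
      moreover have "D x - D y \<le> dist x y" using Dlip[of x y] by linarith
      ultimately show "(if k > 0 then 1 / (real (2 * k + c)) - 1 / (real (2 * k + c) + 1) else 1) \<le> dist x y"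
        using i by auto
    qed
    have Rsum: "(\<Sum>i. f (R (2 * i + c))) \<le> f A" for c
    proof (rule suminf_le_const)
      show "(\<Sum>i<k. f (R (2 * i + c))) \<le> f A" for k
      proof -
        have "(\<Sum>i<k. f (R (2 * i + c))) \<le> f (\<Union>i<k. R (2 * i + c))"
          using outer_finite_Union_separated[of f "\<lambda>i. R (2 * i + c)", OF emp metr Rsep] .
        also have "\<dots> \<le> f A" by (rule mono) (auto simp: R_def)
        finally show ?thesis .
      qed
    qed simp
    \<comment> \<open>The even and the odd shells each sum to at most \<open>f A\<close>, so the
      full series converges and its tails vanish.\<close>
    have Rtot: "(\<Sum>i. f (R i)) \<le> f A + f A"
    proof (rule suminf_le_const)
      fix k
      have "(\<Sum>i<k. f (R i)) \<le> (\<Sum>i<2*k. f (R i))"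
        by (intro sum_mono2) auto
      also have "\<dots> = (\<Sum>i<k. f (R (2 * i + 0))) + (\<Sum>i<k. f (R (2 * i + 1)))"
        by (induction k) (auto simp: ac_simps)
      also have "\<dots> \<le> (\<Sum>i. f (R (2 * i + 0))) + (\<Sum>i. f (R (2 * i + 1)))"
        by (intro add_mono sum_le_suminf) auto
      also have "\<dots> \<le> f A + f A" by (intro add_mono Rsum)
      finally show "(\<Sum>i<k. f (R i)) \<le> f A + f A" .
    qed simp
    then have Rfin: "(\<Sum>i. f (R i)) \<noteq> \<infinity>" using fin
      by (metis ennreal_add_eq_top infinity_ennreal_def less_irrefl top_unique)
    have "(\<lambda>m. \<Sum>i. f (R (i + m))) \<longlonglongrightarrow> 0"
    proof -
      have fr: "f (R i) = ennreal (enn2real (f (R i)))" for i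
        using Rfin by (metis ennreal_enn2real ennreal_suminf_lessD infinity_ennreal_def less_top)
      define g where "g i = enn2real (f (R i))" for i
      have fr: "f (R i) = ennreal (g i)" for i using fr[of i] by (simp add: g_def)
      have sg: "summable g"
      proof (rule summable_suminf_not_top)
        show "(\<Sum>i. ennreal (g i)) \<noteq> top" using Rfin fr by simp
      qed (simp add: g_def)
      have "(\<Sum>i. f (R (i + m))) = ennreal (\<Sum>i. g (i + m))" for m
        unfolding fr using summable_ignore_initial_segment[OF sg] by (intro suminf_ennreal2) (auto simp: g_def)
      moreover have "(\<lambda>m. \<Sum>i. g (i + m)) \<longlonglongrightarrow> 0"
        using suminf_exist_split2[OF sg] .
      ultimately show ?thesis using tendsto_ennrealI by fastforce
    qed
    then have lim: "(\<lambda>m. f A + (\<Sum>i. f (R (i + m)))) \<longlonglongrightarrow> f A + 0"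
      by (intro tendsto_add tendsto_const)
    have le: "f (A \<inter> F) + f (A - F) \<le> f A + (\<Sum>i. f (R (i + m)))" for m
    proof -
      have "f (A - F) \<le> f (An m) + f (\<Union>i. R (i + m))"
        using mono[OF cover[of m]] sub2 order_trans by blast
      also have "\<dots> \<le> f (An m) + (\<Sum>i. f (R (i + m)))" using csub by (intro add_left_mono)
      finally have "f (A \<inter> F) + f (A - F) \<le> (f (A \<inter> F) + f (An m)) + (\<Sum>i. f (R (i + m)))"
        by (simp add: add_left_mono add.assoc)
      also have "f (A \<inter> F) + f (An m) \<le> f (A \<inter> F \<union> An m)"
      proof (rule metr)
        show "0 < 1 / (real m + 1)" by simp
        fix x y assume "x \<in> A \<inter> F" "y \<in> An m"
        then have "D x = 0" "1 / (real m + 1) \<le> D y" by (auto simp: D_def An_def)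
        then show "1 / (real m + 1) \<le> dist x y" using Dlip[of x y] by linarith
      qed
      also have "f (A \<inter> F \<union> An m) \<le> f A" by (rule mono) (auto simp: An_def)
      finally show ?thesis by (simp add: add_right_mono)
    qed
    have "f (A \<inter> F) + f (A - F) \<le> f A + 0"
      using lim le by (intro LIMSEQ_le_const) auto
    then show ?thesis using ge by (simp add: antisym)
  qed
qed

section \<open>Hausdorff measure on Borel sets and under similarities\<close>

lemma sets_hausdorff_measure [simp, measurable_cong]:
  "sets (hausdorff_measure s :: 'a::metric_space measure) = sets borel"
  unfolding hausdorff_measure_def
  using sets.sigma_sets_eq[of "borel :: 'a measure"] by (simp add: sets_measure_of_conv)

lemma space_hausdorff_measure [simp]: "space (hausdorff_measure s) = UNIV"
  unfolding hausdorff_measure_def by (simp add: space_measure_of_conv)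

text \<open>\<open>measure_of\<close> takes over the given set function only if it is a measure, so
  countable additivity on Borel sets comes first: the Caratheodory sets form a sigma-algebra and
  contain the closed sets because the outer measure is metric.\<close>

lemma emeasure_hausdorff_measure:
  fixes A :: "'a::metric_space set"
  assumes "A \<in> sets borel"
  shows "emeasure (hausdorff_measure s) A = hausdorff_outer s A"
proof -
  interpret sigma_algebra "UNIV :: 'a set" "UNIV :: 'a set set" using sigma_algebra_Pow[of UNIV] by simp
  define L where "L = lambda_system UNIV UNIV (hausdorff_outer s :: 'a set \<Rightarrow> ennreal)"
  have ms: "measure_space UNIV L (hausdorff_outer s)"
    unfolding L_def by (rule caratheodory_lemma[OF hausdorff_outer_measure_space])
  have clo: "F \<in> L" if "closed F" for F
    unfolding L_def lambda_system_eq
    using metric_outer_measure_closed[OF hausdorff_outer_measure_space hausdorff_outer_separated that] by auto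
  have sub: "sets borel \<subseteq> L"
  proof -
    have "sigma_sets UNIV (Collect closed) \<subseteq> L"
      using ms clo by (intro sigma_algebra.sigma_sets_subset) (auto simp: measure_space_def)
    then show ?thesis by (simp add: borel_eq_closed)
  qed
  have "measure_space UNIV (sets borel) (hausdorff_outer s :: 'a set \<Rightarrow> ennreal)"
    using ms sub sets.sigma_algebra_axioms[of "borel :: 'a measure"]
    unfolding measure_space_def positive_def countably_additive_def by (auto simp: space_borel)
  then show ?thesis
    unfolding hausdorff_measure_def using assms
    by (auto simp: measure_space_def intro!: emeasure_measure_of_sigma)
qed

text \<open>The image of a cover at scale \<open>\<delta> / r\<close> is a cover at scale \<delta>,
  each diameter being multiplied by at most \<open>r\<close>; the change of scale disappears in the
  supremum.\<close>

lemma hausdorff_outer_image_le: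
  fixes g :: "'a::metric_space \<Rightarrow> 'b::metric_space"
  assumes s: "0 \<le> s" and r: "0 < r" and g: "\<And>x y. dist (g x) (g y) = r * dist x y"
  shows "hausdorff_outer s (g ` A) \<le> ennreal (r powr s) * hausdorff_outer s A"
proof (rule hausdorff_outer_least)
  fix \<delta> :: real assume d: "0 < \<delta>"
  have bdd: "bounded (g ` U)" if "bounded U" for U
    using that unfolding bounded_def by (metis (no_types, lifting) g image_iff mult_left_mono r less_imp_le)
  have diam: "diameter (g ` U) \<le> r * diameter U" if "bounded U" for U
    unfolding diameter_def[of "g ` U"]
    using that r diameter_ge_0[OF that] diameter_bounded_bound[OF that]
    by (auto intro!: cSUP_least simp: g)
  have rs: "ennreal (r powr s) * ennreal (1 / r powr s) = 1"
    using r by (simp flip: ennreal_mult)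
  have "hausdorff_pre s \<delta> (g ` A) * ennreal (1 / r powr s) \<le> hausdorff_pre s (\<delta> / r) A"
  proof (rule hausdorff_pre_greatest)
    fix U :: "nat \<Rightarrow> 'a set"
    assume U: "A \<subseteq> (\<Union>i. U i)" "\<And>i. bounded (U i)" "\<And>i. diameter (U i) \<le> \<delta> / r"
    have "hausdorff_pre s \<delta> (g ` A) \<le> (\<Sum>i. ennreal (diameter (g ` U i) powr s))"
    proof (rule hausdorff_pre_le)
      show "g ` A \<subseteq> (\<Union>i. g ` U i)" using U(1) by blast
      show "diameter (g ` U i) \<le> \<delta>" for i
        using diam[OF U(2)[of i]] U(3)[of i] r by (auto simp: field_simps)
    qed (use U bdd in auto)
    also have "\<dots> \<le> (\<Sum>i. ennreal (r powr s) * ennreal (diameter (U i) powr s))"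
    proof (intro suminf_le)
      fix i
      have "diameter (g ` U i) powr s \<le> (r * diameter (U i)) powr s"
        using diam[OF U(2)[of i]] s diameter_ge_0[OF bdd[OF U(2)[of i]]] by (intro powr_mono2) auto
      also have "\<dots> = r powr s * diameter (U i) powr s"
        using r diameter_ge_0[OF U(2)[of i]] by (simp add: powr_mult)
      finally show "ennreal (diameter (g ` U i) powr s) \<le> ennreal (r powr s) * ennreal (diameter (U i) powr s)"
        by (simp flip: ennreal_mult)
    qed auto
    also have "\<dots> = ennreal (r powr s) * (\<Sum>i. ennreal (diameter (U i) powr s))" by simp
    finally have "hausdorff_pre s \<delta> (g ` A) * ennreal (1 / r powr s)
        \<le> ennreal (r powr s) * (\<Sum>i. ennreal (diameter (U i) powr s)) * ennreal (1 / r powr s)"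
      by (rule mult_right_mono) simp
    also have "\<dots> = (ennreal (r powr s) * ennreal (1 / r powr s)) * (\<Sum>i. ennreal (diameter (U i) powr s))"
      by (simp only: ac_simps)
    finally show "hausdorff_pre s \<delta> (g ` A) * ennreal (1 / r powr s) \<le> (\<Sum>i. ennreal (diameter (U i) powr s))"
      using rs by simp
  qed
  then have "ennreal (r powr s) * (hausdorff_pre s \<delta> (g ` A) * ennreal (1 / r powr s))
      \<le> ennreal (r powr s) * hausdorff_pre s (\<delta> / r) A"
    by (rule mult_left_mono) simp
  also have "ennreal (r powr s) * (hausdorff_pre s \<delta> (g ` A) * ennreal (1 / r powr s)) =
      (ennreal (r powr s) * ennreal (1 / r powr s)) * hausdorff_pre s \<delta> (g ` A)"
    by (simp only: ac_simps)
  finally have "hausdorff_pre s \<delta> (g ` A) \<le> ennreal (r powr s) * hausdorff_pre s (\<delta> / r) A"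
    using rs by simp
  also have "\<dots> \<le> ennreal (r powr s) * hausdorff_outer s A"
    using r d by (intro mult_left_mono hausdorff_pre_le_outer) auto
  finally show "hausdorff_pre s \<delta> (g ` A) \<le> ennreal (r powr s) * hausdorff_outer s A" .
qed

text \<open>The reverse inequality is the previous one for the inverse; surjectivity makes
  \<open>inv g\<close> a similarity of the whole space.\<close>

lemma hausdorff_outer_similarity:
  fixes g :: "'a::metric_space \<Rightarrow> 'b::metric_space"
  assumes s: "0 \<le> s" and r: "0 < r" and g: "\<And>x y. dist (g x) (g y) = r * dist x y" and "surj g"
  shows "hausdorff_outer s (g ` A) = ennreal (r powr s) * hausdorff_outer s A"
proof (rule antisym[OF hausdorff_outer_image_le[OF s r g]])
  have inj: "inj g" using g r by (auto intro!: injI) (metis dist_eq_0_iff mult_eq_0_iff less_irrefl)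
  have inv: "dist (inv g x) (inv g y) = 1 / r * dist x y" for x y
    using g[of "inv g x" "inv g y"] r \<open>surj g\<close> by (simp add: surj_f_inv_f field_simps)
  have "hausdorff_outer s (inv g ` g ` A) \<le> ennreal ((1 / r) powr s) * hausdorff_outer s (g ` A)"
    using r by (intro hausdorff_outer_image_le[OF s _ inv]) auto
  then have "hausdorff_outer s A \<le> ennreal ((1 / r) powr s) * hausdorff_outer s (g ` A)"
    using inj by (simp add: image_image)
  then have "ennreal (r powr s) * hausdorff_outer s A
      \<le> ennreal (r powr s) * (ennreal ((1 / r) powr s) * hausdorff_outer s (g ` A))"
    by (rule mult_left_mono) simp
  also have "\<dots> = hausdorff_outer s (g ` A)"
    using r by (simp add: powr_divide mult.assoc[symmetric] flip: ennreal_mult)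
  finally show "ennreal (r powr s) * hausdorff_outer s A \<le> hausdorff_outer s (g ` A)" .
qed

section \<open>Geometry of the gasket\<close>

lemma word_map_Nil [simp]: "word_map q [] x = x"
  by (simp add: word_map_def)

lemma word_map_Cons [simp]: "word_map q (i # w) x = gasket_map q i (word_map q w x)"
  by (simp add: word_map_def)

lemma word_map_append: "word_map q (u @ v) x = word_map q u (word_map q v x)"
  by (induction u) auto

lemma dist_gasket_map: "dist (gasket_map q i x) (gasket_map q i y) = 1 / 2 * dist x y"
  by (simp add: gasket_map_def dist_norm flip: scaleR_diff_right)

lemma dist_word_map: "dist (word_map q w x) (word_map q w y) = (1 / 2) ^ length w * dist x y"
  by (induction w) (auto simp: dist_gasket_map)

lemma words_0: "words N 0 = {[]}"
  by (auto simp: words_def)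

lemma words_Suc: "words N (Suc m) = (\<lambda>(i, w). i # w) ` ({..N} \<times> words N m)"
  by (auto simp: words_def length_Suc_conv image_iff)

lemma finite_words: "finite (words N m)"
  by (induction m) (auto simp: words_0 words_Suc)

lemma card_words: "card (words N m) = (N + 1) ^ m"
proof (induction m)
  case (Suc m)
  have "inj_on (\<lambda>(i, w). i # w) ({..N} \<times> words N m)" by (auto simp: inj_on_def)
  then show ?case using Suc by (simp add: words_Suc card_image card_cartesian_product)
qed (simp add: words_0)

lemma sum_words_Suc: "(\<Sum>w\<in>words N (Suc m). f w) = (\<Sum>i\<le>N. \<Sum>w\<in>words N m. f (i # w))"
proof -
  have "inj_on (\<lambda>(i, w). i # w) ({..N} \<times> words N m)" by (auto simp: inj_on_def)
  then show ?thesis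
    by (simp add: words_Suc sum.reindex sum.cartesian_product case_prod_unfold)
qed

lemma words_append: "u \<in> words N l \<Longrightarrow> v \<in> words N m \<Longrightarrow> u @ v \<in> words N (l + m)"
  by (auto simp: words_def)

lemma words_split:
  assumes "w \<in> words N (l + m)"
  obtains u v where "w = u @ v" "u \<in> words N l" "v \<in> words N m"
proof
  show "w = take l w @ drop l w" by simp
  show "take l w \<in> words N l" "drop l w \<in> words N m"
    using assms by (auto simp: words_def dest: in_set_takeD in_set_dropD)
qed

lemma sum_words_add:
  "(\<Sum>w\<in>words N (l + m). f w) = (\<Sum>u\<in>words N l. \<Sum>v\<in>words N m. f (u @ v))"
  by (induction l arbitrary: f) (simp_all add: words_0 sum_words_Suc)

text \<open>\<open>2 ^ length w\<close> times the barycentric coordinates of \<^term>\<open>word_map q w x\<close> are those of \<open>x\<close> plus these integers.\<close>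

fun digits :: "nat list \<Rightarrow> nat \<Rightarrow> nat" where
  "digits [] j = 0"
| "digits (i # w) j = (if i = j then 2 ^ length w else 0) + digits w j"

lemma digits_less: "digits w j < 2 ^ length w"
  by (induction w) auto

lemma sum_digits: "set w \<subseteq> {..N} \<Longrightarrow> (\<Sum>j\<le>N. digits w j) + 1 = 2 ^ length w"
  by (induction w) (auto simp: sum.distrib)

text \<open>The first letter contributes \<open>2 ^ length w\<close> to its coordinate, more than
  all later letters together (\<open>digits_less\<close>), so it can be read off and
  removed.\<close>

lemma digits_inj:
  assumes "length w = length v" "set w \<subseteq> {..N}" "set v \<subseteq> {..N}" "\<And>j. j \<le> N \<Longrightarrow> digits w j = digits v j"
  shows "w = v"
  using assms
proof (induction w v rule: list_induct2)
  case (Cons i w j v)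
  have "i = j"
  proof (rule ccontr)
    assume "i \<noteq> j"
    moreover have "digits (i # w) i = digits (j # v) i" using Cons.prems(1) by (intro Cons.prems(3)) auto
    ultimately have "2 ^ length w + digits w i = digits v i" by simp
    then show False using digits_less[of v i] \<open>length w = length v\<close> by simp
  qed
  moreover have "w = v"
  proof (rule Cons.IH)
    fix l assume "l \<le> N"
    then have "digits (i # w) l = digits (j # v) l" by (rule Cons.prems)
    then show "digits w l = digits v l" using \<open>i = j\<close> \<open>length w = length v\<close> by (auto split: if_splits)
  qed (use Cons.prems in auto)
  ultimately show ?case by simp
qed simp

text \<open>Uniqueness in Hutchinson's theorem: unfolding the invariance of \<open>A\<close> for
  \<open>m\<close> levels and following the same maps in \<open>B\<close> puts every point of
  \<open>A\<close> within \<open>(1/2)^m * R\<close> of \<open>B\<close>, which is closed.\<close>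

lemma gasket_invariant_subset:
  fixes q :: "nat \<Rightarrow> real^'n::finite"
  assumes A: "compact A" "A = (\<Union>i\<le>CARD('n). gasket_map q i ` A)"
    and B: "compact B" "B \<noteq> {}" "B = (\<Union>i\<le>CARD('n). gasket_map q i ` B)"
  shows "A \<subseteq> B"
proof
  obtain b where b: "b \<in> B" using B(2) by auto
  obtain R where R: "\<And>x. x \<in> A \<Longrightarrow> dist b x \<le> R"
    using bounded_any_center[of A b, THEN iffD1, OF compact_imp_bounded[OF A(1)]] by auto
  have near: "x \<in> A \<Longrightarrow> \<exists>y\<in>B. dist y x \<le> (1/2)^m * R" for m x
  proof (induction m arbitrary: x)
    case 0
    then show ?case using R b by auto
  next
    case (Suc m)
    then obtain i x' where i: "i \<le> CARD('n)" "x' \<in> A" "x = gasket_map q i x'" using A(2) by blast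
    obtain y' where y': "y' \<in> B" "dist y' x' \<le> (1/2)^m * R" using Suc.IH[OF i(2)] by auto
    have "gasket_map q i y' \<in> B" using B(3) i(1) y'(1) by blast
    moreover have "dist (gasket_map q i y') x \<le> (1/2)^Suc m * R"
      using y'(2) by (simp add: i(3) dist_gasket_map)
    ultimately show ?case by blast
  qed
  fix x assume x: "x \<in> A"
  have "x \<in> closure B"
    unfolding closure_approachable
  proof (intro allI impI)
    fix e :: real assume e: "0 < e"
    have "(\<lambda>m. (1/2)^m * R) \<longlonglongrightarrow> 0 * R" by (intro tendsto_mult tendsto_const LIMSEQ_power_zero) simp
    then have "eventually (\<lambda>m. (1/2)^m * R < e) sequentially" using e by (auto dest: order_tendstoD(2))
    then obtain m where "(1/2)^m * R < e" by (auto simp: eventually_sequentially)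
    then show "\<exists>y\<in>B. dist y x < e" using near[OF x, of m] by force
  qed
  then show "x \<in> B" using B(1) by (simp add: compact_imp_closed closure_closed)
qed

lemma gasket_eqI:
  fixes q :: "nat \<Rightarrow> real^'n::finite"
  assumes "K \<noteq> {}" "compact K" "K = (\<Union>i\<le>CARD('n). gasket_map q i ` K)"
  shows "gasket q = K"
  unfolding gasket_def
proof (rule the_equality)
  show "K \<noteq> {} \<and> compact K \<and> K = (\<Union>i\<le>CARD('n). gasket_map q i ` K)" using assms by blast
qed (use assms gasket_invariant_subset in \<open>metis subset_antisym\<close>)

locale gasket_setup =
  fixes k :: "'n::finite" and q :: "nat \<Rightarrow> real^'n" and n :: nat and N :: real
  assumes n_def: "n = CARD('n)" and N_def: "N = real n + 1"
    and dim: "2 \<le> n" and simplex: "gasket_simplex k q"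
begin

lemma N_ge: "3 \<le> N" and N_pos: "0 < N"
  using dim by (auto simp: N_def)

lemma sum_const_N: "(\<Sum>l\<le>n. c) = N * c" for c :: real
  by (simp add: N_def)

lemma q_0 [simp]: "q 0 = 0"
  using simplex by (simp add: gasket_simplex_def n_def)

lemma dist_q: "i \<le> n \<Longrightarrow> j \<le> n \<Longrightarrow> dist (q i) (q j) = (if i = j then 0 else 1)"
  using simplex by (simp add: gasket_simplex_def n_def)

lemma norm_q: "i \<le> n \<Longrightarrow> norm (q i) \<le> 1"
  using dist_q[of i 0] by (auto split: if_splits)

section \<open>Barycentric coordinates\<close>

definition centroid :: "real^'n" where "centroid = (1 / N) *\<^sub>R (\<Sum>l\<le>n. q l)"

text \<open>The quadratic terms cancel, and the values at the vertices can be read off the distances.\<close>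

definition bary :: "nat \<Rightarrow> real^'n \<Rightarrow> real" where
  "bary j x = 1 / N - (dist x (q j))\<^sup>2 + (\<Sum>l\<le>n. (dist x (q l))\<^sup>2) / N"

lemma dist_sq: "(dist x y)\<^sup>2 = x \<bullet> x - 2 * (x \<bullet> y) + y \<bullet> y" for x y :: "real^'n"
  by (simp add: dist_norm power2_norm_eq_inner inner_diff_left inner_diff_right inner_commute)

lemma bary_affine: "bary j x = bary j 0 + 2 * (x \<bullet> (q j - centroid))"
proof -
  have "(\<Sum>l\<le>n. (dist x (q l))\<^sup>2) = N * (x \<bullet> x) - 2 * (x \<bullet> (\<Sum>l\<le>n. q l)) + (\<Sum>l\<le>n. q l \<bullet> q l)"
    by (simp add: dist_sq sum.distrib sum_subtractf inner_sum_right sum_distrib_left sum_const_N del: sum_constant)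
  also have "x \<bullet> (\<Sum>l\<le>n. q l) = N * (x \<bullet> centroid)"
    using N_pos by (simp add: centroid_def)
  finally have "(\<Sum>l\<le>n. (dist x (q l))\<^sup>2) / N = x \<bullet> x - 2 * (x \<bullet> centroid) + (\<Sum>l\<le>n. q l \<bullet> q l) / N"
    using N_pos by (simp add: field_simps)
  moreover have "(\<Sum>l\<le>n. (dist 0 (q l))\<^sup>2) / N = (\<Sum>l\<le>n. q l \<bullet> q l) / N"
    by (simp add: power2_norm_eq_inner)
  ultimately show ?thesis
    by (simp add: bary_def dist_sq inner_diff_right power2_norm_eq_inner)
qed

lemma bary_q: "i \<le> n \<Longrightarrow> j \<le> n \<Longrightarrow> bary j (q i) = (if i = j then 1 else 0)"
proof -
  assume ij: "i \<le> n" "j \<le> n"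
  have "(\<Sum>l\<le>n. (dist (q i) (q l))\<^sup>2) = (\<Sum>l\<le>n. if l = i then 0 else 1)"
    using ij by (intro sum.cong) (auto simp: dist_q)
  also have "\<dots> = (\<Sum>l\<le>n. 1 - (if l = i then 1 else 0 :: real))"
    by (intro sum.cong) auto
  also have "\<dots> = N - 1"
    using ij by (simp add: sum_subtractf sum_const_N del: sum_constant)
  finally have "(\<Sum>l\<le>n. (dist (q i) (q l))\<^sup>2) / N = 1 - 1 / N" using N_pos by (simp add: diff_divide_distrib)
  then show ?thesis using ij unfolding bary_def by (simp add: dist_q)
qed

lemma sum_bary: "(\<Sum>j\<le>n. bary j x) = 1"
  using N_pos by (simp add: bary_def sum.distrib sum_subtractf sum_const_N del: sum_constant)

lemma bary_gasket_map: "bary j (gasket_map q i x) = (bary j x + bary j (q i)) / 2"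
  using bary_affine[of j "gasket_map q i x"] bary_affine[of j x] bary_affine[of j "q i"]
  by (simp add: gasket_map_def inner_add_left)

text \<open>\<open>q j - centroid\<close> is the average of the edge vectors
  \<open>q j - q l\<close>, whose lengths are at most 1.\<close>

lemma norm_q_centroid: "j \<le> n \<Longrightarrow> norm (q j - centroid) \<le> 1"
proof -
  assume j: "j \<le> n"
  have "q j - centroid = (1 / N) *\<^sub>R (\<Sum>l\<le>n. q j - q l)"
  proof -
    have "(\<Sum>l\<le>n. q j - q l) = N *\<^sub>R q j - (\<Sum>l\<le>n. q l)"
      by (simp only: sum_subtractf sum_constant_scaleR) (simp add: N_def add.commute)
    then show ?thesis using N_pos by (simp add: centroid_def scaleR_diff_right)
  qed
  also have "norm \<dots> \<le> (1 / N) * (\<Sum>l\<le>n. norm (q j - q l))"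
    using N_pos by (simp add: divide_right_mono norm_sum)
  also have "\<dots> \<le> (1 / N) * (\<Sum>l\<le>n. 1)"
    using N_pos j dist_q by (intro mult_left_mono sum_mono) (auto simp flip: dist_norm)
  also have "\<dots> = 1" using N_pos by (simp only: sum_const_N) simp
  finally show ?thesis .
qed

lemma bary_lipschitz: "j \<le> n \<Longrightarrow> \<bar>bary j x - bary j y\<bar> \<le> 2 * dist x y"
proof -
  assume j: "j \<le> n"
  have "bary j x - bary j y = 2 * ((x - y) \<bullet> (q j - centroid))"
    using bary_affine[of j x] bary_affine[of j y] by (simp add: inner_diff_left)
  moreover have "\<bar>(x - y) \<bullet> (q j - centroid)\<bar> \<le> norm (x - y) * norm (q j - centroid)"
    by (rule Cauchy_Schwarz_ineq2)
  moreover have "\<dots> \<le> norm (x - y) * 1" using norm_q_centroid[OF j] by (intro mult_left_mono) auto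
  ultimately show ?thesis by (simp add: dist_norm abs_mult)
qed

lemma continuous_on_bary: "continuous_on S (bary j)"
  unfolding bary_def by (intro continuous_intros) (use N_pos in auto)

section \<open>The attractor as the closure of its vertices\<close>

definition Vstar :: "(real^'n) set" where
  "Vstar = {word_map q w (q a) | w a. set w \<subseteq> {..n} \<and> a \<le> n}"

definition K :: "(real^'n) set" where "K = gasket q"

lemma gasket_map_q: "gasket_map q i (q i) = q i"
  by (simp add: gasket_map_def flip: scaleR_2)

lemma Vstar_invariant: "Vstar = (\<Union>i\<le>n. gasket_map q i ` Vstar)"
proof
  show "Vstar \<subseteq> (\<Union>i\<le>n. gasket_map q i ` Vstar)"
  proof
    fix x assume "x \<in> Vstar"
    then obtain w a where w: "set w \<subseteq> {..n}" "a \<le> n" "x = word_map q w (q a)" by (auto simp: Vstar_def)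
    show "x \<in> (\<Union>i\<le>n. gasket_map q i ` Vstar)"
    proof (cases w)
      \<comment> \<open>The empty word gains a letter because \<open>q a\<close> is fixed by the map
        with index \<open>a\<close>.\<close>
      case Nil
      then have "x = gasket_map q a (word_map q [] (q a))" using w gasket_map_q by simp
      moreover have "word_map q [] (q a) \<in> Vstar" using w unfolding Vstar_def by fastforce
      ultimately show ?thesis using w by blast
    next
      case (Cons i v)
      then have "x = gasket_map q i (word_map q v (q a))" "i \<le> n" using w by auto
      moreover have "word_map q v (q a) \<in> Vstar" using w Cons unfolding Vstar_def by fastforce
      ultimately show ?thesis by blast
    qed
  qed
  show "(\<Union>i\<le>n. gasket_map q i ` Vstar) \<subseteq> Vstar"
  proof
    fix x assume "x \<in> (\<Union>i\<le>n. gasket_map q i ` Vstar)"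
    then obtain i w a where "i \<le> n" "set w \<subseteq> {..n}" "a \<le> n" "x = word_map q (i # w) (q a)"
      by (auto simp: Vstar_def)
    then show "x \<in> Vstar" unfolding Vstar_def
      by (intro CollectI exI[of _ "i # w"] exI[of _ a]) auto
  qed
qed

lemma norm_gasket_map: "i \<le> n \<Longrightarrow> norm x \<le> 1 \<Longrightarrow> norm (gasket_map q i x) \<le> 1"
  using norm_triangle_ineq[of x "q i"] norm_q[of i] by (simp add: gasket_map_def)

lemma norm_Vstar: "x \<in> Vstar \<Longrightarrow> norm x \<le> 1"
proof -
  have "set w \<subseteq> {..n} \<Longrightarrow> a \<le> n \<Longrightarrow> norm (word_map q w (q a)) \<le> 1" for w a
    by (induction w) (auto simp: norm_q norm_gasket_map)
  then show "x \<in> Vstar \<Longrightarrow> norm x \<le> 1" by (auto simp: Vstar_def)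
qed

lemma closure_Vstar_invariant: "closure Vstar = (\<Union>i\<le>n. gasket_map q i ` closure Vstar)"
proof -
  have cl: "closure (gasket_map q i ` Vstar) = gasket_map q i ` closure Vstar" for i
  proof -
    have 1: "gasket_map q i ` S = (*\<^sub>R) (1/2) ` ((+) (q i) ` S)" for S
      by (auto simp: gasket_map_def image_image add.commute)
    show ?thesis unfolding 1 by (simp only: closure_scaleR[symmetric] closure_translation)
  qed
  have "closure (\<Union>i\<in>I. gasket_map q i ` Vstar) = (\<Union>i\<in>I. gasket_map q i ` closure Vstar)"
    if "finite I" for I
    using that by (induction I) (auto simp: cl)
  then show ?thesis by (subst (1) Vstar_invariant) simp
qed

text \<open>Existence of the attractor: the vertices of all levels form a bounded invariant set, and
  closure commutes with finite unions and with the maps.\<close>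

lemma K_eq_closure: "K = closure Vstar"
  unfolding K_def
proof (rule gasket_eqI)
  have "q 0 \<in> Vstar" unfolding Vstar_def by (intro CollectI exI[of _ "[]"] exI[of _ 0]) auto
  then show "closure Vstar \<noteq> {}" using closure_subset by blast
  have "bounded Vstar" using norm_Vstar by (auto simp: bounded_iff)
  then show "compact (closure Vstar)" by (simp add: compact_closure)
  show "closure Vstar = (\<Union>i\<le>CARD('n). gasket_map q i ` closure Vstar)"
    using closure_Vstar_invariant unfolding n_def .
qed

lemma Vstar_subset_K: "Vstar \<subseteq> K"
  by (simp add: K_eq_closure closure_subset)

lemma closed_K: "closed K"
  by (simp add: K_eq_closure)

lemma norm_K: "x \<in> K \<Longrightarrow> norm x \<le> 1"
proof -
  have "closure Vstar \<subseteq> cball 0 1" by (rule closure_minimal) (auto simp: norm_Vstar)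
  then show "x \<in> K \<Longrightarrow> norm x \<le> 1" by (auto simp: K_eq_closure)
qed

lemma compact_K: "compact K"
  using closed_K norm_K by (auto simp: compact_eq_bounded_closed bounded_iff)

lemma q_in_K: "a \<le> n \<Longrightarrow> q a \<in> K"
proof -
  assume "a \<le> n"
  then have "q a \<in> Vstar" unfolding Vstar_def by (intro CollectI exI[of _ "[]"] exI[of _ a]) auto
  then show ?thesis using Vstar_subset_K by blast
qed

lemma dist_K: "x \<in> K \<Longrightarrow> y \<in> K \<Longrightarrow> dist x y \<le> 2"
  using norm_K[of x] norm_K[of y] norm_triangle_ineq4[of x y] by (simp add: dist_norm)

lemma K_invariant: "K = (\<Union>i\<le>n. gasket_map q i ` K)"
  unfolding K_eq_closure by (rule closure_Vstar_invariant)

lemma K_words: "K = (\<Union>w\<in>words n m. word_map q w ` K)"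
proof (induction m)
  case (Suc m)
  have "K = (\<Union>i\<le>n. gasket_map q i ` K)" by (rule K_invariant)
  also have "\<dots> = (\<Union>i\<le>n. gasket_map q i ` (\<Union>w\<in>words n m. word_map q w ` K))"
    by (rule arg_cong[OF Suc, of "\<lambda>A. \<Union>i\<le>n. gasket_map q i ` A"])
  also have "\<dots> = (\<Union>w\<in>words n (Suc m). word_map q w ` K)"
    by (auto simp: image_UN image_image words_Suc) blast
  finally show ?case .
qed (simp add: words_0)

lemma word_map_K: "set w \<subseteq> {..n} \<Longrightarrow> x \<in> K \<Longrightarrow> word_map q w x \<in> K"
proof -
  assume "set w \<subseteq> {..n}" "x \<in> K"
  then have "word_map q w x \<in> (\<Union>v\<in>words n (length w). word_map q v ` K)"
    by (auto simp: words_def)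
  then show ?thesis by (subst K_words)
qed

lemma bary_nonneg_Vstar:
  assumes "set w \<subseteq> {..n}" "a \<le> n" "j \<le> n"
  shows "0 \<le> bary j (word_map q w (q a))"
  using assms by (induction w) (auto simp: bary_q bary_gasket_map)

lemma bary_repr_Vstar:
  assumes "set w \<subseteq> {..n}" "a \<le> n"
  shows "word_map q w (q a) = (\<Sum>j\<le>n. bary j (word_map q w (q a)) *\<^sub>R q j)"
proof -
  have d: "(\<Sum>j\<le>n. bary j (q i) *\<^sub>R q j) = q i" if "i \<le> n" for i
  proof -
    have "(\<Sum>j\<le>n. bary j (q i) *\<^sub>R q j) = (\<Sum>j\<le>n. if j = i then q j else 0)"
      using that by (intro sum.cong) (auto simp: bary_q)
    then show ?thesis using that by simp
  qed
  from assms show ?thesis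
  proof (induction w)
    case (Cons i w)
    let ?x = "word_map q w (q a)"
    have "(\<Sum>j\<le>n. bary j (word_map q (i # w) (q a)) *\<^sub>R q j)
        = (\<Sum>j\<le>n. (1/2) *\<^sub>R (bary j ?x *\<^sub>R q j + bary j (q i) *\<^sub>R q j))"
      by (intro sum.cong) (auto simp: bary_gasket_map algebra_simps add_divide_distrib)
    also have "\<dots> = (1/2) *\<^sub>R ((\<Sum>j\<le>n. bary j ?x *\<^sub>R q j) + (\<Sum>j\<le>n. bary j (q i) *\<^sub>R q j))"
      by (simp add: sum.distrib scaleR_sum_right[symmetric])
    also have "\<dots> = word_map q (i # w) (q a)"
      using Cons d[of i] by (simp add: gasket_map_def)
    finally show ?case ..
  qed (use d in simp)
qed

text \<open>Closed conditions pass from the vertices, where induction on words proves them, to the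
  closure \<open>K\<close>; \<open>bary_repr\<close> is obtained in the same way.\<close>

lemma bary_nonneg: "x \<in> K \<Longrightarrow> j \<le> n \<Longrightarrow> 0 \<le> bary j x"
proof -
  assume j: "j \<le> n"
  have "closure Vstar \<subseteq> {x. 0 \<le> bary j x}"
    by (rule closure_minimal)
      (auto simp: Vstar_def bary_nonneg_Vstar j intro!: closed_Collect_le continuous_on_bary continuous_on_const)
  then show "x \<in> K \<Longrightarrow> 0 \<le> bary j x" by (auto simp: K_eq_closure)
qed

lemma bary_repr: "x \<in> K \<Longrightarrow> x = (\<Sum>j\<le>n. bary j x *\<^sub>R q j)"
proof -
  have "closure Vstar \<subseteq> {x. x = (\<Sum>j\<le>n. bary j x *\<^sub>R q j)}"
  proof (rule closure_minimal)
    show "Vstar \<subseteq> {x. x = (\<Sum>j\<le>n. bary j x *\<^sub>R q j)}"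
      using bary_repr_Vstar by (auto simp: Vstar_def)
    show "closed {x. x = (\<Sum>j\<le>n. bary j x *\<^sub>R q j)}"
      by (intro closed_Collect_eq continuous_intros continuous_on_bary)
  qed
  then show "x \<in> K \<Longrightarrow> x = (\<Sum>j\<le>n. bary j x *\<^sub>R q j)" by (auto simp: K_eq_closure)
qed

lemma bary_ext: "x \<in> K \<Longrightarrow> y \<in> K \<Longrightarrow> (\<And>j. j \<le> n \<Longrightarrow> bary j x = bary j y) \<Longrightarrow> x = y"
proof -
  assume xy: "x \<in> K" "y \<in> K" "\<And>j. j \<le> n \<Longrightarrow> bary j x = bary j y"
  have "x = (\<Sum>j\<le>n. bary j x *\<^sub>R q j)" by (rule bary_repr[OF xy(1)])
  also have "\<dots> = (\<Sum>j\<le>n. bary j y *\<^sub>R q j)" using xy(3) by (intro sum.cong) auto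
  also have "\<dots> = y" by (rule bary_repr[OF xy(2), symmetric])
  finally show "x = y" .
qed

lemma bary_le_1: "x \<in> K \<Longrightarrow> j \<le> n \<Longrightarrow> bary j x \<le> 1"
  using sum_bary[of x] member_le_sum[of j "{..n}" "\<lambda>j. bary j x"] bary_nonneg by fastforce

lemma bary_pair_le_1:
  assumes "x \<in> K" "i \<le> n" "j \<le> n" "i \<noteq> j"
  shows "bary i x + bary j x \<le> 1"
proof -
  have "(\<Sum>l\<in>{i, j}. bary l x) \<le> (\<Sum>l\<le>n. bary l x)"
    using assms bary_nonneg by (intro sum_mono2) auto
  then show ?thesis using assms by (simp add: sum_bary)
qed

lemma bary_eq_1_imp: 
  assumes "x \<in> K" "a \<le> n" "1 \<le> bary a x"
  shows "x = q a"
proof (rule bary_ext)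
  fix j assume j: "j \<le> n"
  show "bary j x = bary j (q a)"
    using bary_pair_le_1[of x a j] bary_le_1[of x a] bary_nonneg[of x j] assms j by (auto simp: bary_q)
qed (use assms q_in_K in auto)

lemma bary_word_map:
  assumes "set w \<subseteq> {..n}" "j \<le> n"
  shows "2 ^ length w * bary j (word_map q w x) = real (digits w j) + bary j x"
  using assms by (induction w) (auto simp: bary_gasket_map bary_q field_simps)

lemma word_map_q_inj:
  assumes "w \<in> words n m" "v \<in> words n m" "a \<le> n" "word_map q w (q a) = word_map q v (q a)"
  shows "w = v"
proof (rule digits_inj)
  fix j assume "j \<le> n"
  then show "digits w j = digits v j"
    using bary_word_map[of w j "q a"] bary_word_map[of v j "q a"] assms by (auto simp: words_def)
qed (use assms in \<open>auto simp: words_def\<close>)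

text \<open>
  Nearby points of two distinct cells of the same level force the integer vectors of the cells to differ by
  a difference of two unit vectors, and then the cells share a vertex.
\<close>

lemma word_separation:
  assumes w: "w \<in> words n m" "v \<in> words n m" "w \<noteq> v" and xy: "x \<in> K" "y \<in> K"
    and near: "\<And>j. j \<le> n \<Longrightarrow> 2 ^ m * \<bar>bary j (word_map q w x) - bary j (word_map q v y)\<bar> < 1 / 2"
  obtains a b where "a \<le> n" "b \<le> n" "word_map q w (q b) = word_map q v (q a)"
    "word_map q w x = word_map q v y \<Longrightarrow> x = q b \<and> y = q a"
proof -
  have len: "length w = m" "length v = m" and sets: "set w \<subseteq> {..n}" "set v \<subseteq> {..n}"
    using w by (auto simp: words_def)
  define D where "D j = int (digits w j) - int (digits v j)" for j
  have Deq: "2 ^ m * (bary j (word_map q w x) - bary j (word_map q v y)) = real_of_int (D j) + bary j x - bary j y"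
    if "j \<le> n" for j
    using bary_word_map[OF sets(1) that, of x] bary_word_map[OF sets(2) that, of y] len
    by (simp add: D_def algebra_simps)
  have Dnear: "\<bar>real_of_int (D j) + bary j x - bary j y\<bar> < 1 / 2" if "j \<le> n" for j
  proof -
    have "2 ^ m * \<bar>t\<bar> = \<bar>2 ^ m * t\<bar>" for t :: real by (simp add: abs_mult)
    then show ?thesis using near[OF that] Deq[OF that] by simp
  qed
  have sumD: "(\<Sum>j\<le>n. D j) = 0"
  proof -
    have "(\<Sum>j\<le>n. int (digits w j)) + 1 = (\<Sum>j\<le>n. int (digits v j)) + 1"
      using sum_digits[OF sets(1)] sum_digits[OF sets(2)] len
      by (metis of_nat_1 of_nat_add of_nat_sum)
    then show ?thesis by (simp add: D_def sum_subtractf)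
  qed
  have ex: "\<exists>j\<le>n. D j \<noteq> 0"
    using digits_inj[of w v n] w(3) len sets by (force simp: D_def)
  \<comment> \<open>Coordinates in [0, 1] and an error below 1/2 leave
    \<open>\<bar>D j\<bar> < 3/2\<close>.\<close>
  have bounds: "-1 \<le> D j \<and> D j \<le> 1" if "j \<le> n" for j
    using Dnear[OF that] bary_nonneg[OF xy(1) that] bary_nonneg[OF xy(2) that]
      bary_le_1[OF xy(1) that] bary_le_1[OF xy(2) that] by linarith
  have pos: "\<exists>a\<le>n. D a > 0"
  proof (rule ccontr)
    assume "\<not> ?thesis"
    then have "\<forall>j\<in>{..n}. 0 \<le> - D j" by auto
    moreover have "(\<Sum>j\<le>n. - D j) = 0" using sumD by (simp add: sum_negf)
    ultimately have "\<forall>j\<in>{..n}. - D j = 0" by (subst (asm) sum_nonneg_eq_0_iff) auto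
    then show False using ex by auto
  qed
  have neg: "\<exists>b\<le>n. D b < 0"
  proof (rule ccontr)
    assume "\<not> ?thesis"
    then have "\<forall>j\<in>{..n}. 0 \<le> D j" by (auto simp: not_less)
    then have "\<forall>j\<in>{..n}. D j = 0" using sumD by (subst (asm) sum_nonneg_eq_0_iff) auto
    then show False using ex by auto
  qed
  obtain a b where ab: "a \<le> n" "D a > 0" "b \<le> n" "D b < 0" using pos neg by auto
  have Da: "D a = 1" and Db: "D b = -1" using bounds[OF ab(1)] bounds[OF ab(3)] ab by auto
  \<comment> \<open>This is where the bound 1/2 matters: two entries equal to 1 would make two
    coordinates of \<open>y\<close> exceed 1/2 each, although their sum is at most 1. Two entries
    equal to -1 do the same to \<open>x\<close>.\<close>
  have D0: "D j = 0" if j: "j \<le> n" "j \<noteq> a" "j \<noteq> b" for j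
  proof -
    have r: "real_of_int (D a) = 1" "real_of_int (D b) = -1" using Da Db by simp_all
    have "D j \<noteq> 1"
    proof
      assume "D j = 1"
      then have "real_of_int (D j) = 1" by simp
      then show False
        using Dnear[OF ab(1)] Dnear[OF j(1)] r bary_pair_le_1[OF xy(2) ab(1) j(1)] j(2)
          bary_nonneg[OF xy(1) j(1)] bary_nonneg[OF xy(1) ab(1)] by linarith
    qed
    moreover have "D j \<noteq> -1"
    proof
      assume "D j = -1"
      then have "real_of_int (D j) = -1" by simp
      then show False
        using Dnear[OF ab(3)] Dnear[OF j(1)] r bary_pair_le_1[OF xy(1) ab(3) j(1)] j(3)
          bary_nonneg[OF xy(2) j(1)] bary_nonneg[OF xy(2) ab(3)] by linarith
    qed
    ultimately show ?thesis using bounds[OF j(1)] by auto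
  qed
  have "a \<noteq> b" using Da Db by auto
  \<comment> \<open>The digit vectors differ by the unit vector of \<open>a\<close> minus that of
    \<open>b\<close>, so adding the coordinates of \<open>q b\<close> to one and of
    \<open>q a\<close> to the other makes them equal.\<close>
  have eq: "word_map q w (q b) = word_map q v (q a)"
  proof (rule bary_ext)
    fix j assume j: "j \<le> n"
    have "real_of_int (D j) + bary j (q b) - bary j (q a) = 0"
      using j ab Da Db D0[OF j] \<open>a \<noteq> b\<close> by (auto simp: bary_q)
    then have "2 ^ m * bary j (word_map q w (q b)) = 2 ^ m * bary j (word_map q v (q a))"
      using bary_word_map[OF sets(1) j, of "q b"] bary_word_map[OF sets(2) j, of "q a"] len
      by (simp add: D_def)
    then show "bary j (word_map q w (q b)) = bary j (word_map q v (q a))" by simp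
  qed (use sets ab q_in_K word_map_K in auto)
  have "x = q b \<and> y = q a" if "word_map q w x = word_map q v y"
  proof -
    have "1 + bary a x - bary a y = 0" "-1 + bary b x - bary b y = 0"
      using Deq[OF ab(1)] Deq[OF ab(3)] that Da Db by auto
    then show ?thesis
      using bary_eq_1_imp[OF xy(1) ab(3)] bary_eq_1_imp[OF xy(2) ab(1)]
        bary_nonneg[OF xy(1) ab(1)] bary_nonneg[OF xy(2) ab(3)] by auto
  qed
  then show thesis using that ab(1,3) eq by blast
qed

subsection \<open>The double gasket\<close>

text \<open>The simplex is known only through its centroid \<open>c *\<^sub>R axis k 1\<close>, so
  the height of \<open>q j\<close> is read off the inner product with it. Inner products of vertices
  are nonnegative by polarisation of the edge lengths, and \<open>q j \<bullet> q j = 1\<close>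
  alone gives the bound \<open>1 / (N * c)\<close>.\<close>

lemma q_height: "\<exists>h>0. \<forall>j. 0 < j \<longrightarrow> j \<le> n \<longrightarrow> h \<le> q j $ k"
proof -
  obtain c where c: "0 < c" "(1 / N) *\<^sub>R (\<Sum>i\<le>n. q i) = c *\<^sub>R axis k 1"
    using simplex by (auto simp: gasket_simplex_def N_def n_def)
  have "1 / (N * c) \<le> q j $ k" if j: "0 < j" "j \<le> n" for j
  proof -
    have nn: "0 \<le> q j \<bullet> q l" if "l \<le> n" for l
    proof (cases "l = j \<or> l = 0")
      case False
      have "(dist (q j) (q l))\<^sup>2 = (dist (q j) (q 0))\<^sup>2 - 2 * (q j \<bullet> q l) + (dist (q l) (q 0))\<^sup>2"
        by (simp add: dist_sq power2_norm_eq_inner)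
      then show ?thesis using False j that by (simp add: dist_q del: q_0)
    qed auto
    have "q j \<bullet> q j = (dist (q j) (q 0))\<^sup>2" by (simp add: power2_norm_eq_inner)
    then have "1 = q j \<bullet> q j" using j by (simp add: dist_q del: q_0)
    also have "\<dots> \<le> (\<Sum>l\<le>n. q j \<bullet> q l)"
      using nn j by (intro member_le_sum[of j "{..n}" "\<lambda>l. q j \<bullet> q l"]) auto
    also have "\<dots> = N * (q j \<bullet> ((1 / N) *\<^sub>R (\<Sum>i\<le>n. q i)))"
      using N_pos by (simp add: inner_sum_right)
    also have "\<dots> = N * c * q j $ k"
      unfolding c(2) by (simp add: inner_axis)
    finally show ?thesis using N_pos c(1) by (simp add: field_simps)
  qed
  then show ?thesis using N_pos c(1) by (intro exI[of _ "1 / (N * c)"]) auto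
qed

text \<open>Height is the average of the vertex heights, weighted by the coordinates. Points of
  \<open>K\<close> near the hyperplane of reflection therefore have \<open>bary 0\<close> near 1,
  that is, they are near the gluing point.\<close>

lemma K_height: "\<exists>h>0. \<forall>x\<in>K. h * (1 - bary 0 x) \<le> x $ k"
proof -
  obtain h where h: "0 < h" "\<And>j. 0 < j \<Longrightarrow> j \<le> n \<Longrightarrow> h \<le> q j $ k" using q_height by auto
  have "h * (1 - bary 0 x) \<le> x $ k" if x: "x \<in> K" for x
  proof -
    have "x $ k = (\<Sum>j\<le>n. bary j x *\<^sub>R q j) $ k" using bary_repr[OF x] by simp
    also have "\<dots> = (\<Sum>j\<le>n. bary j x * q j $ k)" by simp
    also have "\<dots> \<ge> (\<Sum>j\<le>n. if j = 0 then 0 else h * bary j x)"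
    proof (rule sum_mono)
      fix j assume "j \<in> {..n}"
      then show "(if j = 0 then 0 else h * bary j x) \<le> bary j x * q j $ k"
        using mult_left_mono[OF h(2) bary_nonneg[OF x], of j j] by (auto simp: mult.commute)
    qed
    also have "(\<Sum>j\<le>n. if j = 0 then 0 else h * bary j x) = (\<Sum>j\<le>n. h * bary j x - (if j = 0 then h * bary 0 x else 0))"
      by (intro sum.cong) auto
    also have "\<dots> = h * (1 - bary 0 x)"
      by (simp add: sum_subtractf sum_distrib_left[symmetric] sum_bary algebra_simps)
    finally show ?thesis .
  qed
  then show ?thesis using h(1) by blast
qed

abbreviation R where "R \<equiv> reflect_coord k"

lemma R_R [simp]: "R (R x) = x"
  by (simp add: reflect_coord_def vec_eq_iff)

lemma R_0 [simp]: "R 0 = 0"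
  by (simp add: reflect_coord_def vec_eq_iff)

lemma R_k [simp]: "R x $ k = - (x $ k)"
  by (simp add: reflect_coord_def)

lemma dist_R [simp]: "dist (R x) (R y) = dist x y"
  unfolding dist_vec_def
  by (intro arg_cong2[of _ _ _ _ L2_set] ext) (auto simp: reflect_coord_def dist_real_def)

abbreviation X where "X \<equiv> double_gasket k q"

section \<open>Cells of the double gasket and their adjacency\<close>

definition cmap :: "bool \<times> nat list \<Rightarrow> real^'n \<Rightarrow> real^'n" where
  "cmap \<iota> x = (if fst \<iota> then R (word_map q (snd \<iota>) x) else word_map q (snd \<iota>) x)"

definition cells :: "nat \<Rightarrow> (bool \<times> nat list) set" where
  "cells m = UNIV \<times> words n m"

definition cset :: "bool \<times> nat list \<Rightarrow> (real^'n) set" where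
  "cset \<iota> = cmap \<iota> ` K"

lemma dist_cmap: "dist (cmap \<iota> x) (cmap \<iota> y) = (1/2) ^ length (snd \<iota>) * dist x y"
  by (simp add: cmap_def dist_word_map)

lemma finite_cells: "finite (cells m)"
  by (simp add: cells_def finite_words)

lemma card_cells: "real (card (cells m)) = 2 * N ^ m"
  by (simp add: cells_def card_cartesian_product card_words N_def add.commute)

lemma cells_length: "\<iota> \<in> cells m \<Longrightarrow> length (snd \<iota>) = m"
  by (auto simp: cells_def words_def)

lemma X_eq: "X = K \<union> R ` K"
  by (simp add: double_gasket_def K_def)

lemma cells_eq: "cells m = Pair False ` words n m \<union> Pair True ` words n m"
  unfolding cells_def UNIV_bool by auto

lemma X_cells: "X = (\<Union>\<iota>\<in>cells m. cset \<iota>)"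
proof -
  have "(\<Union>\<iota>\<in>cells m. cset \<iota>) = (\<Union>w\<in>words n m. word_map q w ` K) \<union> R ` (\<Union>w\<in>words n m. word_map q w ` K)"
    by (simp add: cells_eq cset_def cmap_def image_UN image_image)
  then show ?thesis using X_eq K_words[of m] by metis
qed

lemma continuous_on_cmap: "continuous_on S (cmap \<iota>)"
  unfolding continuous_on_iff dist_cmap
proof (intro ballI allI impI)
  fix x e assume "x \<in> S" "0 < (e::real)"
  then show "\<exists>d>0. \<forall>x'\<in>S. dist x' x < d \<longrightarrow> (1 / 2) ^ length (snd \<iota>) * dist x' x < e"
    by (intro exI[of _ "e * 2 ^ length (snd \<iota>)"]) (auto simp: field_simps power_divide)
qed

lemma compact_cset: "compact (cset \<iota>)"
  unfolding cset_def by (intro compact_continuous_image continuous_on_cmap compact_K)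

lemma closed_cset: "closed (cset \<iota>)"
  by (simp add: compact_cset compact_imp_closed)

lemma compact_X: "compact X"
  unfolding X_cells[of 0] by (intro compact_UN finite_cells compact_cset)

lemma closed_X: "closed X"
  by (simp add: compact_X compact_imp_closed)

lemma cset_subset_X: "\<iota> \<in> cells m \<Longrightarrow> cset \<iota> \<subseteq> X"
  using X_cells[of m] by blast

lemma X_cellE:
  assumes "x \<in> X" obtains \<iota> where "\<iota> \<in> cells m" "x \<in> cset \<iota>"
  using assms X_cells[of m] by blast

lemma vertex_in_cset: "a \<le> n \<Longrightarrow> cmap \<iota> (q a) \<in> cset \<iota>"
  by (simp add: cset_def q_in_K)

lemma cset_dist: "\<iota> \<in> cells m \<Longrightarrow> x \<in> cset \<iota> \<Longrightarrow> y \<in> cset \<iota> \<Longrightarrow> dist x y \<le> 2 * (1/2) ^ m"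
  using dist_K by (auto simp: cset_def dist_cmap cells_length)

definition adj :: "bool \<times> nat list \<Rightarrow> bool \<times> nat list \<Rightarrow> bool" where
  "adj \<iota> \<kappa> \<longleftrightarrow> (\<exists>a\<le>n. \<exists>b\<le>n. cmap \<iota> (q a) = cmap \<kappa> (q b))"

lemma adj_refl: "adj \<iota> \<iota>" and adj_sym: "adj \<iota> \<kappa> \<Longrightarrow> adj \<kappa> \<iota>"
  by (force simp: adj_def)+

lemma adj_dist:
  assumes "\<iota> \<in> cells m" "\<kappa> \<in> cells m" "adj \<iota> \<kappa>" "x \<in> cset \<iota>" "y \<in> cset \<kappa>"
  shows "dist x y \<le> 4 * (1/2) ^ m"
proof -
  obtain a b where ab: "a \<le> n" "b \<le> n" "cmap \<iota> (q a) = cmap \<kappa> (q b)" using assms by (auto simp: adj_def)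
  have "dist x (cmap \<iota> (q a)) \<le> 2 * (1/2) ^ m" "dist y (cmap \<iota> (q a)) \<le> 2 * (1/2) ^ m"
    using assms ab cset_dist vertex_in_cset by metis+
  then show ?thesis using dist_triangle2[of x y "cmap \<iota> (q a)"] by linarith
qed

text \<open>The hypothesis forces \<open>digits (snd \<iota>) 0\<close> above
  \<open>2 ^ m - 2\<close>, hence to its largest value \<open>2 ^ m - 1\<close>: the cell is the one
  at the corner \<open>q 0\<close>.\<close>

lemma cset_vertex_0:
  assumes "\<iota> \<in> cells m" "x \<in> K" "2 ^ m * (1 - bary 0 (word_map q (snd \<iota>) x)) < 1"
  shows "cmap \<iota> (q 0) = 0" "word_map q (snd \<iota>) x = 0 \<Longrightarrow> x = q 0"
proof -
  have w: "set (snd \<iota>) \<subseteq> {..n}" "length (snd \<iota>) = m" using assms by (auto simp: cells_def words_def)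
  have *: "2 ^ m * bary 0 (word_map q (snd \<iota>) y) = real (digits (snd \<iota>) 0) + bary 0 y" for y
    using bary_word_map[OF w(1), of 0 y] w(2) by simp
  have less: "digits (snd \<iota>) 0 < 2 ^ m" using digits_less[of "snd \<iota>" 0] w by simp
  have "real (digits (snd \<iota>) 0) > 2 ^ m - 2"
    using assms(3) *[of x] bary_le_1[OF assms(2), of 0] by (simp add: algebra_simps)
  then have "real (digits (snd \<iota>) 0) + 2 > real (2 ^ m)" by simp
  then have "digits (snd \<iota>) 0 + 2 > 2 ^ m" by (metis of_nat_add of_nat_less_iff of_nat_numeral)
  then have d: "digits (snd \<iota>) 0 + 1 = 2 ^ m" using less by simp
  then have dr: "real (digits (snd \<iota>) 0) + 1 = 2 ^ m" by (metis of_nat_1 of_nat_add of_nat_numeral of_nat_power)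
  have "2 ^ m * bary 0 (word_map q (snd \<iota>) (q 0)) = 2 ^ m"
    using *[of "q 0"] dr bary_q[of 0 0] by simp
  then have "word_map q (snd \<iota>) (q 0) = q 0"
    using w by (intro bary_eq_1_imp word_map_K q_in_K) auto
  then show "cmap \<iota> (q 0) = 0" by (simp add: cmap_def)
  assume "word_map q (snd \<iota>) x = 0"
  then show "x = q 0"
    using *[of x] dr bary_q[of 0 0] assms(2) by (intro bary_eq_1_imp) auto
qed

text \<open>In one half this is \<open>word_separation\<close>. In different halves the heights have
  opposite signs, so two close points are both close to the hyperplane, and both cells have
  \<open>0\<close> as a vertex.\<close>

lemma cells_separation:
  obtains c where "0 < c"
    "\<And>m \<iota> \<kappa> x y. \<iota> \<in> cells m \<Longrightarrow> \<kappa> \<in> cells m \<Longrightarrow> x \<in> cset \<iota> \<Longrightarrow> y \<in> cset \<kappa> \<Longrightarrow>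
        dist x y < c * (1/2) ^ m \<Longrightarrow> adj \<iota> \<kappa>"
    "\<And>m \<iota> \<kappa> x. \<iota> \<in> cells m \<Longrightarrow> \<kappa> \<in> cells m \<Longrightarrow> \<iota> \<noteq> \<kappa> \<Longrightarrow> x \<in> cset \<iota> \<Longrightarrow> x \<in> cset \<kappa> \<Longrightarrow>
        \<exists>a\<le>n. \<exists>b\<le>n. x = cmap \<iota> (q a) \<and> x = cmap \<kappa> (q b)"
proof -
  obtain h where h: "0 < h" "\<And>x. x \<in> K \<Longrightarrow> h * (1 - bary 0 x) \<le> x $ k" using K_height by auto
  \<comment> \<open>With the Lipschitz constant 2 of \<open>bary\<close>, the value 1/4 yields the
    error 1/2 required by \<open>word_separation\<close>; the bound \<open>h\<close> makes
    \<open>1 - bary 0\<close> smaller than \<open>(1/2) ^ m\<close> in the case of different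
    halves.\<close>
  define c where "c = min (1/4) h"
  have c: "0 < c" "c \<le> 1/4" "c \<le> h" using h(1) by (auto simp: c_def)
  have main: "adj \<iota> \<kappa> \<and> (\<iota> \<noteq> \<kappa> \<longrightarrow> x = y \<longrightarrow> (\<exists>a\<le>n. \<exists>b\<le>n. x = cmap \<iota> (q a) \<and> x = cmap \<kappa> (q b)))"
    if \<iota>: "\<iota> \<in> cells m" "\<kappa> \<in> cells m" "x \<in> cset \<iota>" "y \<in> cset \<kappa>" "dist x y < c * (1/2) ^ m" for m \<iota> \<kappa> x y
  proof -
    define w v where "w = snd \<iota>" and "v = snd \<kappa>"
    have wv: "w \<in> words n m" "v \<in> words n m" using \<iota> by (auto simp: cells_def w_def v_def)
    obtain x' y' where x': "x' \<in> K" "x = cmap \<iota> x'" and y': "y' \<in> K" "y = cmap \<kappa> y'"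
      using \<iota> by (auto simp: cset_def)
    have inK: "word_map q w x' \<in> K" "word_map q v y' \<in> K"
      using x' y' wv by (auto intro!: word_map_K simp: words_def)
    show ?thesis
    proof (cases "fst \<iota> = fst \<kappa>")
      case True
      show ?thesis
      proof (cases "w = v")
        case True
        then have "\<iota> = \<kappa>" using \<open>fst \<iota> = fst \<kappa>\<close> by (simp add: w_def v_def prod_eq_iff)
        then show ?thesis by (simp add: adj_refl)
      next
        case False
        have d: "dist (word_map q w x') (word_map q v y') = dist x y"
          using True by (simp add: x' y' cmap_def w_def v_def)
        have "2 ^ m * \<bar>bary j (word_map q w x') - bary j (word_map q v y')\<bar> < 1 / 2" if "j \<le> n" for j
        proof -
          have "2 ^ m * \<bar>bary j (word_map q w x') - bary j (word_map q v y')\<bar> \<le> 2 ^ m * (2 * dist x y)"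
            using bary_lipschitz[OF that] d by (intro mult_left_mono) (metis, simp)
          also have "\<dots> < 2 ^ m * (2 * (c * (1/2) ^ m))"
            using \<iota>(5) by (intro mult_strict_left_mono) auto
          also have "\<dots> = 2 * c" by (simp add: power_divide)
          finally show ?thesis using c by simp
        qed
        then obtain a b where ab: "a \<le> n" "b \<le> n" "word_map q w (q b) = word_map q v (q a)"
          "word_map q w x' = word_map q v y' \<Longrightarrow> x' = q b \<and> y' = q a"
          using word_separation[OF wv False x'(1) y'(1)] by metis
        have "cmap \<iota> (q b) = cmap \<kappa> (q a)" using ab(3) True by (simp add: cmap_def w_def v_def)
        moreover have "x = cmap \<iota> (q b) \<and> y = cmap \<kappa> (q a)" if "x = y"
          using ab(4) d that x' y' by simp
        ultimately show ?thesis using ab(1,2) unfolding adj_def by metis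
      qed
    next
      case False
      have R_diff: "\<bar>u $ k - R z $ k\<bar> \<le> dist u (R z)" for u z
        using component_le_norm_cart[of "u - R z" k] by (simp add: dist_norm)
      have dR: "dist (R u) z = dist u (R z)" for u z using dist_R[of "R u" z] by simp
      \<comment> \<open>One of the two points is reflected, so the difference of their last
        coordinates is the sum of the heights up to sign.\<close>
      have "\<bar>word_map q w x' $ k + word_map q v y' $ k\<bar> \<le> dist x y"
        using False R_diff[of "word_map q w x'" "word_map q v y'"]
        by (auto simp: x' y' cmap_def w_def v_def dR split: if_splits)
      then have le: "h * (1 - bary 0 (word_map q w x')) + h * (1 - bary 0 (word_map q v y')) \<le> dist x y"
        using h(2)[OF inK(1)] h(2)[OF inK(2)] by linarith
      have nn: "0 \<le> h * (1 - bary 0 (word_map q w x'))" "0 \<le> h * (1 - bary 0 (word_map q v y'))"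
        using h(1) bary_le_1[OF inK(1)] bary_le_1[OF inK(2)] by auto
      have less: "2 ^ m * (1 - t) < 1" if "h * (1 - t) \<le> dist x y" for t
      proof -
        have "h * (1 - t) < h * (1/2) ^ m"
        proof -
          have "c * (1/2) ^ m \<le> h * (1/2) ^ m" using c(3) by (intro mult_right_mono) auto
          then show ?thesis using that \<iota>(5) by linarith
        qed
        then have "1 - t < (1/2) ^ m" using h(1) by simp
        then show ?thesis by (simp add: field_simps power_divide)
      qed
      have *: "2 ^ m * (1 - bary 0 (word_map q w x')) < 1" "2 ^ m * (1 - bary 0 (word_map q v y')) < 1"
        using le nn less by auto
      have 0: "cmap \<iota> (q 0) = 0" "cmap \<kappa> (q 0) = 0"
        using cset_vertex_0(1)[OF \<iota>(1) x'(1)] cset_vertex_0(1)[OF \<iota>(2) y'(1)] * by (auto simp: w_def v_def)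
      moreover have "x = cmap \<iota> (q 0) \<and> x = cmap \<kappa> (q 0)" if "x = y"
      proof -
        have "dist x y = 0" using that by simp
        then have "h * (1 - bary 0 (word_map q w x')) = 0" using le nn by linarith
        then have "word_map q w x' = q 0" using h(1) inK by (intro bary_eq_1_imp) auto
        then have "x' = q 0" using cset_vertex_0(2)[OF \<iota>(1) x'(1)] *(1) by (simp add: w_def)
        then show ?thesis using 0 x' by simp
      qed
      ultimately show ?thesis unfolding adj_def by (metis zero_le)
    qed
  qed
  show thesis
  proof
    show "0 < c" by (rule c)
    show "adj \<iota> \<kappa>" if "\<iota> \<in> cells m" "\<kappa> \<in> cells m" "x \<in> cset \<iota>" "y \<in> cset \<kappa>" "dist x y < c * (1/2) ^ m" for m \<iota> \<kappa> x y
      using main that by blast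
    show "\<exists>a\<le>n. \<exists>b\<le>n. x = cmap \<iota> (q a) \<and> x = cmap \<kappa> (q b)"
      if "\<iota> \<in> cells m" "\<kappa> \<in> cells m" "\<iota> \<noteq> \<kappa>" "x \<in> cset \<iota>" "x \<in> cset \<kappa>" for m \<iota> \<kappa> x
      using main[of \<iota> m \<kappa> x x] that c by auto
  qed
qed

lemma cmap_q_inj:
  assumes "\<iota> \<in> cells m" "\<kappa> \<in> cells m" "fst \<iota> = fst \<kappa>" "a \<le> n" "cmap \<iota> (q a) = cmap \<kappa> (q a)"
  shows "\<iota> = \<kappa>"
proof -
  have "word_map q (snd \<iota>) (q a) = word_map q (snd \<kappa>) (q a)"
    using assms(3,5) by (auto simp: cmap_def split: if_splits) (metis R_R)
  then have "snd \<iota> = snd \<kappa>"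
    using assms word_map_q_inj[of "snd \<iota>" m "snd \<kappa>" a] by (auto simp: cells_def)
  then show ?thesis using assms(3) by (simp add: prod_eq_iff)
qed

text \<open>A neighbour is determined by its half and by the indices that the common vertex has in
  the two cells (\<open>cmap_q_inj\<close>), which leaves \<open>2 * (n + 1)\<^sup>2\<close>
  possibilities.\<close>

lemma card_adj: 
  assumes \<iota>: "\<iota> \<in> cells m"
  shows "real (card {\<kappa>\<in>cells m. adj \<iota> \<kappa>}) \<le> 2 * N\<^sup>2"
proof -
  let ?I = "(UNIV :: bool set) \<times> {..n} \<times> {..n}"
  define S where "S = (\<lambda>(s, a, b). {\<kappa>\<in>cells m. fst \<kappa> = s \<and> cmap \<iota> (q a) = cmap \<kappa> (q b)})"
  have "{\<kappa>\<in>cells m. adj \<iota> \<kappa>} \<subseteq> (\<Union>i\<in>?I. S i)" by (auto simp: S_def adj_def)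
  moreover have fin: "finite (S i)" for i unfolding S_def by (cases i) (auto simp: finite_cells)
  ultimately have "card {\<kappa>\<in>cells m. adj \<iota> \<kappa>} \<le> card (\<Union>i\<in>?I. S i)"
    by (intro card_mono) auto
  also have "\<dots> \<le> (\<Sum>i\<in>?I. card (S i))" by (rule card_UN_le) simp
  also have "\<dots> \<le> (\<Sum>i\<in>?I. 1)"
  proof (rule sum_mono)
    fix i assume i: "i \<in> ?I"
    have "\<kappa> = \<kappa>'" if "\<kappa> \<in> S i" "\<kappa>' \<in> S i" for \<kappa> \<kappa>'
      using that i cmap_q_inj[of \<kappa> m \<kappa>'] by (auto simp: S_def)
    then show "card (S i) \<le> 1" by (metis card_le_Suc0_iff_eq[OF fin] One_nat_def)
  qed
  also have "\<dots> = 2 * (n + 1)\<^sup>2" by (simp add: card_cartesian_product power2_eq_square)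
  finally have "real (card {\<kappa>\<in>cells m. adj \<iota> \<kappa>}) \<le> real (2 * (n + 1)\<^sup>2)" by (simp only: of_nat_le_iff)
  then show ?thesis by (simp add: N_def power2_eq_square algebra_simps)
qed

end

section \<open>The measure on the double gasket\<close>

lemma hausdorff_pre_finite_cover:
  fixes U :: "'i \<Rightarrow> 'a::metric_space set"
  assumes I: "finite I" and A: "A \<subseteq> (\<Union>i\<in>I. U i)" and bd: "\<And>i. i \<in> I \<Longrightarrow> bounded (U i)"
    and di: "\<And>i. i \<in> I \<Longrightarrow> diameter (U i) \<le> \<delta>" and \<delta>: "0 \<le> \<delta>"
  shows "hausdorff_pre s \<delta> A \<le> ennreal (\<Sum>i\<in>I. diameter (U i) powr s)"
proof -
  obtain h where h: "bij_betw h {0..<card I} I" using ex_bij_betw_nat_finite[OF I] by blast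
  define V where "V i = (if i < card I then U (h i) else {})" for i
  have hI: "i < card I \<Longrightarrow> h i \<in> I" for i using h by (auto simp: bij_betw_def)
  have "hausdorff_pre s \<delta> A \<le> (\<Sum>i. ennreal (diameter (V i) powr s))"
  proof (rule hausdorff_pre_le)
    show "A \<subseteq> (\<Union>i. V i)"
    proof
      fix x assume "x \<in> A"
      then obtain i where i: "i \<in> I" "x \<in> U i" using A by auto
      then have "i \<in> h ` {0..<card I}" using h by (simp add: bij_betw_def)
      then obtain j where "j < card I" "h j = i" by auto
      then have "x \<in> V j" using i by (simp add: V_def)
      then show "x \<in> (\<Union>i. V i)" by blast
    qed
  qed (use bd di hI \<delta> in \<open>auto simp: V_def\<close>)
  also have "\<dots> = (\<Sum>i\<in>{0..<card I}. ennreal (diameter (V i) powr s))"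
    by (rule suminf_finite) (auto simp: V_def)
  also have "\<dots> = (\<Sum>i\<in>{0..<card I}. ennreal (diameter (U (h i)) powr s))"
    by (intro sum.cong) (auto simp: V_def)
  also have "\<dots> = (\<Sum>i\<in>I. ennreal (diameter (U i) powr s))"
    by (rule sum.reindex_bij_betw[OF h])
  also have "\<dots> = ennreal (\<Sum>i\<in>I. diameter (U i) powr s)" by simp
  finally show ?thesis .
qed

context gasket_setup
begin

section \<open>The Hausdorff measure of the gasket is positive and finite\<close>

definition ds :: real where "ds = ln N / ln 2"

lemma ds_pos: "0 < ds"
  using N_ge by (simp add: ds_def)

lemma gasket_dim_eq: "gasket_dim TYPE('n) = ds"
  by (simp only: gasket_dim_def ds_def) (simp add: N_def n_def)

lemma two_powr_ds: "2 powr ds = N"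
  using N_pos by (simp add: powr_def ds_def)

lemma half_power_powr_ds: "((1/2) ^ m) powr ds = (1 / N) ^ m"
proof (induction m)
  case (Suc m)
  have "(1/2) powr ds = 1 / N" using two_powr_ds by (simp add: powr_divide powr_mult)
  then show ?case using Suc by (simp only: power_Suc powr_mult)
qed simp

lemma surj_gasket_map: "surj (gasket_map q i)"
proof (rule surjI)
  fix y show "gasket_map q i (2 *\<^sub>R y - q i) = y" by (simp add: gasket_map_def)
qed

lemma surj_word_map: "surj (word_map q w)"
proof (induction w)
  case (Cons i w)
  have "word_map q (i # w) = gasket_map q i \<circ> word_map q w" by auto
  then show ?case using Cons surj_gasket_map comp_surj by metis
qed (auto intro!: surjI[of _ "\<lambda>x. x"])

lemma surj_cmap: "surj (cmap \<iota>)"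
proof (cases "fst \<iota>")
  case True
  have "cmap \<iota> = R \<circ> word_map q (snd \<iota>)" using True by (auto simp: cmap_def)
  moreover have "surj R" by (rule surjI[of _ R]) simp
  ultimately show ?thesis using surj_word_map comp_surj by metis
next
  case False
  then have "cmap \<iota> = word_map q (snd \<iota>)" by (auto simp: cmap_def)
  then show ?thesis using surj_word_map by simp
qed

lemma hausdorff_outer_cset:
  assumes "\<iota> \<in> cells m"
  shows "hausdorff_outer ds (cset \<iota>) = ennreal ((1 / N) ^ m) * hausdorff_outer ds K"
proof -
  have "hausdorff_outer ds (cset \<iota>) = ennreal (((1/2) ^ length (snd \<iota>)) powr ds) * hausdorff_outer ds K"
    unfolding cset_def using ds_pos by (intro hausdorff_outer_similarity dist_cmap surj_cmap) auto
  then show ?thesis by (simp only: half_power_powr_ds cells_length[OF assms])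
qed

lemma diameter_cset_le: "\<iota> \<in> cells m \<Longrightarrow> diameter (cset \<iota>) \<le> 2 * (1/2) ^ m"
proof -
  assume \<iota>: "\<iota> \<in> cells m"
  have "cset \<iota> \<noteq> {}" using vertex_in_cset[of 0 \<iota>] by auto
  then show ?thesis
    unfolding diameter_def using cset_dist[OF \<iota>] by (auto intro!: cSUP_least)
qed

text \<open>The cells of level \<open>m\<close> are a cover with sum at most
  \<open>2 * N ^ m * (2 * (1/2) ^ m) powr ds\<close>, which is \<open>2 * N\<close> for every
  \<open>m\<close>.\<close>

lemma hausdorff_outer_K_le: "hausdorff_outer ds K \<le> ennreal (2 * N)"
proof (rule hausdorff_outer_least)
  fix \<delta> :: real assume \<delta>: "0 < \<delta>"
  obtain m where m: "(1/2) ^ m < \<delta> / 2" using real_arch_pow_inv[of "\<delta> / 2" "1/2"] \<delta> by auto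
  have "K \<subseteq> (\<Union>\<iota>\<in>cells m. cset \<iota>)" using X_cells[of m] X_eq by blast
  then have "hausdorff_pre ds \<delta> K \<le> ennreal (\<Sum>\<iota>\<in>cells m. diameter (cset \<iota>) powr ds)"
  proof (rule hausdorff_pre_finite_cover[OF finite_cells])
    fix \<iota> assume "\<iota> \<in> cells m"
    then show "diameter (cset \<iota>) \<le> \<delta>" using diameter_cset_le[of \<iota> m] m by linarith
  qed (use \<delta> compact_cset compact_imp_bounded in auto)
  also have "\<dots> \<le> ennreal (\<Sum>\<iota>\<in>cells m. (2 * (1/2) ^ m) powr ds)"
    using ds_pos diameter_cset_le diameter_ge_0[OF compact_imp_bounded[OF compact_cset]]
    by (intro ennreal_leI sum_mono powr_mono2) auto
  also have "(\<Sum>\<iota>\<in>cells m. (2 * (1/2) ^ m) powr ds) = real (card (cells m)) * (2 powr ds * ((1/2) ^ m) powr ds)"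
    by (simp only: sum_constant powr_mult)
  also have "\<dots> = 2 * N"
    using N_pos by (simp only: card_cells two_powr_ds half_power_powr_ds) (simp add: power_divide)
  finally show "hausdorff_pre ds \<delta> K \<le> ennreal (2 * N)" .
qed

text \<open>All cells that meet a small set are neighbours of any one of them, so
  \<open>card_adj\<close> counts them.\<close>

lemma card_cells_meeting:
  "\<exists>c>0. \<forall>m A. (\<forall>x\<in>A. \<forall>y\<in>A. dist x y < c * (1/2) ^ m) \<longrightarrow>
     real (card {\<iota>\<in>cells m. cset \<iota> \<inter> A \<noteq> {}}) \<le> 2 * N\<^sup>2"
proof -
  obtain c where c: "0 < c"
    "\<And>m \<iota> \<kappa> x y. \<iota> \<in> cells m \<Longrightarrow> \<kappa> \<in> cells m \<Longrightarrow> x \<in> cset \<iota> \<Longrightarrow> y \<in> cset \<kappa> \<Longrightarrow>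
        dist x y < c * (1/2) ^ m \<Longrightarrow> adj \<iota> \<kappa>"
    using cells_separation by metis
  show ?thesis
  proof (intro exI[of _ c] conjI allI impI c(1))
    fix m and A :: "(real^'n) set" assume A: "\<forall>x\<in>A. \<forall>y\<in>A. dist x y < c * (1/2) ^ m"
    show "real (card {\<iota>\<in>cells m. cset \<iota> \<inter> A \<noteq> {}}) \<le> 2 * N\<^sup>2"
    proof (cases "{\<iota>\<in>cells m. cset \<iota> \<inter> A \<noteq> {}} = {}")
      case True
      then show ?thesis by (simp only: card.empty) simp
    next
      case False
      then obtain \<iota> x where \<iota>: "\<iota> \<in> cells m" "x \<in> cset \<iota>" "x \<in> A" by auto
      have "{\<iota>\<in>cells m. cset \<iota> \<inter> A \<noteq> {}} \<subseteq> {\<kappa>\<in>cells m. adj \<iota> \<kappa>}"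
        using c(2)[OF \<iota>(1) _ \<iota>(2)] A \<iota>(3) by auto
      then have "card {\<iota>\<in>cells m. cset \<iota> \<inter> A \<noteq> {}} \<le> card {\<kappa>\<in>cells m. adj \<iota> \<kappa>}"
        by (intro card_mono) (auto simp: finite_cells)
      then show ?thesis using card_adj[OF \<iota>(1)] by linarith
    qed
  qed
qed

lemma card_cells_containing: "real (card {\<iota>\<in>cells m. x \<in> cset \<iota>}) \<le> 2 * N\<^sup>2"
proof -
  obtain c where c: "0 < c"
    "\<forall>m A. (\<forall>x\<in>A. \<forall>y\<in>A. dist x y < c * (1/2) ^ m) \<longrightarrow>
       real (card {\<iota>\<in>cells m. cset \<iota> \<inter> A \<noteq> {}}) \<le> 2 * N\<^sup>2"
    using card_cells_meeting by blast
  have "{\<iota>\<in>cells m. cset \<iota> \<inter> {x} \<noteq> {}} = {\<iota>\<in>cells m. x \<in> cset \<iota>}" by auto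
  then show ?thesis using c(2)[rule_format, of "{x}" m] c(1) by simp
qed

text \<open>Positivity: the mass distribution principle, with cell counting in place of a measure.\<close>

lemma hausdorff_outer_K_pos: "0 < hausdorff_outer ds K"
proof -
  obtain c where c: "0 < c"
    "\<forall>m A. (\<forall>x\<in>A. \<forall>y\<in>A. dist x y < c * (1/2) ^ m) \<longrightarrow>
       real (card {\<iota>\<in>cells m. cset \<iota> \<inter> A \<noteq> {}}) \<le> 2 * N\<^sup>2"
    using card_cells_meeting by blast
  \<comment> \<open>The counting argument yields \<open>2 * c0\<close>; one half is spent on
    enlarging the covering sets.\<close>
  define c0 where "c0 = (c / 2) powr ds / (4 * N\<^sup>2)"
  have c0: "0 < c0" using c(1) N_pos by (simp add: c0_def)
  have "ennreal c0 \<le> hausdorff_pre ds (c / 4) K"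
  proof (rule hausdorff_pre_greatest)
    fix U :: "nat \<Rightarrow> (real^'n) set"
    assume cov: "K \<subseteq> (\<Union>i. U i)" and bd: "\<And>i. bounded (U i)" and di: "\<And>i. diameter (U i) \<le> c / 4"
    define d where "d i = diameter (U i)" for i
    have d: "0 \<le> d i" "d i \<le> c / 4" for i using diameter_ge_0[OF bd] di by (auto simp: d_def)
    \<comment> \<open>Slightly above the diameter, to leave room for an open neighbourhood; the
      powers grow by at most \<open>c0\<close> in total. The cap \<open>c / 2\<close> guarantees
      that a level \<open>kk i\<close> with \<open>r i\<close> just below
      \<open>c * (1/2) ^ kk i\<close> exists.\<close>
    define r where "r i = min ((d i powr ds + c0 * (1/2) ^ Suc i) powr (1 / ds)) (c / 2)" for i
    have r_gt: "d i < r i" for i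
    proof -
      have "d i = (d i powr ds) powr (1 / ds)" using d(1)[of i] ds_pos by (simp add: powr_powr)
      also have "\<dots> < (d i powr ds + c0 * (1/2) ^ Suc i) powr (1 / ds)"
        using ds_pos c0 by (intro powr_less_mono2) auto
      finally show ?thesis using d(2)[of i] c(1) by (simp add: r_def)
    qed
    have r_pos: "0 < r i" for i using r_gt[of i] d(1)[of i] by linarith
    have r_powr: "r i powr ds \<le> d i powr ds + c0 * (1/2) ^ Suc i" for i
    proof -
      have "r i powr ds \<le> ((d i powr ds + c0 * (1/2) ^ Suc i) powr (1 / ds)) powr ds"
        using ds_pos r_pos[of i] by (intro powr_mono2) (auto simp: r_def)
      then show ?thesis using ds_pos c0 by (simp add: powr_powr)
    qed
    have "\<exists>k. r i \<le> c * (1/2) ^ k \<and> c * (1/2) ^ Suc k < r i" for i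
    proof -
      obtain k0 where k0: "(1/2) ^ k0 < r i / c" using real_arch_pow_inv[of "r i / c" "1/2"] r_pos[of i] c(1) by auto
      have ex: "c * (1/2) ^ k0 < r i" using k0 c(1) by (simp add: field_simps)
      define k where "k = (LEAST k. c * (1/2) ^ k < r i)"
      have k: "c * (1/2) ^ k < r i" unfolding k_def by (rule LeastI[of _ k0]) (rule ex)
      have "r i \<le> c / 2" by (simp add: r_def)
      then have "k \<noteq> 0" using k c(1) by (cases k) auto
      then obtain j where j: "k = Suc j" by (cases k) auto
      have "\<not> c * (1/2) ^ j < r i" using not_less_Least[of j "\<lambda>k. c * (1/2) ^ k < r i"] j by (simp add: k_def)
      then show ?thesis using k j by (intro exI[of _ j]) auto
    qed
    then obtain kk where kk: "\<And>i. r i \<le> c * (1/2) ^ kk i" "\<And>i. c * (1/2) ^ Suc (kk i) < r i" by metis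
    \<comment> \<open>Margins of half the slack keep all distances within \<open>V i\<close> below
      \<open>r i\<close>, and openness permits a finite subcover.\<close>
    define V where "V i = (\<Union>x\<in>U i. ball x ((r i - d i) / 2))" for i
    have "open (V i)" for i by (auto simp: V_def)
    moreover have "U i \<subseteq> V i" for i using r_gt[of i] by (force simp: V_def)
    ultimately obtain J where J: "finite J" "K \<subseteq> (\<Union>i\<in>J. V i)"
      using compactE_image[OF compact_K, of UNIV V] cov by (metis (no_types, lifting) SUP_mono' order_trans)
    have Vd: "dist x y < c * (1/2) ^ kk i" if "x \<in> V i" "y \<in> V i" for x y i
    proof -
      obtain x' y' where x': "x' \<in> U i" "dist x' x < (r i - d i) / 2" and y': "y' \<in> U i" "dist y' y < (r i - d i) / 2"
        using \<open>x \<in> V i\<close> \<open>y \<in> V i\<close> by (auto simp: V_def)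
      have "dist x' y' \<le> d i" unfolding d_def by (rule diameter_bounded_bound[OF bd x'(1) y'(1)])
      moreover have "dist x y \<le> dist x' x + dist x' y' + dist y' y"
        by (smt (verit) dist_commute dist_triangle)
      ultimately have "dist x y < (r i - d i) / 2 + d i + (r i - d i) / 2" using x' y' by linarith
      then have "dist x y < r i" by (simp add: field_simps)
      then show ?thesis using kk(1)[of i] by (rule order_less_le_trans)
    qed
    \<comment> \<open>A common level finer than all the \<open>kk i\<close> in the finite
      subcover.\<close>
    define m where "m = (\<Sum>i\<in>J. kk i)"
    have km: "kk i \<le> m" if "i \<in> J" for i unfolding m_def using that J(1) by (intro member_le_sum) auto
    define W where "W i = {w\<in>words n m. word_map q w (q 0) \<in> V i}" for i
    \<comment> \<open>The prefix of length \<open>kk i\<close> of such a word is a cell that meets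
      \<open>V i\<close>; there are at most \<open>2 * N\<^sup>2\<close> of these, and the remaining
      letters are free.\<close>
    have Wcard: "real (card (W i)) \<le> 2 * N\<^sup>2 * N ^ (m - kk i)" if i: "i \<in> J" for i
    proof -
      let ?C = "{\<iota>\<in>cells (kk i). cset \<iota> \<inter> V i \<noteq> {}}"
      have "W i \<subseteq> (\<lambda>(\<iota>, v). snd \<iota> @ v) ` (?C \<times> words n (m - kk i))"
      proof
        fix w assume w: "w \<in> W i"
        then have "w \<in> words n (kk i + (m - kk i))" using km[OF i] by (simp add: W_def)
        then obtain u v where uv: "w = u @ v" "u \<in> words n (kk i)" "v \<in> words n (m - kk i)"
          by (rule words_split)
        have "word_map q w (q 0) \<in> cset (False, u)"
          using uv q_in_K[of 0] by (auto simp: cset_def cmap_def word_map_append words_def intro!: imageI word_map_K)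
        then have "(False, u) \<in> ?C" using uv w by (auto simp: cells_def W_def)
        then show "w \<in> (\<lambda>(\<iota>, v). snd \<iota> @ v) ` (?C \<times> words n (m - kk i))"
          using uv by (intro image_eqI[of _ _ "((False, u), v)"]) auto
      qed
      then have "card (W i) \<le> card ((\<lambda>(\<iota>, v). snd \<iota> @ v) ` (?C \<times> words n (m - kk i)))"
        by (intro card_mono) (auto simp: finite_cells finite_words)
      also have "\<dots> \<le> card (?C \<times> words n (m - kk i))"
        by (intro card_image_le) (auto simp: finite_cells finite_words)
      also have "\<dots> = card ?C * (n + 1) ^ (m - kk i)" by (simp add: card_cartesian_product card_words)
      finally have "real (card (W i)) \<le> real (card ?C * (n + 1) ^ (m - kk i))" by (simp only: of_nat_le_iff)
      also have "\<dots> = real (card ?C) * N ^ (m - kk i)" by (simp add: N_def add.commute)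
      also have "\<dots> \<le> 2 * N\<^sup>2 * N ^ (m - kk i)"
        using c(2)[rule_format, of "V i" "kk i"] Vd N_pos by (intro mult_right_mono) auto
      finally show ?thesis .
    qed
    have "words n m \<subseteq> (\<Union>i\<in>J. W i)"
    proof
      fix w assume w: "w \<in> words n m"
      then have "word_map q w (q 0) \<in> K" by (intro word_map_K q_in_K) (auto simp: words_def)
      then show "w \<in> (\<Union>i\<in>J. W i)" using J(2) w by (auto simp: W_def)
    qed
    then have "card (words n m) \<le> card (\<Union>i\<in>J. W i)"
      using J(1) by (intro card_mono) (auto simp: W_def finite_words)
    also have "\<dots> \<le> (\<Sum>i\<in>J. card (W i))" by (rule card_UN_le[OF J(1)])
    finally have "real ((n + 1) ^ m) \<le> real (\<Sum>i\<in>J. card (W i))" by (simp only: card_words of_nat_le_iff)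
    then have "N ^ m \<le> (\<Sum>i\<in>J. real (card (W i)))" by (simp add: N_def add.commute)
    also have "\<dots> \<le> (\<Sum>i\<in>J. 2 * N\<^sup>2 * N ^ (m - kk i))" by (intro sum_mono Wcard)
    also have "\<dots> = (\<Sum>i\<in>J. N ^ m * (2 * N\<^sup>2 * (1 / N) ^ kk i))"
      using N_pos km by (intro sum.cong) (auto simp: power_diff power_divide)
    also have "\<dots> = N ^ m * (\<Sum>i\<in>J. 2 * N\<^sup>2 * (1 / N) ^ kk i)" by (simp add: sum_distrib_left)
    finally have "1 \<le> (\<Sum>i\<in>J. 2 * N\<^sup>2 * (1 / N) ^ kk i)" using N_pos by simp
    also have "\<dots> \<le> (\<Sum>i\<in>J. 2 * N\<^sup>2 * (r i powr ds / (c / 2) powr ds))"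
    proof (intro sum_mono mult_left_mono)
      fix i
      have "(1 / N) ^ kk i = ((1/2) ^ kk i) powr ds" by (simp only: half_power_powr_ds)
      also have "\<dots> \<le> (r i / (c / 2)) powr ds"
        using kk(2)[of i] c(1) ds_pos by (intro powr_mono2) (auto simp: field_simps)
      also have "\<dots> = r i powr ds / (c / 2) powr ds" using r_pos[of i] c(1) by (simp add: powr_divide powr_mult)
      finally show "(1 / N) ^ kk i \<le> r i powr ds / (c / 2) powr ds" .
    qed auto
    also have "\<dots> = (\<Sum>i\<in>J. r i powr ds * (2 * N\<^sup>2 / (c / 2) powr ds))"
      by (intro sum.cong) (auto simp: field_simps)
    also have "\<dots> = (\<Sum>i\<in>J. r i powr ds) * (2 * N\<^sup>2 / (c / 2) powr ds)"
      by (rule sum_distrib_right[symmetric])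
    also have "\<dots> = (\<Sum>i\<in>J. r i powr ds) / (2 * c0)"
      by (simp add: c0_def)
    finally have "2 * c0 \<le> (\<Sum>i\<in>J. r i powr ds)" using c0 by (simp add: field_simps)
    also have "\<dots> \<le> (\<Sum>i\<in>J. d i powr ds + c0 * (1/2) ^ Suc i)" by (intro sum_mono r_powr)
    also have "\<dots> = (\<Sum>i\<in>J. d i powr ds) + c0 * (\<Sum>i\<in>J. (1/2) ^ Suc i)"
      by (simp add: sum.distrib sum_distrib_left)
    also have "\<dots> \<le> (\<Sum>i\<in>J. d i powr ds) + c0 * 1"
    proof -
      have "(\<Sum>i\<in>J. (1/2::real) ^ Suc i) \<le> (\<Sum>i. (1/2) ^ Suc i)"
        using power_half_series J(1) by (intro sum_le_suminf) (auto simp: sums_iff)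
      also have "\<dots> = 1" using power_half_series by (simp add: sums_iff)
      finally show ?thesis using c0 by (intro add_left_mono mult_left_mono) auto
    qed
    finally have "c0 \<le> (\<Sum>i\<in>J. d i powr ds)" by simp
    then have "ennreal c0 \<le> (\<Sum>i\<in>J. ennreal (d i powr ds))" by (simp add: ennreal_leI)
    also have "\<dots> \<le> (\<Sum>i. ennreal (d i powr ds))" using J(1) by (intro sum_le_suminf) auto
    finally show "ennreal c0 \<le> (\<Sum>i. ennreal (diameter (U i) powr ds))" by (simp add: d_def)
  qed
  also have "\<dots> \<le> hausdorff_outer ds K" using c(1) by (intro hausdorff_pre_le_outer) auto
  finally show ?thesis using c0 by (metis ennreal_less_zero_iff order_less_le_trans)
qed

definition muK :: real where "muK = enn2real (hausdorff_outer ds K)"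

lemma muK: "hausdorff_outer ds K = ennreal muK" and muK_pos: "0 < muK"
proof -
  have "hausdorff_outer ds K < top" using hausdorff_outer_K_le order_le_less_trans by fastforce
  then show "hausdorff_outer ds K = ennreal muK" "0 < muK"
    using hausdorff_outer_K_pos by (auto simp: muK_def enn2real_positive_iff)
qed

section \<open>Mass of cells and balls\<close>

definition M where "M = double_gasket_measure k q"

lemma space_M: "space M = X"
  by (simp add: M_def double_gasket_measure_def space_restrict_space)

lemma sets_M: "sets M = sets (restrict_space borel X)"
  by (simp add: M_def double_gasket_measure_def sets_restrict_space)

lemma sets_MI: "A \<in> sets borel \<Longrightarrow> A \<subseteq> X \<Longrightarrow> A \<in> sets M"
  unfolding sets_M using closed_X by (subst sets_restrict_space_iff) auto

lemma emeasure_M: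
  assumes "A \<in> sets borel" "A \<subseteq> X"
  shows "emeasure M A = hausdorff_outer ds A"
proof -
  have "emeasure M A = emeasure (hausdorff_measure ds) A"
    unfolding M_def double_gasket_measure_def gasket_dim_eq
    using assms closed_X by (intro emeasure_restrict_space) auto
  then show ?thesis using assms(1) by (simp add: emeasure_hausdorff_measure)
qed

lemma cset_sets: "\<iota> \<in> cells m \<Longrightarrow> cset \<iota> \<in> sets M"
  using closed_cset cset_subset_X by (intro sets_MI) auto

lemma emeasure_cset: "\<iota> \<in> cells m \<Longrightarrow> emeasure M (cset \<iota>) = ennreal (muK * (1 / N) ^ m)"
  using closed_cset cset_subset_X hausdorff_outer_cset muK N_pos muK_pos
  by (subst emeasure_M) (auto simp: mult.commute simp flip: ennreal_mult)

lemma emeasure_cells_le: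
  assumes "A \<subseteq> (\<Union>\<iota>\<in>I. cset \<iota>)" "I \<subseteq> cells m"
  shows "emeasure M A \<le> ennreal (real (card I) * (muK * (1 / N) ^ m))"
proof -
  have I: "finite I" using assms(2) finite_cells finite_subset by blast
  have "emeasure M A \<le> emeasure M (\<Union>\<iota>\<in>I. cset \<iota>)"
    using assms I cset_sets by (intro emeasure_mono sets.finite_UN) auto
  also have "\<dots> \<le> (\<Sum>\<iota>\<in>I. emeasure M (cset \<iota>))"
    using assms I cset_sets by (intro emeasure_subadditive_finite) auto
  also have "\<dots> = (\<Sum>\<iota>\<in>I. ennreal (muK * (1 / N) ^ m))"
    using assms(2) by (intro sum.cong) (auto simp: emeasure_cset)
  also have "\<dots> = ennreal (real (card I) * (muK * (1 / N) ^ m))"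
    using muK_pos N_pos by (simp add: ennreal_mult'' ennreal_of_nat_eq_real_of_nat)
  finally show ?thesis .
qed

lemma emeasure_X: "emeasure M X \<le> ennreal (2 * muK)"
  using emeasure_cells_le[of X "cells 0" 0] X_cells[of 0] card_cells[of 0] by simp

lemma finite_measure_M: "finite_measure M"
  by (rule finite_measureI) (use emeasure_X space_M in \<open>auto simp: top_unique\<close>)

sublocale M: finite_measure M
  by (rule finite_measure_M)

text \<open>The radius \<open>4 * (1/2) ^ m\<close> is the one that covers adjacent cells. The ball
  is small compared with cells that are \<open>h\<close> levels coarser, so few of them meet
  it.\<close>

lemma ball_measure_upper:
  obtains C where "0 < C"
    "\<And>m x (r::real). x \<in> X \<Longrightarrow> r \<le> 4 * (1/2) ^ m \<Longrightarrow> emeasure M (ball x r \<inter> X) \<le> ennreal (C * (1 / N) ^ m)"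
proof -
  obtain c where c: "0 < c"
    "\<forall>m A. (\<forall>x\<in>A. \<forall>y\<in>A. dist x y < c * (1/2) ^ m) \<longrightarrow>
       real (card {\<iota>\<in>cells m. cset \<iota> \<inter> A \<noteq> {}}) \<le> 2 * N\<^sup>2"
    using card_cells_meeting by blast
  \<comment> \<open>The ball has diameter at most \<open>8 * (1/2) ^ m\<close>, and this choice puts
    it below \<open>c * (1/2) ^ (m - h)\<close>. Levels \<open>m < h\<close> are handled by the
    total mass, which the factor \<open>N ^ h\<close> in \<open>C\<close> pays for.\<close>
  obtain h where h: "(1/2) ^ h < c / 8" using real_arch_pow_inv[of "c / 8" "1/2"] c(1) by auto
  define C where "C = 2 * N\<^sup>2 * muK * N ^ h"
  show thesis
  proof (rule that)
    show "0 < C" using N_pos muK_pos by (simp add: C_def)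
    fix m x and r :: real assume x: "x \<in> X" and r: "r \<le> 4 * (1/2) ^ m"
    show "emeasure M (ball x r \<inter> X) \<le> ennreal (C * (1 / N) ^ m)"
    proof (cases "h \<le> m")
      case True
      let ?I = "{\<iota>\<in>cells (m - h). cset \<iota> \<inter> ball x r \<noteq> {}}"
      have "ball x r \<inter> X \<subseteq> (\<Union>\<iota>\<in>?I. cset \<iota>)" using X_cells[of "m - h"] by auto
      then have "emeasure M (ball x r \<inter> X) \<le> ennreal (real (card ?I) * (muK * (1 / N) ^ (m - h)))"
        by (rule emeasure_cells_le) auto
      also have "\<dots> \<le> ennreal (2 * N\<^sup>2 * (muK * (1 / N) ^ (m - h)))"
      proof (intro ennreal_leI mult_right_mono c(2)[rule_format])
        fix y z assume "y \<in> ball x r" "z \<in> ball x r"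
        then have "dist y z < 2 * r" using dist_triangle3[of y z x] by simp
        also have "\<dots> \<le> 8 * (1/2) ^ m" using r by simp
        also have "\<dots> = 8 * (1/2) ^ h * (1/2) ^ (m - h)" using True by (simp flip: power_add)
        also have "\<dots> \<le> c * (1/2) ^ (m - h)" using h by (intro mult_right_mono) auto
        finally show "dist y z < c * (1/2) ^ (m - h)" .
      qed (use N_pos muK_pos in auto)
      also have "2 * N\<^sup>2 * (muK * (1 / N) ^ (m - h)) = C * (1 / N) ^ m"
        using N_pos True by (simp add: C_def power_diff power_divide)
      finally show ?thesis .
    next
      case False
      have "emeasure M (ball x r \<inter> X) \<le> emeasure M X"
        using closed_X by (intro emeasure_mono sets_MI) auto
      also have "\<dots> \<le> ennreal (2 * muK)" by (rule emeasure_X)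
      also have "\<dots> \<le> ennreal (C * (1 / N) ^ m)"
      proof (rule ennreal_leI)
        have "N ^ m \<le> N ^ h" using False N_ge by (intro power_increasing) auto
        then have "1 \<le> N ^ h * (1 / N) ^ m" using N_pos by (simp add: power_divide)
        moreover have "1 \<le> N\<^sup>2" using N_ge by (intro one_le_power) auto
        ultimately have "1 * 1 \<le> N\<^sup>2 * (N ^ h * (1 / N) ^ m)" by (intro mult_mono) auto
        then have "2 * muK * 1 \<le> 2 * muK * (N\<^sup>2 * (N ^ h * (1 / N) ^ m))"
          using muK_pos by (intro mult_left_mono) auto
        then show "2 * muK \<le> C * (1 / N) ^ m" by (simp add: C_def mult_ac)
      qed
      finally show ?thesis .
    qed
  qed
qed

lemma ball_measure_lower:
  assumes "x \<in> X" "2 * (1/2) ^ m < r"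
  shows "ennreal (muK * (1 / N) ^ m) \<le> emeasure M (ball x r \<inter> X)"
proof -
  obtain \<iota> where \<iota>: "\<iota> \<in> cells m" "x \<in> cset \<iota>" using X_cellE[OF assms(1)] .
  have "cset \<iota> \<subseteq> ball x r \<inter> X"
    using cset_dist[OF \<iota>] assms(2) cset_subset_X[OF \<iota>(1)] by fastforce
  then have "emeasure M (cset \<iota>) \<le> emeasure M (ball x r \<inter> X)"
    using closed_X by (intro emeasure_mono sets_MI) auto
  then show ?thesis using emeasure_cset[OF \<iota>(1)] by simp
qed

end

section \<open>Discrete energies and the scaling factor\<close>

lemma powr_sum_le:
  fixes t :: "'i \<Rightarrow> real"
  assumes I: "finite I" and t: "\<And>i. i \<in> I \<Longrightarrow> 0 \<le> t i" and p: "0 < p"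
  shows "(\<Sum>i\<in>I. t i) powr p \<le> real (card I) powr p * (\<Sum>i\<in>I. t i powr p)"
proof (cases "I = {}")
  case False
  define T where "T = Max (t ` I)"
  have "T \<in> t ` I" unfolding T_def using I False by (intro Max_in) auto
  then obtain i where i: "i \<in> I" "t i = T" by auto
  have le: "t j \<le> T" if "j \<in> I" for j using I that by (auto simp: T_def)
  have "(\<Sum>i\<in>I. t i) \<le> real (card I) * T" using sum_bounded_above[of I t T] le by simp
  then have "(\<Sum>i\<in>I. t i) powr p \<le> (real (card I) * T) powr p"
    using p t by (intro powr_mono2) (auto intro: sum_nonneg)
  also have "\<dots> = real (card I) powr p * t i powr p" using t[OF i(1)] i(2) by (simp add: powr_mult)
  also have "\<dots> \<le> real (card I) powr p * (\<Sum>i\<in>I. t i powr p)"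
    using I i(1) by (intro mult_left_mono member_le_sum[of i I "\<lambda>i. t i powr p"]) auto
  finally show ?thesis .
qed simp

lemma powr_add_le:
  fixes s t p :: real
  assumes "0 \<le> s" "0 \<le> t" "0 < p"
  shows "(s + t) powr p \<le> 2 powr p * (s powr p + t powr p)"
  using powr_sum_le[of "{True, False}" "\<lambda>b. if b then s else t" p] assms by simp

lemma powr_abs_diff_le:
  fixes x y z p :: real
  assumes "0 < p"
  shows "\<bar>x - y\<bar> powr p \<le> 2 powr p * (\<bar>x - z\<bar> powr p + \<bar>z - y\<bar> powr p)"
proof -
  have "\<bar>x - y\<bar> powr p \<le> (\<bar>x - z\<bar> + \<bar>z - y\<bar>) powr p" using assms by (intro powr_mono2) auto
  also have "\<dots> \<le> 2 powr p * (\<bar>x - z\<bar> powr p + \<bar>z - y\<bar> powr p)" using assms by (intro powr_add_le) auto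
  finally show ?thesis .
qed

lemma realpow_powr: "(x ^ m) powr a = (x powr a) ^ m" for x a :: real
  by (induction m) (simp_all only: power_0 power_Suc powr_mult powr_one_eq_one)

lemma sum_swap3:
  "(\<Sum>x\<in>A. \<Sum>y\<in>B. \<Sum>z\<in>C. \<Sum>t\<in>D. f x y z t) = (\<Sum>t\<in>D. \<Sum>x\<in>A. \<Sum>y\<in>B. \<Sum>z\<in>C. f x y z t)"
proof -
  have "(\<Sum>x\<in>A. \<Sum>y\<in>B. \<Sum>z\<in>C. \<Sum>t\<in>D. f x y z t) = (\<Sum>x\<in>A. \<Sum>y\<in>B. \<Sum>t\<in>D. \<Sum>z\<in>C. f x y z t)"
    by (intro sum.cong refl sum.swap)
  also have "\<dots> = (\<Sum>x\<in>A. \<Sum>t\<in>D. \<Sum>y\<in>B. \<Sum>z\<in>C. f x y z t)"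
    by (intro sum.cong refl sum.swap)
  also have "\<dots> = (\<Sum>t\<in>D. \<Sum>x\<in>A. \<Sum>y\<in>B. \<Sum>z\<in>C. f x y z t)"
    by (rule sum.swap)
  finally show ?thesis .
qed

text \<open>Fekete's lemma. The limit is kept as the infimum of the quotients, which later gives a
  lower bound for the conductances without error term.\<close>

lemma subadditive_limit:
  fixes b :: "nat \<Rightarrow> real"
  assumes sub: "\<And>l m. b (l + m) \<le> b l + b m" and lower: "\<And>m. 0 < m \<Longrightarrow> - C * real m \<le> b m"
  obtains L where "(\<lambda>m. b m / real m) \<longlonglongrightarrow> L" "\<And>m. 0 < m \<Longrightarrow> L \<le> b m / real m"
proof -
  define S where "S = (\<lambda>m. b m / real m) ` {0<..}"
  define L where "L = Inf S"
  have bdd: "bdd_below S"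
    unfolding bdd_below_def S_def
  proof (intro exI[of _ "- C"] ballI)
    fix x assume "x \<in> (\<lambda>m. b m / real m) ` {0<..}"
    then show "- C \<le> x" using lower by (auto simp: field_simps)
  qed
  have L_le: "L \<le> b m / real m" if "0 < m" for m
    unfolding L_def using bdd that by (intro cInf_lower) (auto simp: S_def)
  have "(\<lambda>m. b m / real m) \<longlonglongrightarrow> L"
  proof (rule LIMSEQ_I)
    fix e :: real assume e: "0 < e"
    have "S \<noteq> {}" by (auto simp: S_def)
    then obtain x where "x \<in> S" "x < L + e / 2"
      using cInf_lessD[of S "L + e / 2"] e by (auto simp: L_def)
    then obtain k where k: "0 < k" "b k / real k < L + e / 2" by (auto simp: S_def)
    \<comment> \<open>Pays for the remainder term \<open>b (m mod k)\<close> and for replacing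
      \<open>m div k\<close> by \<open>m / k\<close>.\<close>
    define B where "B = (\<Sum>r<k. \<bar>b r\<bar>) + \<bar>b k\<bar>"
    have mult: "b (i * k + r) \<le> real i * b k + b r" for i r
    proof (induction i)
      case (Suc i)
      have "b (Suc i * k + r) \<le> b k + b (i * k + r)" using sub[of k "i * k + r"] by (simp add: ac_simps)
      then show ?case using Suc by (simp add: algebra_simps)
    qed simp
    have up: "b m / real m \<le> b k / real k + B / real m" if m: "0 < m" for m
    proof -
      define r where "r = m mod k"
      have r: "r < k" using k by (simp add: r_def)
      have meq: "m div k * k + r = m" by (simp add: r_def)
      have "b m \<le> real (m div k) * b k + b r" using mult[of "m div k" r] meq by simp
      also have "real (m div k) = (real m - real r) / real k"
        using arg_cong[OF meq, of real] k by (simp add: field_simps)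
      also have "(real m - real r) / real k * b k = real m * (b k / real k) - real r / real k * b k"
        using k by (simp add: field_simps)
      also have "\<dots> \<le> real m * (b k / real k) + \<bar>b k\<bar>"
      proof -
        have "\<bar>real r / real k * b k\<bar> \<le> 1 * \<bar>b k\<bar>"
          unfolding abs_mult using r by (intro mult_right_mono) auto
        then show ?thesis by linarith
      qed
      finally have "b m \<le> real m * (b k / real k) + \<bar>b k\<bar> + b r" by simp
      moreover have "b r \<le> (\<Sum>r<k. \<bar>b r\<bar>)"
        using member_le_sum[of r "{..<k}" "\<lambda>r. \<bar>b r\<bar>"] r by auto
      ultimately have "b m \<le> real m * (b k / real k) + B" by (simp add: B_def)
      then have "b m / real m \<le> (real m * (b k / real k) + B) / real m" by (rule divide_right_mono) simp
      then show ?thesis using m by (simp add: add_divide_distrib)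
    qed
    obtain M where M: "2 * B / e < real M" using reals_Archimedean2 by blast
    show "\<exists>no. \<forall>m\<ge>no. norm (b m / real m - L) < e"
    proof (intro exI[of _ "Suc M"] allI impI)
      fix m assume "Suc M \<le> m"
      then have m: "0 < m" "real M < real m" by auto
      have "2 * B < e * real M" using M e by (simp add: field_simps)
      also have "\<dots> < e * real m" using m e by simp
      finally have "B / real m < e / 2" using m by (simp add: field_simps)
      then show "norm (b m / real m - L) < e"
        using up[OF m(1)] L_le[OF m(1)] k(2) unfolding real_norm_def abs_less_iff by linarith
    qed
  qed
  then show thesis using that L_le by blast
qed

section \<open>Discrete energies and conductances\<close>

locale gasket_energy = gasket_setup k q n N
  for k :: "'n::finite" and q :: "nat \<Rightarrow> real^'n" and n :: nat and N :: real +
  fixes p :: real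
  assumes p: "1 < p"
begin

text \<open>Twice the graph energy. Summing over words and vertex indices instead of edges makes it
  split over the first letters of the words (\<open>En_add\<close>).\<close>

definition En :: "nat \<Rightarrow> (real^'n \<Rightarrow> real) \<Rightarrow> real" where
  "En m f = (\<Sum>w\<in>words n m. \<Sum>a\<le>n. \<Sum>b\<le>n. \<bar>f (word_map q w (q a)) - f (word_map q w (q b))\<bar> powr p)"

lemma En_nonneg: "0 \<le> En m f"
  by (auto simp: En_def intro!: sum_nonneg)

lemma En_0: "En 0 f = (\<Sum>a\<le>n. \<Sum>b\<le>n. \<bar>f (q a) - f (q b)\<bar> powr p)"
  by (simp add: En_def words_0)

lemma En_add: "En (l + m) f = (\<Sum>u\<in>words n l. En m (\<lambda>x. f (word_map q u x)))"
  by (simp add: En_def sum_words_add word_map_append)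

lemma En_Suc: "En (Suc m) f = (\<Sum>i\<le>n. En m (\<lambda>x. f (gasket_map q i x)))"
  by (simp add: En_def sum_words_Suc)

lemma En_cong:
  assumes "\<And>x. x \<in> K \<Longrightarrow> f x = g x"
  shows "En m f = En m g"
  unfolding En_def using assms by (intro sum.cong refl) (auto simp: words_def word_map_K q_in_K)

lemma En_mono:
  assumes "\<And>x y. \<bar>f x - f y\<bar> \<le> \<bar>g x - g y\<bar>"
  shows "En m f \<le> En m g"
  unfolding En_def using assms p by (intro sum_mono powr_mono2) auto

lemma En_affine: "En m (\<lambda>x. c * f x + d) = \<bar>c\<bar> powr p * En m f"
proof -
  have "\<bar>c * s + d - (c * t + d)\<bar> powr p = \<bar>c\<bar> powr p * \<bar>s - t\<bar> powr p" for s t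
    by (simp add: abs_mult powr_mult flip: right_diff_distrib)
  then show ?thesis by (simp add: En_def sum_distrib_left)
qed

lemma vertex_pair_le_En_0: "a \<le> n \<Longrightarrow> b \<le> n \<Longrightarrow> \<bar>f (q a) - f (q b)\<bar> powr p \<le> En 0 f"
proof -
  assume ab: "a \<le> n" "b \<le> n"
  have "\<bar>f (q a) - f (q b)\<bar> powr p \<le> (\<Sum>b\<le>n. \<bar>f (q a) - f (q b)\<bar> powr p)"
    using ab by (intro member_le_sum[of b "{..n}" "\<lambda>b. \<bar>f (q a) - f (q b)\<bar> powr p"]) auto
  also have "\<dots> \<le> En 0 f"
    unfolding En_0 using ab
    by (intro member_le_sum[of a "{..n}" "\<lambda>a. \<Sum>b\<le>n. \<bar>f (q a) - f (q b)\<bar> powr p"]) (auto intro: sum_nonneg)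
  finally show ?thesis .
qed

lemma word_map_eq_iff [simp]: "word_map q w x = word_map q w y \<longleftrightarrow> x = y"
proof -
  have "dist (word_map q w x) (word_map q w y) = 0 \<longleftrightarrow> dist x y = 0" by (simp add: dist_word_map)
  then show ?thesis by simp
qed

lemma cmap_eq_iff [simp]: "cmap \<iota> x = cmap \<iota> y \<longleftrightarrow> x = y"
proof -
  have "dist (cmap \<iota> x) (cmap \<iota> y) = 0 \<longleftrightarrow> dist x y = 0" by (simp add: dist_cmap)
  then show ?thesis by simp
qed

lemma q_eq_iff: "a \<le> n \<Longrightarrow> b \<le> n \<Longrightarrow> q a = q b \<longleftrightarrow> a = b"
  using dist_q[of a b] by (auto split: if_splits)

text \<open>An ordered edge determines its cell and the indices of its ends, because two cells of
  one level cannot share two vertices.\<close>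

lemma graph_energy_eq: "graph_energy q p m f = En m f / 2"
proof -
  define T where "T = {(w, a, b). w \<in> words n m \<and> a \<le> n \<and> b \<le> n \<and> a \<noteq> b}"
  define \<Phi> where "\<Phi> = (\<lambda>(w, a, b). (word_map q w (q a), word_map q w (q b)))"
  have inj: "inj_on \<Phi> T"
  proof (rule inj_onI)
    fix x y assume x: "x \<in> T" and y: "y \<in> T" and e: "\<Phi> x = \<Phi> y"
    obtain w a b where x': "x = (w, a, b)" by (cases x)
    obtain v a' b' where y': "y = (v, a', b')" by (cases y)
    have T: "w \<in> words n m" "a \<le> n" "b \<le> n" "a \<noteq> b" "v \<in> words n m" "a' \<le> n" "b' \<le> n" "a' \<noteq> b'"
      using x y by (auto simp: T_def x' y')
    have eq: "word_map q w (q a) = word_map q v (q a')" "word_map q w (q b) = word_map q v (q b')"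
      using e by (auto simp: \<Phi>_def x' y')
    have sets: "set w \<subseteq> {..n}" "set v \<subseteq> {..n}" "length w = m" "length v = m" using T by (auto simp: words_def)
    \<comment> \<open>Coordinate \<open>a\<close> drops by one unit along the edge in
      \<open>w\<close>; in \<open>v\<close> this happens only if the first end has index
      \<open>a\<close> too.\<close>
    have "real (digits w a) + 1 = real (digits v a) + bary a (q a')"
      using bary_word_map[OF sets(1) T(2), of "q a"] bary_word_map[OF sets(2) T(2), of "q a'"] eq sets T
      by (simp add: bary_q)
    moreover have "real (digits w a) = real (digits v a) + bary a (q b')"
      using bary_word_map[OF sets(1) T(2), of "q b"] bary_word_map[OF sets(2) T(2), of "q b'"] eq sets T
      by (simp add: bary_q)
    ultimately have "a' = a" using T by (auto simp: bary_q split: if_splits)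
    then have "w = v" using word_map_q_inj T eq by metis
    then show "x = y" using \<open>a' = a\<close> eq(2) T by (simp add: x' y' q_eq_iff)
  qed
  have img: "gasket_edges q m = \<Phi> ` T"
  proof
    show "gasket_edges q m \<subseteq> \<Phi> ` T"
    proof
      fix z assume "z \<in> gasket_edges q m"
      then obtain x y w where z: "z = (x, y)" "x \<noteq> y" "w \<in> words n m" "x \<in> cell q w" "y \<in> cell q w"
        by (auto simp: gasket_edges_def n_def)
      then obtain a b where "a \<le> n" "b \<le> n" "x = word_map q w (q a)" "y = word_map q w (q b)"
        by (auto simp: cell_def n_def)
      then show "z \<in> \<Phi> ` T" using z by (intro image_eqI[of _ _ "(w, a, b)"]) (auto simp: \<Phi>_def T_def)
    qed
    show "\<Phi> ` T \<subseteq> gasket_edges q m"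
      by (fastforce simp: \<Phi>_def T_def gasket_edges_def cell_def q_eq_iff simp flip: n_def)
  qed
  have "(\<Sum>(x, y)\<in>gasket_edges q m. \<bar>f x - f y\<bar> powr p)
      = (\<Sum>(w, a, b)\<in>T. \<bar>f (word_map q w (q a)) - f (word_map q w (q b))\<bar> powr p)"
    unfolding img by (subst sum.reindex[OF inj]) (auto simp: \<Phi>_def intro!: sum.cong)
  also have "\<dots> = (\<Sum>(w, a, b)\<in>words n m \<times> {..n} \<times> {..n}. \<bar>f (word_map q w (q a)) - f (word_map q w (q b))\<bar> powr p)"
    by (intro sum.mono_neutral_left) (auto simp: T_def finite_words)
  also have "\<dots> = En m f" by (simp add: En_def sum.cartesian_product)
  finally show ?thesis by (simp add: graph_energy_def)
qed

abbreviation c where "c \<equiv> conductance q p"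

lemma conductance_eq: "c m = Inf ((\<lambda>f. En m f / 2) ` {f. f (q 0) = 0 \<and> f (q 1) = 1})"
  by (simp only: conductance_def graph_energy_eq setcompr_eq_image)

lemma conductance_le: "f (q 0) = 0 \<Longrightarrow> f (q 1) = 1 \<Longrightarrow> c m \<le> En m f / 2"
  unfolding conductance_eq
  by (intro cInf_lower) (auto intro!: bdd_belowI2[of _ 0] simp: En_nonneg)

lemma one_le_n: "1 \<le> n" and zero_le_n: "0 \<le> n"
  using dim by auto

lemma conductance_witness: "\<exists>f. f (q 0) = 0 \<and> f (q 1) = (1::real)"
proof (intro exI conjI)
  show "bary 1 (q 0) = 0" "bary 1 (q 1) = 1" using one_le_n by (simp_all only: bary_q zero_le_n) auto
qed

lemma conductance_approx:
  assumes "c m < t"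
  obtains f where "f (q 0) = 0" "f (q 1) = 1" "En m f / 2 < t"
proof -
  define S where "S = (\<lambda>f. En m f / 2) ` {f. f (q 0) = 0 \<and> f (q 1) = 1}"
  have "S \<noteq> {}" unfolding S_def using conductance_witness by blast
  moreover have "Inf S < t" using assms by (simp only: conductance_eq S_def)
  ultimately obtain x where "x \<in> S" "x < t" using cInf_lessD by blast
  then show thesis using that by (auto simp: S_def)
qed

lemma conductance_greatest:
  assumes "\<And>f. f (q 0) = 0 \<Longrightarrow> f (q 1) = 1 \<Longrightarrow> t \<le> En m f / 2"
  shows "t \<le> c m"
  unfolding conductance_eq
proof (rule cInf_greatest)
  show "(\<lambda>f. En m f / 2) ` {f. f (q 0) = 0 \<and> f (q 1) = 1} \<noteq> {}" using conductance_witness by blast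
qed (use assms in auto)

text \<open>From \<open>q a\<close> to \<open>q b\<close> one passes through the midpoint, which is
  a vertex of both subcells at the ends; each level doubles the number of pieces.\<close>

lemma vertex_diff_le_En:
  "a \<le> n \<Longrightarrow> b \<le> n \<Longrightarrow> \<bar>f (q a) - f (q b)\<bar> \<le> 2 ^ m * En m f powr (1 / p)"
proof (induction m arbitrary: f a b)
  case 0
  have "\<bar>f (q a) - f (q b)\<bar> = (\<bar>f (q a) - f (q b)\<bar> powr p) powr (1 / p)"
    using p by (simp add: powr_powr)
  also have "\<dots> \<le> En 0 f powr (1 / p)"
    using p 0 by (intro powr_mono2 vertex_pair_le_En_0) auto
  finally show ?case by simp
next
  case (Suc m)
  have sub: "En m (\<lambda>x. f (gasket_map q i x)) \<le> En (Suc m) f" if "i \<le> n" for i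
    unfolding En_Suc using that
    by (intro member_le_sum[of i "{..n}" "\<lambda>i. En m (\<lambda>x. f (gasket_map q i x))"]) (auto simp: En_nonneg)
  have mid: "gasket_map q a (q b) = gasket_map q b (q a)" by (simp add: gasket_map_def add.commute)
  have le: "\<bar>f (gasket_map q i (q a)) - f (gasket_map q i (q b))\<bar> \<le> 2 ^ m * En (Suc m) f powr (1 / p)" if "i \<le> n" for i
  proof -
    have "\<bar>f (gasket_map q i (q a)) - f (gasket_map q i (q b))\<bar> \<le> 2 ^ m * En m (\<lambda>x. f (gasket_map q i x)) powr (1 / p)"
      using Suc.IH[OF Suc.prems, of "\<lambda>x. f (gasket_map q i x)"] .
    also have "\<dots> \<le> 2 ^ m * En (Suc m) f powr (1 / p)"
      using p sub[OF that] by (intro mult_left_mono powr_mono2) (auto simp: En_nonneg)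
    finally show ?thesis .
  qed
  show ?case using le[OF Suc.prems(1)] le[OF Suc.prems(2)] by (simp add: gasket_map_q mid)
qed

text \<open>A crude bound, for two purposes: conductances are positive, and their logarithms
  decrease at most linearly, as Fekete's lemma requires.\<close>

lemma conductance_lower: "(1 / 2) * ((1/2) powr p) ^ m \<le> c m"
proof (rule conductance_greatest)
  fix f assume f: "f (q 0) = 0" "f (q 1) = (1::real)"
  have "1 \<le> 2 ^ m * En m f powr (1 / p)"
    using vertex_diff_le_En[of 0 1 f m] f one_le_n by simp
  then have "(1/2) ^ m \<le> En m f powr (1 / p)" by (simp add: field_simps power_divide)
  then have "((1/2) ^ m) powr p \<le> (En m f powr (1 / p)) powr p" using p by (intro powr_mono2) auto
  also have "\<dots> = En m f" using p En_nonneg[of m f] by (simp add: powr_powr)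
  also have "((1/2::real) ^ m) powr p = ((1/2) powr p) ^ m" by (rule realpow_powr)
  finally show "(1 / 2) * ((1/2) powr p) ^ m \<le> En m f / 2" by simp
qed

lemma conductance_pos: "0 < c m"
  using conductance_lower[of m] by (rule less_le_trans[rotated]) simp

subsection \<open>Symmetry and the extension operator\<close>

text \<open>The affine symmetry of the simplex that permutes the vertices by \<sigma>. With it the
  pair \<open>q 0\<close>, \<open>q 1\<close> in the definition of the conductance can be replaced
  by any other pair.\<close>

definition perm_map :: "(nat \<Rightarrow> nat) \<Rightarrow> real^'n \<Rightarrow> real^'n" where
  "perm_map \<sigma> x = (\<Sum>j\<le>n. bary j x *\<^sub>R q (\<sigma> j))"

lemma sum_bary_q: "i \<le> n \<Longrightarrow> (\<Sum>j\<le>n. bary j (q i) *\<^sub>R g j) = g i" for g :: "nat \<Rightarrow> real^'n"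
proof -
  assume i: "i \<le> n"
  have "(\<Sum>j\<le>n. bary j (q i) *\<^sub>R g j) = (\<Sum>j\<le>n. if j = i then g j else 0)"
    using i by (intro sum.cong) (auto simp: bary_q)
  then show ?thesis using i by simp
qed

lemma perm_map_q: "i \<le> n \<Longrightarrow> perm_map \<sigma> (q i) = q (\<sigma> i)"
  unfolding perm_map_def by (rule sum_bary_q)

lemma perm_map_gasket_map: "i \<le> n \<Longrightarrow> perm_map \<sigma> (gasket_map q i x) = gasket_map q (\<sigma> i) (perm_map \<sigma> x)"
proof -
  assume i: "i \<le> n"
  have "perm_map \<sigma> (gasket_map q i x) = (\<Sum>j\<le>n. (1/2) *\<^sub>R (bary j x *\<^sub>R q (\<sigma> j) + bary j (q i) *\<^sub>R q (\<sigma> j)))"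
    unfolding perm_map_def
    by (intro sum.cong) (auto simp: bary_gasket_map algebra_simps add_divide_distrib)
  also have "\<dots> = (1/2) *\<^sub>R (perm_map \<sigma> x + perm_map \<sigma> (q i))"
    by (simp add: perm_map_def sum.distrib scaleR_sum_right[symmetric])
  finally show ?thesis using i by (simp add: perm_map_q gasket_map_def)
qed

lemma En_perm_map:
  assumes \<sigma>: "bij_betw \<sigma> {..n} {..n}"
  shows "En m (\<lambda>x. f (perm_map \<sigma> x)) = En m f"
proof (induction m arbitrary: f)
  case 0
  have "En 0 (\<lambda>x. f (perm_map \<sigma> x)) = (\<Sum>a\<le>n. \<Sum>b\<le>n. \<bar>f (q (\<sigma> a)) - f (q (\<sigma> b))\<bar> powr p)"
    unfolding En_0 by (intro sum.cong) (auto simp: perm_map_q)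
  also have "\<dots> = (\<Sum>a\<le>n. \<Sum>b\<le>n. \<bar>f (q (\<sigma> a)) - f (q b)\<bar> powr p)"
    by (intro sum.cong refl sum.reindex_bij_betw[OF \<sigma>])
  also have "\<dots> = En 0 f"
    unfolding En_0 by (rule sum.reindex_bij_betw[OF \<sigma>])
  finally show ?case .
next
  case (Suc m)
  have "En (Suc m) (\<lambda>x. f (perm_map \<sigma> x)) = (\<Sum>i\<le>n. En m (\<lambda>x. f (gasket_map q (\<sigma> i) x)))"
    unfolding En_Suc
  proof (intro sum.cong refl)
    fix i assume "i \<in> {..n}"
    then have "En m (\<lambda>x. f (perm_map \<sigma> (gasket_map q i x))) = En m (\<lambda>x. f (gasket_map q (\<sigma> i) (perm_map \<sigma> x)))"
      by (simp add: perm_map_gasket_map)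
    also have "\<dots> = En m (\<lambda>x. f (gasket_map q (\<sigma> i) x))" by (rule Suc.IH)
    finally show "En m (\<lambda>x. f (perm_map \<sigma> (gasket_map q i x))) = En m (\<lambda>x. f (gasket_map q (\<sigma> i) x))" .
  qed
  also have "\<dots> = En (Suc m) f"
    unfolding En_Suc by (rule sum.reindex_bij_betw[OF \<sigma>])
  finally show ?case .
qed

lemma exists_perm:
  assumes "a \<le> n" "b \<le> n" "a \<noteq> b"
  obtains \<sigma> where "bij_betw \<sigma> {..n} {..n}" "\<sigma> a = 1" "\<sigma> b = (0::nat)"
proof -
  let ?s = "Transposition.transpose b 0"
  have s: "?s permutes {..n}" using assms by (intro permutes_swap_id) auto
  then have sa: "?s a \<in> {..n}" using assms permutes_in_image[OF s, of a] by simp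
  have t: "Transposition.transpose (?s a) 1 permutes {..n}"
    using sa one_le_n by (intro permutes_swap_id) auto
  have "?s a \<noteq> 0" using assms by (auto simp: Transposition.transpose_def)
  then have "(Transposition.transpose (?s a) 1 \<circ> ?s) b = 0" "(Transposition.transpose (?s a) 1 \<circ> ?s) a = 1"
    by (auto simp: Transposition.transpose_def)
  moreover have "bij_betw (Transposition.transpose (?s a) 1 \<circ> ?s) {..n} {..n}"
    using permutes_compose[OF s t] by (rule permutes_imp_bij)
  ultimately show thesis using that by blast
qed

text \<open>A near-minimiser with slack factor 2 stands in for a minimiser, and \<open>En\<close>
  counts edges twice, hence 4. The truncation at 1 keeps the terms \<open>1 - F a b\<close> in
  \<open>extension\<close> nonnegative.\<close>

lemma pair_potential:
  assumes "a \<le> n" "b \<le> n" "a \<noteq> b"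
  obtains f where "f (q a) = 1" "f (q b) = 0" "\<And>x. f x \<le> (1::real)" "En m f \<le> 4 * c m"
proof -
  obtain \<sigma> where \<sigma>: "bij_betw \<sigma> {..n} {..n}" "\<sigma> a = 1" "\<sigma> b = 0" using exists_perm[OF assms] .
  have "c m < 2 * c m" using conductance_pos[of m] by simp
  then obtain f where f: "f (q 0) = 0" "f (q 1) = 1" "En m f / 2 < 2 * c m" by (rule conductance_approx)
  show thesis
  proof (rule that[of "\<lambda>x. min 1 (f (perm_map \<sigma> x))"])
    have "En m (\<lambda>x. min 1 (f (perm_map \<sigma> x))) \<le> En m (\<lambda>x. f (perm_map \<sigma> x))" by (rule En_mono) auto
    also have "\<dots> = En m f" by (rule En_perm_map[OF \<sigma>(1)])
    finally show "En m (\<lambda>x. min 1 (f (perm_map \<sigma> x))) \<le> 4 * c m" using f(3) by simp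
  qed (use assms f \<sigma> in \<open>auto simp: perm_map_q simp del: q_0\<close>)
qed

text \<open>\<open>4\<close> is from \<open>pair_potential\<close>, \<open>(N * N) powr p\<close>
  from the power of a sum over pairs of vertices, and \<open>N\<close> from the sum over the second
  vertex.\<close>

definition ext_const where "ext_const = 4 * N * (N * N) powr p"

lemma ext_const_pos: "0 < ext_const"
  using N_pos by (simp add: ext_const_def)

text \<open>Potentials for pairs of vertices are combined into functions \<psi> that are 1 at one
  vertex and 0 at the others; these interpolate \<open>g\<close>, and clamping to the range of the
  vertex values gives the maximum principle.\<close>

lemma extension:
  obtains h where "\<And>a. a \<le> n \<Longrightarrow> h (q a) = g (q a)"
    "\<And>x lo hi. (\<And>a. a \<le> n \<Longrightarrow> lo \<le> g (q a) \<and> g (q a) \<le> hi) \<Longrightarrow> lo \<le> h x \<and> h x \<le> hi"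
    "En m h \<le> ext_const * c m * En 0 g"
proof -
  have "\<forall>a\<in>{..n}. \<forall>b\<in>{..n}-{a}. \<exists>f. f (q a) = 1 \<and> f (q b) = 0 \<and> (\<forall>x. f x \<le> (1::real)) \<and> En m f \<le> 4 * c m"
    using pair_potential[of _ _ m] by (metis DiffE atMost_iff singletonI)
  then obtain F' where F': "\<forall>a\<in>{..n}. \<forall>b\<in>{..n}-{a}.
      F' a b (q a) = 1 \<and> F' a b (q b) = 0 \<and> (\<forall>x. F' a b x \<le> (1::real)) \<and> En m (F' a b) \<le> 4 * c m"
    by metis
  \<comment> \<open>With the value 1 on the diagonal, the term \<open>b = a\<close> drops out of the
    sum in \<psi>.\<close>
  define F where "F a b x = (if a = b then 1 else F' a b x)" for a b x
  have Faa: "F a b (q a) = 1" if "a \<le> n" "b \<le> n" for a b using F' that by (auto simp: F_def)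
  have Fab: "F a b (q b) = 0" if "a \<le> n" "b \<le> n" "a \<noteq> b" for a b using F' that by (auto simp: F_def)
  have F1: "F a b x \<le> 1" if "a \<le> n" "b \<le> n" for a b x using F' that by (auto simp: F_def)
  have FE: "En m (F a b) \<le> 4 * c m" if "a \<le> n" "b \<le> n" for a b
  proof (cases "a = b")
    case True
    then have "En m (F a b) = 0" by (simp add: En_def F_def)
    then show ?thesis using conductance_pos[of m] by simp
  next
    case False
    then have "F a b = F' a b" by (auto simp: F_def)
    then show ?thesis using F' that False by auto
  qed
  \<comment> \<open>At \<open>q b\<close> the single term \<open>1 - F a b\<close> already equals 1
    and the others are nonnegative, so the cut-off gives 0; at \<open>q a\<close> all terms
    vanish.\<close>
  define \<psi> where "\<psi> a x = max 0 (1 - (\<Sum>b\<le>n. 1 - F a b x))" for a x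
  have \<psi>aa: "\<psi> a (q a) = 1" if "a \<le> n" for a using Faa that by (simp add: \<psi>_def)
  have \<psi>ab: "\<psi> a (q b) = 0" if "a \<le> n" "b \<le> n" "a \<noteq> b" for a b
  proof -
    have "1 - F a b (q b) \<le> (\<Sum>b'\<le>n. 1 - F a b' (q b))"
      using that F1 by (intro member_le_sum[of b "{..n}" "\<lambda>b'. 1 - F a b' (q b)"]) auto
    then show ?thesis using Fab[OF that] by (simp add: \<psi>_def)
  qed
  have \<psi>d: "\<bar>\<psi> a x - \<psi> a y\<bar> \<le> (\<Sum>b\<le>n. \<bar>F a b x - F a b y\<bar>)" for a x y
  proof -
    have "\<bar>\<psi> a x - \<psi> a y\<bar> \<le> \<bar>(\<Sum>b\<le>n. 1 - F a b y) - (\<Sum>b\<le>n. 1 - F a b x)\<bar>" unfolding \<psi>_def by auto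
    also have "(\<Sum>b\<le>n. 1 - F a b y) - (\<Sum>b\<le>n. 1 - F a b x) = (\<Sum>b\<le>n. F a b x - F a b y)"
      by (simp flip: sum_subtractf)
    also have "\<bar>\<dots>\<bar> \<le> (\<Sum>b\<le>n. \<bar>F a b x - F a b y\<bar>)" by (rule sum_abs)
    finally show ?thesis .
  qed
  \<comment> \<open>Interpolating differences from \<open>g (q 0)\<close> makes the energy depend on
    differences of \<open>g\<close> only.\<close>
  define h0 where "h0 x = g (q 0) + (\<Sum>a\<le>n. (g (q a) - g (q 0)) * \<psi> a x)" for x
  have h0q: "h0 (q b) = g (q b)" if b: "b \<le> n" for b
  proof -
    have "(\<Sum>a\<le>n. (g (q a) - g (q 0)) * \<psi> a (q b)) = (\<Sum>a\<le>n. if a = b then g (q a) - g (q 0) else 0)"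
      using \<psi>aa \<psi>ab b by (intro sum.cong) auto
    then show ?thesis using b by (simp add: h0_def)
  qed
  define lo where "lo = Min ((\<lambda>a. g (q a)) ` {..n})"
  define hi where "hi = Max ((\<lambda>a. g (q a)) ` {..n})"
  have lohi: "lo \<le> g (q a)" "g (q a) \<le> hi" if "a \<le> n" for a
    using that unfolding lo_def hi_def by (auto intro: Min_le Max_ge)
  define h where "h x = max lo (min hi (h0 x))" for x
  have hd: "\<bar>h x - h y\<bar> powr p \<le> (N * N) powr p * (\<Sum>a\<le>n. \<Sum>b\<le>n. \<bar>g (q a) - g (q 0)\<bar> powr p * \<bar>F a b x - F a b y\<bar> powr p)" for x y
  proof -
    have "\<bar>h x - h y\<bar> \<le> \<bar>h0 x - h0 y\<bar>" by (auto simp: h_def)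
    also have "h0 x - h0 y = (\<Sum>a\<le>n. (g (q a) - g (q 0)) * (\<psi> a x - \<psi> a y))"
      by (simp add: h0_def right_diff_distrib sum_subtractf)
    also have "\<bar>\<dots>\<bar> \<le> (\<Sum>a\<le>n. \<bar>g (q a) - g (q 0)\<bar> * \<bar>\<psi> a x - \<psi> a y\<bar>)"
      using sum_abs[of "\<lambda>a. (g (q a) - g (q 0)) * (\<psi> a x - \<psi> a y)" "{..n}"] by (simp add: abs_mult)
    also have "\<dots> \<le> (\<Sum>a\<le>n. \<bar>g (q a) - g (q 0)\<bar> * (\<Sum>b\<le>n. \<bar>F a b x - F a b y\<bar>))"
      by (intro sum_mono mult_left_mono \<psi>d) auto
    also have "\<dots> = (\<Sum>(a, b)\<in>{..n}\<times>{..n}. \<bar>g (q a) - g (q 0)\<bar> * \<bar>F a b x - F a b y\<bar>)"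
      by (simp add: sum_distrib_left sum.cartesian_product)
    finally have "\<bar>h x - h y\<bar> powr p \<le> (\<Sum>(a, b)\<in>{..n}\<times>{..n}. \<bar>g (q a) - g (q 0)\<bar> * \<bar>F a b x - F a b y\<bar>) powr p"
      using p by (intro powr_mono2) auto
    also have "\<dots> \<le> real (card ({..n}\<times>{..n})) powr p *
        (\<Sum>i\<in>{..n}\<times>{..n}. (case i of (a, b) \<Rightarrow> \<bar>g (q a) - g (q 0)\<bar> * \<bar>F a b x - F a b y\<bar>) powr p)"
      using p by (intro powr_sum_le) auto
    also have "real (card ({..n}\<times>{..n})) = N * N" by (simp add: card_cartesian_product N_def algebra_simps)
    also have "(\<Sum>i\<in>{..n}\<times>{..n}. (case i of (a, b) \<Rightarrow> \<bar>g (q a) - g (q 0)\<bar> * \<bar>F a b x - F a b y\<bar>) powr p)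
        = (\<Sum>(a, b)\<in>{..n}\<times>{..n}. \<bar>g (q a) - g (q 0)\<bar> powr p * \<bar>F a b x - F a b y\<bar> powr p)"
      by (intro sum.cong) (auto simp: powr_mult)
    also have "\<dots> = (\<Sum>a\<le>n. \<Sum>b\<le>n. \<bar>g (q a) - g (q 0)\<bar> powr p * \<bar>F a b x - F a b y\<bar> powr p)"
      by (simp add: sum.cartesian_product)
    finally show ?thesis .
  qed
  have "En m h \<le> (\<Sum>w\<in>words n m. \<Sum>d\<le>n. \<Sum>e\<le>n. (N * N) powr p * (\<Sum>a\<le>n. \<Sum>b\<le>n. \<bar>g (q a) - g (q 0)\<bar> powr p
      * \<bar>F a b (word_map q w (q d)) - F a b (word_map q w (q e))\<bar> powr p))"
    unfolding En_def by (intro sum_mono hd)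
  also have "\<dots> = (N * N) powr p * (\<Sum>w\<in>words n m. \<Sum>d\<le>n. \<Sum>e\<le>n. \<Sum>a\<le>n. \<Sum>b\<le>n. \<bar>g (q a) - g (q 0)\<bar> powr p
      * \<bar>F a b (word_map q w (q d)) - F a b (word_map q w (q e))\<bar> powr p)"
    by (simp only: sum_distrib_left)
  also have "(\<Sum>w\<in>words n m. \<Sum>d\<le>n. \<Sum>e\<le>n. \<Sum>a\<le>n. \<Sum>b\<le>n. \<bar>g (q a) - g (q 0)\<bar> powr p
      * \<bar>F a b (word_map q w (q d)) - F a b (word_map q w (q e))\<bar> powr p)
     = (\<Sum>a\<le>n. \<Sum>b\<le>n. \<Sum>w\<in>words n m. \<Sum>d\<le>n. \<Sum>e\<le>n. \<bar>g (q a) - g (q 0)\<bar> powr p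
      * \<bar>F a b (word_map q w (q d)) - F a b (word_map q w (q e))\<bar> powr p)"
    by (subst sum_swap3, intro sum.cong refl, rule sum_swap3)
  also have "\<dots> = (\<Sum>a\<le>n. \<Sum>b\<le>n. \<bar>g (q a) - g (q 0)\<bar> powr p * En m (F a b))"
    by (simp only: En_def sum_distrib_left)
  also have "(N * N) powr p * \<dots> \<le> (N * N) powr p * (\<Sum>a\<le>n. \<Sum>b\<le>n. \<bar>g (q a) - g (q 0)\<bar> powr p * (4 * c m))"
    by (intro mult_left_mono sum_mono FE) auto
  also have "\<dots> = ext_const * c m * (\<Sum>a\<le>n. \<bar>g (q a) - g (q 0)\<bar> powr p)"
    by (simp only: sum_const_N ext_const_def) (simp add: sum_distrib_left mult_ac)
  also have "\<dots> \<le> ext_const * c m * En 0 g"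
  proof (rule mult_left_mono)
    show "(\<Sum>a\<le>n. \<bar>g (q a) - g (q 0)\<bar> powr p) \<le> En 0 g"
      unfolding En_0
      by (intro sum_mono member_le_sum[of 0 "{..n}" "\<lambda>b. \<bar>g (q _) - g (q b)\<bar> powr p"]) auto
  qed (use ext_const_pos conductance_pos[of m] in auto)
  finally have Eh: "En m h \<le> ext_const * c m * En 0 g" .
  show thesis
  proof (rule that[OF _ _ Eh])
    show "h (q a) = g (q a)" if "a \<le> n" for a using h0q[OF that] lohi[OF that] by (simp add: h_def)
    fix x lo' hi' assume B: "\<And>a. a \<le> n \<Longrightarrow> lo' \<le> g (q a) \<and> g (q a) \<le> hi'"
    have "lo' \<le> lo" "hi \<le> hi'" using B unfolding lo_def hi_def by auto
    moreover have "lo \<le> hi" using lohi[of 0] by simp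
    ultimately show "lo' \<le> h x \<and> h x \<le> hi'" by (auto simp: h_def)
  qed
qed

text \<open>Distinct cells of one level meet only in common vertices, where all the
  \<open>h \<iota>\<close> take the values of \<open>f\<close>; so the choice of a cell and a
  preimage does not affect the value.\<close>

lemma glue:
  fixes h :: "bool \<times> nat list \<Rightarrow> real^'n \<Rightarrow> real"
  assumes h: "\<And>\<iota> a. \<iota> \<in> cells l \<Longrightarrow> a \<le> n \<Longrightarrow> h \<iota> (q a) = f (cmap \<iota> (q a))"
  obtains g where "\<And>\<iota> x. \<iota> \<in> cells l \<Longrightarrow> x \<in> K \<Longrightarrow> g (cmap \<iota> x) = h \<iota> x"
proof -
  define P where "P z i \<longleftrightarrow> fst i \<in> cells l \<and> snd i \<in> K \<and> z = cmap (fst i) (snd i)" for z i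
  define g where "g z = (let i = (SOME i. P z i) in h (fst i) (snd i))" for z
  show thesis
  proof (rule that[of g])
    fix \<iota> x assume \<iota>: "\<iota> \<in> cells l" and x: "x \<in> K"
    have "P (cmap \<iota> x) (\<iota>, x)" using \<iota> x by (simp add: P_def)
    then have "P (cmap \<iota> x) (SOME i. P (cmap \<iota> x) i)" by (rule someI)
    then obtain \<kappa> y where e: "(SOME i. P (cmap \<iota> x) i) = (\<kappa>, y)" and
      \<kappa>: "\<kappa> \<in> cells l" "y \<in> K" "cmap \<iota> x = cmap \<kappa> y"
      by (cases "SOME i. P (cmap \<iota> x) i") (auto simp: P_def)
    have "h \<iota> x = h \<kappa> y"
    proof (cases "\<iota> = \<kappa>")
      case False
      have "cmap \<iota> x \<in> cset \<iota>" using x by (auto simp: cset_def)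
      moreover have "cmap \<iota> x \<in> cset \<kappa>" using \<kappa> by (auto simp: cset_def)
      ultimately
      obtain a b where ab: "a \<le> n" "b \<le> n" "cmap \<iota> x = cmap \<iota> (q a)" "cmap \<iota> x = cmap \<kappa> (q b)"
        using cells_separation \<iota> \<kappa>(1) False by metis
      then have "x = q a" "cmap \<kappa> y = cmap \<kappa> (q b)" using \<kappa>(3) by auto
      then have "x = q a" "y = q b" by simp_all
      then show ?thesis using h[OF \<iota> ab(1)] h[OF \<kappa>(1) ab(2)] ab \<kappa>(3) by simp
    qed (use \<kappa> in simp)
    then show "g (cmap \<iota> x) = h \<iota> x" by (simp add: g_def e)
  qed
qed

lemma word_map_replicate: "word_map q (replicate l a) (q a) = q a"
  by (induction l) (auto simp: gasket_map_q)

lemma cmap_append_fst: "cmap (fst \<iota>, snd \<iota> @ w) x = cmap \<iota> (word_map q w x)"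
  by (simp add: cmap_def word_map_append)

lemma cells_False: "w \<in> words n l \<Longrightarrow> (False, w) \<in> cells l"
  by (simp add: cells_def)

text \<open>\<open>extension\<close> applied in every cell of level \<open>l\<close>, then glued.
  The range statement is the maximum principle cell by cell.\<close>

lemma refine:
  obtains g where
    "\<And>\<iota> a. \<iota> \<in> cells l \<Longrightarrow> a \<le> n \<Longrightarrow> g (cmap \<iota> (q a)) = f (cmap \<iota> (q a))"
    "\<And>\<iota> x lo hi. \<iota> \<in> cells l \<Longrightarrow> x \<in> K \<Longrightarrow> (\<And>a. a \<le> n \<Longrightarrow> lo \<le> f (cmap \<iota> (q a)) \<and> f (cmap \<iota> (q a)) \<le> hi) \<Longrightarrow>
       lo \<le> g (cmap \<iota> x) \<and> g (cmap \<iota> x) \<le> hi"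
    "\<And>\<iota>. \<iota> \<in> cells l \<Longrightarrow> En m (\<lambda>x. g (cmap \<iota> x)) \<le> ext_const * c m * En 0 (\<lambda>x. f (cmap \<iota> x))"
proof -
  have "\<exists>h. (\<forall>a\<le>n. h (q a) = f (cmap \<iota> (q a))) \<and>
      (\<forall>x lo hi. (\<forall>a\<le>n. lo \<le> f (cmap \<iota> (q a)) \<and> f (cmap \<iota> (q a)) \<le> hi) \<longrightarrow> lo \<le> h x \<and> h x \<le> hi) \<and>
      En m h \<le> ext_const * c m * En 0 (\<lambda>x. f (cmap \<iota> x))" for \<iota>
    by (rule extension[of "\<lambda>x. f (cmap \<iota> x)" m]) blast
  then obtain h where h: "\<And>\<iota>. \<forall>a\<le>n. h \<iota> (q a) = f (cmap \<iota> (q a))"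
    "\<And>\<iota>. \<forall>x lo hi. (\<forall>a\<le>n. lo \<le> f (cmap \<iota> (q a)) \<and> f (cmap \<iota> (q a)) \<le> hi) \<longrightarrow> lo \<le> h \<iota> x \<and> h \<iota> x \<le> hi"
    "\<And>\<iota>. En m (h \<iota>) \<le> ext_const * c m * En 0 (\<lambda>x. f (cmap \<iota> x))"
    by metis
  obtain g where g: "\<And>\<iota> x. \<iota> \<in> cells l \<Longrightarrow> x \<in> K \<Longrightarrow> g (cmap \<iota> x) = h \<iota> x"
    using glue[of l h f] h(1) by metis
  show thesis
  proof (rule that[of g])
    show "g (cmap \<iota> (q a)) = f (cmap \<iota> (q a))" if "\<iota> \<in> cells l" "a \<le> n" for \<iota> a
      using g[OF that(1) q_in_K[OF that(2)]] h(1) that(2) by simp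
    show "En m (\<lambda>x. g (cmap \<iota> x)) \<le> ext_const * c m * En 0 (\<lambda>x. f (cmap \<iota> x))" if "\<iota> \<in> cells l" for \<iota>
      using En_cong[of "\<lambda>x. g (cmap \<iota> x)" "h \<iota>" m] g[OF that] h(3)[of \<iota>] by simp
    show "lo \<le> g (cmap \<iota> x) \<and> g (cmap \<iota> x) \<le> hi"
      if "\<iota> \<in> cells l" "x \<in> K" "\<And>a. a \<le> n \<Longrightarrow> lo \<le> f (cmap \<iota> (q a)) \<and> f (cmap \<iota> (q a)) \<le> hi" for \<iota> x lo hi
      using h(2)[rule_format, of lo \<iota> hi x] g[OF that(1,2)] that(3) by simp
  qed
qed

text \<open>A near-minimiser of level \<open>l\<close>, refined by \<open>m\<close> levels in each
  of its cells, is a competitor at level \<open>l + m\<close>.\<close>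

lemma conductance_submult: "c (l + m) \<le> ext_const * c m * c l"
proof -
  have "c (l + m) / (ext_const * c m) \<le> t" if t: "c l < t" for t
  proof -
    obtain f where f: "f (q 0) = 0" "f (q 1) = 1" "En l f / 2 < t" using conductance_approx[OF t] .
    obtain g where g: "\<And>\<iota> a. \<iota> \<in> cells l \<Longrightarrow> a \<le> n \<Longrightarrow> g (cmap \<iota> (q a)) = f (cmap \<iota> (q a))"
      "\<And>\<iota>. \<iota> \<in> cells l \<Longrightarrow> En m (\<lambda>x. g (cmap \<iota> x)) \<le> ext_const * c m * En 0 (\<lambda>x. f (cmap \<iota> x))"
      by (rule refine[of l f m]) blast
    \<comment> \<open>The corner \<open>q a\<close> is a vertex of the cell with word
      \<open>a, ..., a\<close>, so the refinement keeps its value.\<close>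
    have gq: "g (q a) = f (q a)" if "a \<le> n" for a
    proof -
      have "(False, replicate l a) \<in> cells l" using that by (intro cells_False) (auto simp: words_def)
      from g(1)[OF this that] show ?thesis by (simp add: cmap_def word_map_replicate)
    qed
    have "c (l + m) \<le> En (l + m) g / 2"
      using gq[of 0] gq[of 1] f one_le_n by (intro conductance_le) (auto simp del: q_0)
    also have "En (l + m) g \<le> (\<Sum>u\<in>words n l. ext_const * c m * En 0 (\<lambda>x. f (word_map q u x)))"
      unfolding En_add using g(2)[OF cells_False] by (intro sum_mono) (simp add: cmap_def)
    also have "\<dots> = ext_const * c m * En l f"
      using En_add[of l 0 f] by (simp add: sum_distrib_left)
    finally have "c (l + m) \<le> ext_const * c m * (En l f / 2)" by simp
    also have "\<dots> \<le> ext_const * c m * t" using f(3) ext_const_pos conductance_pos[of m] by (intro mult_left_mono) auto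
    finally show ?thesis using ext_const_pos conductance_pos[of m] by (simp add: field_simps)
  qed
  then have "c (l + m) / (ext_const * c m) \<le> c l" by (rule dense_ge)
  then show ?thesis using ext_const_pos conductance_pos[of m] by (simp add: field_simps)
qed

subsection \<open>The scaling factor\<close>

text \<open>Multiplying \<open>c\<close> by \<open>ext_const\<close> makes it submultiplicative
  without a constant; in the limit of the roots this factor disappears.\<close>

lemma scaling_limit:
  obtains L where "scaling_factor q p = exp (- L)" "(\<lambda>m. ln (ext_const * c m) / real m) \<longlonglongrightarrow> L"
    "\<And>m. 0 < m \<Longrightarrow> L \<le> ln (ext_const * c m) / real m"
proof -
  have Ac: "0 < ext_const * c m" for m using ext_const_pos conductance_pos by simp
  define C where "C = \<bar>ln (ext_const / 2)\<bar> + p * ln 2"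
  have sub: "ln (ext_const * c (l + m)) \<le> ln (ext_const * c l) + ln (ext_const * c m)" for l m
  proof -
    have "ext_const * c (l + m) \<le> (ext_const * c l) * (ext_const * c m)"
      using mult_left_mono[OF conductance_submult[of l m], of ext_const] ext_const_pos by (simp add: mult_ac)
    then have "ln (ext_const * c (l + m)) \<le> ln ((ext_const * c l) * (ext_const * c m))" using Ac by (simp only: ln_le_cancel_iff mult_pos_pos)
    then show ?thesis using Ac by (simp only: ln_mult_pos)
  qed
  have lower: "- C * real m \<le> ln (ext_const * c m)" if "0 < m" for m
  proof -
    have "ln (ext_const / 2 * ((1/2) powr p) ^ m) \<le> ln (ext_const * c m)"
      using mult_left_mono[OF conductance_lower[of m], of ext_const] ext_const_pos Ac by (intro ln_mono) auto
    moreover have "ln (ext_const / 2 * ((1/2) powr p) ^ m) = ln (ext_const / 2) - real m * (p * ln 2)"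
      using ext_const_pos by (simp add: ln_mult_pos ln_realpow ln_powr ln_div)
    moreover have "- \<bar>ln (ext_const / 2)\<bar> * real m \<le> ln (ext_const / 2)"
    proof -
      have "\<bar>ln (ext_const / 2)\<bar> * 1 \<le> \<bar>ln (ext_const / 2)\<bar> * real m" using that by (intro mult_left_mono) auto
      then show ?thesis by linarith
    qed
    ultimately show ?thesis by (simp add: C_def algebra_simps)
  qed
  obtain L where L: "(\<lambda>m. ln (ext_const * c m) / real m) \<longlonglongrightarrow> L" "\<And>m. 0 < m \<Longrightarrow> L \<le> ln (ext_const * c m) / real m"
    using subadditive_limit[of "\<lambda>m. ln (ext_const * c m)" C, OF sub lower] by metis
  have "(\<lambda>m. c m powr (- 1 / real m)) \<longlonglongrightarrow> exp (- L)"
  proof (rule Lim_transform_eventually)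
    have "(\<lambda>m. ln ext_const / real m) \<longlonglongrightarrow> 0" by (rule lim_const_over_n)
    then have "(\<lambda>m. ln ext_const / real m - ln (ext_const * c m) / real m) \<longlonglongrightarrow> 0 - L" by (intro tendsto_diff L(1))
    then show "(\<lambda>m. exp (ln ext_const / real m - ln (ext_const * c m) / real m)) \<longlonglongrightarrow> exp (- L)"
      by (intro tendsto_exp) simp
    \<comment> \<open>The equality also holds for \<open>m = 0\<close>, where division by zero makes
      both sides 1.\<close>
    show "eventually (\<lambda>m. exp (ln ext_const / real m - ln (ext_const * c m) / real m) = c m powr (- 1 / real m)) sequentially"
      using conductance_pos ext_const_pos
      by (intro always_eventually) (auto simp: powr_def ln_mult_pos add_divide_distrib less_imp_neq[symmetric])
  qed
  then have "scaling_factor q p = exp (- L)" unfolding scaling_factor_def by (rule limI)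
  then show thesis using that L by blast
qed

abbreviation \<rho> where "\<rho> \<equiv> scaling_factor q p"

lemma rho_pos: "0 < \<rho>"
proof -
  obtain L where "\<rho> = exp (- L)" using scaling_limit by metis
  then show ?thesis by simp
qed

lemma rho_lower: "0 < m \<Longrightarrow> (1 / \<rho>) ^ m \<le> ext_const * c m"
proof -
  assume m: "0 < m"
  have Ac: "0 < ext_const * c m" using ext_const_pos conductance_pos by simp
  obtain L where L: "\<rho> = exp (- L)" "\<And>m. 0 < m \<Longrightarrow> L \<le> ln (ext_const * c m) / real m" using scaling_limit by metis
  have "(1 / \<rho>) ^ m = exp (real m * L)" by (simp add: L(1) exp_minus field_simps flip: exp_of_nat_mult)
  also have "\<dots> \<le> exp (ln (ext_const * c m))" using L(2)[OF m] m by (simp add: field_simps)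
  finally show ?thesis using Ac by simp
qed

text \<open>Supplies the block length for the refinement: one level at which the exponential rate
  has beaten \<open>ext_const\<close>.\<close>

lemma rho_approx:
  assumes "1 / \<rho> < l"
  obtains m where "0 < m" "ext_const * c m < l ^ m"
proof -
  obtain L where L: "\<rho> = exp (- L)" "(\<lambda>m. ln (ext_const * c m) / real m) \<longlonglongrightarrow> L" using scaling_limit by metis
  have l: "0 < l" using assms rho_pos by (meson divide_pos_pos less_trans zero_less_one)
  have "exp L < l" using assms by (simp add: L(1) exp_minus field_simps)
  then have "L < ln l" using l by (metis exp_less_cancel_iff exp_ln)
  then have "eventually (\<lambda>m. ln (ext_const * c m) / real m < ln l \<and> 0 < m) sequentially"
    using order_tendstoD(2)[OF L(2)] eventually_gt_at_top[of 0] by (auto intro: eventually_conj)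
  then obtain m where m: "ln (ext_const * c m) / real m < ln l" "0 < m" by (auto simp: eventually_sequentially)
  have Ac: "0 < ext_const * c m" using ext_const_pos conductance_pos by simp
  have "ln (ext_const * c m) < real m * ln l" using m by (simp add: field_simps)
  also have "\<dots> = ln (l ^ m)" using l by (simp add: ln_realpow)
  finally have "ext_const * c m < l ^ m" using Ac l by (simp only: ln_less_cancel_iff zero_less_power)
  then show thesis using that m(2) by blast
qed

text \<open>
  \<open>\<rho> > 1\<close>: the staircase that jumps by the same amount at each of \<open>m\<close> cells of decreasing size around \<open>q 0\<close>
  has energy of order \<open>m \<sqdot> m powr (- p)\<close>.
\<close>

definition stair :: "nat \<Rightarrow> real^'n \<Rightarrow> real" where
  "stair m x = (\<Sum>j<m. if bary 0 x < 1 - (1/2) ^ Suc j then 1 else 0)"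

text \<open>Only the cell at \<open>q 0\<close> has vertices with different values, at every level,
  so the energy does not grow with \<open>m\<close>.\<close>

lemma En_vertex_indicator: "En m (\<lambda>x. d + (if bary 0 x < 1 then 1 else 0)) \<le> 2 * N\<^sup>2"
proof (induction m)
  case 0
  have "En 0 (\<lambda>x. d + (if bary 0 x < 1 then 1 else 0)) \<le> (\<Sum>a\<le>n. \<Sum>b\<le>n. 1)"
    unfolding En_0 by (intro sum_mono) auto
  also have "\<dots> = N\<^sup>2" by (simp add: N_def power2_eq_square algebra_simps)
  finally show ?case by (simp add: order_trans[of _ "N\<^sup>2"])
next
  case (Suc m)
  let ?f = "\<lambda>x. d + (if bary 0 x < 1 then 1 else 0 :: real)"
  have "En m (\<lambda>x. ?f (gasket_map q i x)) = (if i = 0 then En m ?f else 0)" if i: "i \<le> n" for i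
  proof (cases "i = 0")
    case True
    have "En m (\<lambda>x. ?f (gasket_map q i x)) = En m ?f"
      using True by (intro En_cong) (auto simp: bary_gasket_map bary_q simp del: q_0)
    then show ?thesis using True by simp
  next
    case False
    have "En m (\<lambda>x. ?f (gasket_map q i x)) = En m (\<lambda>x. d + 1)"
      using False i bary_le_1[of _ 0] by (intro En_cong) (force simp: bary_gasket_map bary_q simp del: q_0)
    also have "\<dots> = 0" by (simp add: En_def)
    finally show ?thesis using False by simp
  qed
  then have "En (Suc m) ?f = (\<Sum>i\<le>n. if i = 0 then En m ?f else 0)"
    unfolding En_Suc by (intro sum.cong) auto
  then show ?case using Suc by simp
qed

text \<open>On the subcell at \<open>q 0\<close> the staircase restricts to the staircase with one
  step fewer; on any other subcell all steps but one are taken, and the last is a vertex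
  indicator.\<close>

lemma En_stair: "En m (stair m) \<le> real m * (2 * N ^ 3)"
proof (induction m)
  case 0
  show ?case by (simp add: En_def stair_def)
next
  case (Suc m)
  have 0: "En m (\<lambda>x. stair (Suc m) (gasket_map q 0 x)) = En m (stair m)"
  proof (rule En_cong)
    fix x assume x: "x \<in> K"
    have "(bary 0 (gasket_map q 0 x) < 1 - (1/2) ^ Suc (Suc j)) = (bary 0 x < 1 - (1/2) ^ Suc j)" for j
      using bary_q[of 0 0] by (auto simp: bary_gasket_map simp del: q_0)
    moreover have "\<not> bary 0 (gasket_map q 0 x) < 1 - (1/2) ^ Suc 0"
      using bary_nonneg[OF x, of 0] bary_q[of 0 0] by (auto simp: bary_gasket_map simp del: q_0)
    ultimately show "stair (Suc m) (gasket_map q 0 x) = stair m x"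
      unfolding stair_def sum.lessThan_Suc_shift by (simp del: power_Suc)
  qed
  have i: "En m (\<lambda>x. stair (Suc m) (gasket_map q i x)) \<le> 2 * N\<^sup>2" if i: "i \<le> n" "i \<noteq> 0" for i
  proof -
    have "En m (\<lambda>x. stair (Suc m) (gasket_map q i x)) = En m (\<lambda>x. real m + (if bary 0 x < 1 then 1 else 0))"
    proof (rule En_cong)
      fix x assume x: "x \<in> K"
      have b: "bary 0 (gasket_map q i x) = bary 0 x / 2" using i by (simp add: bary_gasket_map bary_q)
      have "(bary 0 (gasket_map q i x) < 1 - (1/2) ^ Suc 0) = (bary 0 x < 1)" by (simp add: b)
      moreover have "bary 0 (gasket_map q i x) < 1 - (1/2) ^ Suc (Suc j)" for j
      proof -
        have "(1/2::real) ^ Suc (Suc j) \<le> (1/2) ^ Suc (Suc 0)" by (intro power_decreasing) auto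
        then show ?thesis using bary_le_1[OF x, of 0] by (simp add: b)
      qed
      ultimately show "stair (Suc m) (gasket_map q i x) = real m + (if bary 0 x < 1 then 1 else 0)"
        unfolding stair_def sum.lessThan_Suc_shift by (simp del: power_Suc)
    qed
    then show ?thesis using En_vertex_indicator by simp
  qed
  have "En (Suc m) (stair (Suc m)) = (\<Sum>i\<le>n. En m (\<lambda>x. stair (Suc m) (gasket_map q i x)))" by (rule En_Suc)
  also have "\<dots> \<le> (\<Sum>i\<le>n. (if i = 0 then En m (stair m) else 0) + 2 * N\<^sup>2)"
    using 0 i by (intro sum_mono) auto
  also have "\<dots> = En m (stair m) + 2 * N ^ 3"
    by (simp add: sum.distrib sum_const_N power3_eq_cube power2_eq_square mult_ac del: sum_constant)
  finally show ?case using Suc by (simp add: algebra_simps)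
qed

lemma conductance_upper: "0 < m \<Longrightarrow> c m \<le> N ^ 3 * real m powr (1 - p)"
proof -
  assume m: "0 < m"
  have "stair m (q 0) = 0" using bary_q[of 0 0] by (simp add: stair_def del: q_0)
  moreover have "stair m (q 1) = real m"
  proof -
    have "bary 0 (q 1) = 0" using bary_q[of 1 0] one_le_n by simp
    moreover have "(1/2::real) ^ Suc j < 1" for j by (rule power_Suc_less_one) auto
    ultimately show ?thesis unfolding stair_def by (simp del: power_Suc)
  qed
  ultimately have "c m \<le> En m (\<lambda>x. (1 / real m) * stair m x + 0) / 2"
    using m by (intro conductance_le) (auto simp del: q_0)
  also have "En m (\<lambda>x. (1 / real m) * stair m x + 0) = (1 / real m) powr p * En m (stair m)"
    by (simp only: En_affine) simp
  also have "\<dots> \<le> (1 / real m) powr p * (real m * (2 * N ^ 3))"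
    by (intro mult_left_mono En_stair) auto
  also have "(1 / real m) powr p = real m powr (1 - p) / real m"
    using m by (simp add: powr_diff powr_divide)
  finally show ?thesis using m by (simp add: field_simps)
qed

lemma rho_gt_1: "1 < \<rho>"
proof -
  have "(\<lambda>m. ext_const * (N ^ 3 * real m powr (1 - p))) \<longlonglongrightarrow> ext_const * (N ^ 3 * 0)"
    using p by (intro tendsto_mult tendsto_const tendsto_neg_powr filterlim_real_sequentially) auto
  then have "(\<lambda>m. ext_const * (N ^ 3 * real m powr (1 - p))) \<longlonglongrightarrow> 0" by simp
  then have "eventually (\<lambda>m. ext_const * (N ^ 3 * real m powr (1 - p)) < 1 \<and> 0 < m) sequentially"
    by (intro eventually_conj eventually_gt_at_top order_tendstoD(2)) auto
  then obtain m where m: "ext_const * (N ^ 3 * real m powr (1 - p)) < 1" "0 < m" by (auto simp: eventually_sequentially)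
  have "(1 / \<rho>) ^ m \<le> ext_const * c m" by (rule rho_lower[OF m(2)])
  also have "\<dots> \<le> ext_const * (N ^ 3 * real m powr (1 - p))" using ext_const_pos m by (intro mult_left_mono conductance_upper) auto
  also have "\<dots> < 1" by (rule m)
  finally have "1 / \<rho> < 1" using rho_pos by (metis one_le_power not_less)
  then show ?thesis using rho_pos by (simp add: field_simps)
qed

end

section \<open>Besov functions above the critical exponent\<close>

text \<open>For \<open>D = 0\<close> and \<open>t \<noteq> 0\<close> the quotient is
  \<open>top\<close>, and positivity of \<open>E\<close> prevents the product from being 0.\<close>

lemma ennreal_le_mult_divide:
  fixes t D E :: ennreal
  assumes "D \<le> E" "0 < E" "E < top"
  shows "t \<le> E * (t / D)"
proof (cases "t = 0")
  case False
  show ?thesis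
  proof (cases "D = 0")
    case True
    then have "t / D = top" using False by (simp add: divide_ennreal_def ennreal_mult_top)
    then show ?thesis using assms by (simp add: ennreal_mult_top)
  next
    case D: False
    have "D < top" using assms by auto
    then have "t = D * (t / D)" using D by (metis ennreal_mult_divide_eq ennreal_times_divide mult.commute less_irrefl)
    also have "\<dots> \<le> E * (t / D)" using assms by (intro mult_right_mono) auto
    finally show ?thesis .
  qed
qed simp

text \<open>Jensen's inequality up to a constant, from the pointwise bound \<open>t \<le> s/2 + t\<^sup>p (s/2)\<^bsup>1-p\<^esup>\<close>.\<close>

lemma mean_powr_le:
  fixes v :: "'a \<Rightarrow> real"
  assumes fin: "finite_measure M" and A: "A \<in> sets M" "0 < measure M A"
    and v: "integrable M v" "integrable M (\<lambda>x. \<bar>v x\<bar> powr p)" and p: "1 < p"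
  shows "\<bar>(\<integral>x\<in>A. v x \<partial>M) / measure M A\<bar> powr p * measure M A \<le> 2 powr p * (\<integral>x\<in>A. \<bar>v x\<bar> powr p \<partial>M)"
proof -
  interpret finite_measure M by (rule fin)
  define s where "s = \<bar>(\<integral>x\<in>A. v x \<partial>M) / measure M A\<bar>"
  have int: "set_integrable M A v" "set_integrable M A (\<lambda>x. \<bar>v x\<bar>)" "set_integrable M A (\<lambda>x. \<bar>v x\<bar> powr p)"
    "set_integrable M A (\<lambda>x. s / 2 :: real)"
    using A v unfolding set_integrable_def by (auto intro!: integrable_mult_indicator simp del: real_scaleR_def)
  show ?thesis
  proof (cases "s = 0")
    case True
    have "0 \<le> (\<integral>x\<in>A. \<bar>v x\<bar> powr p \<partial>M)"
      unfolding set_lebesgue_integral_def by (intro Bochner_Integration.integral_nonneg) auto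
    then show ?thesis unfolding s_def[symmetric] using True by simp
  next
    case False
    moreover have "0 \<le> s" by (simp add: s_def)
    ultimately have s: "0 < s" by simp
    define r where "r = (s / 2) powr (1 - p)"
    have pt: "\<bar>v x\<bar> \<le> s / 2 + r * \<bar>v x\<bar> powr p" for x
    proof (cases "\<bar>v x\<bar> \<le> s / 2")
      case True
      moreover have "0 \<le> r * \<bar>v x\<bar> powr p" by (simp add: r_def)
      ultimately show ?thesis by linarith
    next
      case False
      have "\<bar>v x\<bar> = \<bar>v x\<bar> powr (1 - p) * \<bar>v x\<bar> powr p" using False s by (simp flip: powr_add)
      also have "\<dots> \<le> r * \<bar>v x\<bar> powr p"
        unfolding r_def using False s p by (intro mult_right_mono powr_mono2') auto
      finally show ?thesis using s by simp
    qed
    have "s * measure M A = \<bar>\<integral>x\<in>A. v x \<partial>M\<bar>" using A(2) by (simp add: s_def)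
    also have "\<dots> \<le> (\<integral>x\<in>A. \<bar>v x\<bar> \<partial>M)"
      using set_integral_norm_bound[OF int(1)] by simp
    also have "\<dots> \<le> (\<integral>x\<in>A. s / 2 + r * \<bar>v x\<bar> powr p \<partial>M)"
      by (intro set_integral_mono int set_integral_add set_integrable_mult_right pt)
    also have "\<dots> = s / 2 * measure M A + r * (\<integral>x\<in>A. \<bar>v x\<bar> powr p \<partial>M)"
      using A int by (subst set_integral_add) (auto simp: set_integral_const)
    finally have "s / 2 * measure M A \<le> r * (\<integral>x\<in>A. \<bar>v x\<bar> powr p \<partial>M)" by simp
    then have "(s / 2) powr (p - 1) * (s / 2 * measure M A) \<le> (s / 2) powr (p - 1) * (r * (\<integral>x\<in>A. \<bar>v x\<bar> powr p \<partial>M))"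
      by (rule mult_left_mono) simp
    also have "(s / 2) powr (p - 1) * (s / 2 * measure M A) = (s / 2) powr p * measure M A"
      using s by (simp add: powr_diff)
    also have "(s / 2) powr (p - 1) * (r * (\<integral>x\<in>A. \<bar>v x\<bar> powr p \<partial>M)) = (\<integral>x\<in>A. \<bar>v x\<bar> powr p \<partial>M)"
      using s by (simp add: r_def mult.assoc[symmetric] flip: powr_add)
    finally have "2 powr p * ((s / 2) powr p * measure M A) \<le> 2 powr p * (\<integral>x\<in>A. \<bar>v x\<bar> powr p \<partial>M)"
      by (rule mult_left_mono) simp
    then show ?thesis unfolding s_def[symmetric] using s by (simp add: powr_divide)
  qed
qed

context gasket_setup
begin

lemma ident_measurable_M [measurable]: "(\<lambda>x. x) \<in> measurable M borel"
proof -
  have "(\<lambda>x. x) \<in> measurable (restrict_space borel X) borel"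
    by (intro measurable_restrict_space1) simp
  then show ?thesis by (subst measurable_cong_sets[OF sets_M refl])
qed

lemma fst_measurable_MM [measurable]: "fst \<in> measurable (M \<Otimes>\<^sub>M M) borel"
  and snd_measurable_MM [measurable]: "snd \<in> measurable (M \<Otimes>\<^sub>M M) borel"
  using measurable_compose[OF measurable_fst ident_measurable_M]
    measurable_compose[OF measurable_snd ident_measurable_M] by auto

lemma nn_integral2_cmult:
  assumes "case_prod F \<in> borel_measurable (M \<Otimes>\<^sub>M M)"
  shows "(\<integral>\<^sup>+x. \<integral>\<^sup>+y. r * F x y \<partial>M \<partial>M) = r * (\<integral>\<^sup>+x. \<integral>\<^sup>+y. F x y \<partial>M \<partial>M)"
proof -
  have "(\<integral>\<^sup>+x. \<integral>\<^sup>+y. r * F x y \<partial>M \<partial>M) = (\<integral>\<^sup>+x. r * (\<integral>\<^sup>+y. F x y \<partial>M) \<partial>M)"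
    using measurable_Pair2[OF assms] by (intro nn_integral_cong nn_integral_cmult) simp
  also have "\<dots> = r * (\<integral>\<^sup>+x. \<integral>\<^sup>+y. F x y \<partial>M \<partial>M)"
    by (intro nn_integral_cmult M.borel_measurable_nn_integral assms)
  finally show ?thesis .
qed

lemma adj_if_common_point: "\<iota> \<in> cells m \<Longrightarrow> \<kappa> \<in> cells m \<Longrightarrow> x \<in> cset \<iota> \<Longrightarrow> x \<in> cset \<kappa> \<Longrightarrow> adj \<iota> \<kappa>"
  by (rule cells_separation) (metis adj_def adj_refl)

lemma measure_cset: "\<iota> \<in> cells m \<Longrightarrow> measure M (cset \<iota>) = muK * (1 / N) ^ m"
  using muK_pos N_pos by (simp add: measure_def emeasure_cset)

end

context gasket_energy
begin

section \<open>The \<open>L\<^sup>p\<close> space of the double gasket\<close>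

lemma continuous_measurable_M:
  assumes "continuous_on X (f :: real^'n \<Rightarrow> real)"
  shows "f \<in> borel_measurable M"
  using borel_measurable_continuous_on_restrict[OF assms]
  by (subst measurable_cong_sets[OF sets_M refl])

lemma continuous_bounded_X:
  assumes "continuous_on X (f :: real^'n \<Rightarrow> real)"
  shows "\<exists>B>0. \<forall>x\<in>X. \<bar>f x\<bar> \<le> B"
proof -
  have "bounded (f ` X)" using compact_continuous_image[OF assms compact_X] by (rule compact_imp_bounded)
  then show ?thesis unfolding bounded_pos by (auto simp: real_norm_def)
qed

lemma Lp_diff_integrable:
  assumes "u \<in> Lp_fun p M" "v \<in> Lp_fun p M"
  shows "integrable M (\<lambda>x. \<bar>u x - v x\<bar> powr p)"
proof (rule Bochner_Integration.integrable_bound)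
  have [measurable]: "u \<in> borel_measurable M" "v \<in> borel_measurable M" using assms by (auto simp: Lp_fun_def)
  show "(\<lambda>x. \<bar>u x - v x\<bar> powr p) \<in> borel_measurable M" by measurable
  show "integrable M (\<lambda>x. 2 powr p * (\<bar>u x\<bar> powr p + \<bar>v x\<bar> powr p))"
    using assms by (auto simp: Lp_fun_def)
  show "AE x in M. norm (\<bar>u x - v x\<bar> powr p) \<le> norm (2 powr p * (\<bar>u x\<bar> powr p + \<bar>v x\<bar> powr p))"
  proof (intro AE_I2)
    fix x
    show "norm (\<bar>u x - v x\<bar> powr p) \<le> norm (2 powr p * (\<bar>u x\<bar> powr p + \<bar>v x\<bar> powr p))"
      using powr_abs_diff_le[of p "u x" "v x" 0] p by simp
  qed
qed

lemma Lp_triangle: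
  assumes "u \<in> Lp_fun p M" "v \<in> Lp_fun p M" "w \<in> Lp_fun p M"
  shows "(\<integral>x. \<bar>u x - w x\<bar> powr p \<partial>M) \<le> 2 powr p * ((\<integral>x. \<bar>u x - v x\<bar> powr p \<partial>M) + (\<integral>x. \<bar>v x - w x\<bar> powr p \<partial>M))"
proof -
  have "(\<integral>x. \<bar>u x - w x\<bar> powr p \<partial>M) \<le> (\<integral>x. 2 powr p * (\<bar>u x - v x\<bar> powr p + \<bar>v x - w x\<bar> powr p) \<partial>M)"
  proof (rule integral_mono)
    show "\<bar>u x - w x\<bar> powr p \<le> 2 powr p * (\<bar>u x - v x\<bar> powr p + \<bar>v x - w x\<bar> powr p)" for x
      using p by (intro powr_abs_diff_le) auto
  qed (use assms Lp_diff_integrable in auto)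
  then show ?thesis using assms Lp_diff_integrable by simp
qed

lemma continuous_Lp:
  assumes "continuous_on X v"
  shows "v \<in> Lp_fun p M"
proof -
  obtain B where B: "0 < B" "\<forall>x\<in>X. \<bar>v x\<bar> \<le> B" using continuous_bounded_X[OF assms] by blast
  have [measurable]: "v \<in> borel_measurable M" by (rule continuous_measurable_M[OF assms])
  have "integrable M (\<lambda>x. \<bar>v x\<bar> powr p)"
  proof (rule M.integrable_const_bound[of _ "B powr p"])
    show "AE x in M. norm (\<bar>v x\<bar> powr p) \<le> B powr p"
      using B p by (intro AE_I2) (auto simp: space_M intro!: powr_mono2)
  qed measurable
  then show ?thesis by (simp add: Lp_fun_def)
qed

lemma indicator_Lp: "B \<in> sets M \<Longrightarrow> indicator B \<in> Lp_fun p M"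
  using p by (auto simp: Lp_fun_def indicator_def if_distrib[of abs] if_distribR intro!: M.integrable_const_bound[of _ 1])

end

section \<open>Cell averages of a Besov function\<close>

locale besov_fun = gasket_energy k q n N p
  for k :: "'n::finite" and q :: "nat \<Rightarrow> real^'n" and n :: nat and N p :: real +
  fixes \<theta> :: real and u :: "real^'n \<Rightarrow> real"
  assumes theta: "0 < \<theta>" and u: "u \<in> besov p \<theta> M"
begin

definition \<alpha> where "\<alpha> = \<theta> * p"

lemma alpha_pos: "0 < \<alpha>"
  using theta p by (simp add: \<alpha>_def)

definition lam where "lam = N * 2 powr (- \<alpha>)"

lemma lam_pos: "0 < lam"
  using N_pos by (simp add: lam_def)

lemma u_measurable [measurable]: "u \<in> borel_measurable M"
  using u by (simp add: besov_def Lp_fun_def)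

lemma u_p_integrable: "integrable M (\<lambda>x. \<bar>u x\<bar> powr p)"
  using u by (simp add: besov_def Lp_fun_def)

lemma diff_p_integrable: "integrable M (\<lambda>x. \<bar>u x - t\<bar> powr p)"
  using Lp_diff_integrable[OF _ continuous_Lp[OF continuous_on_const]] u by (simp add: besov_def)

lemma u_integrable: "integrable M u"
proof (rule Bochner_Integration.integrable_bound)
  show "integrable M (\<lambda>x. 1 + \<bar>u x\<bar> powr p)" using u_p_integrable by auto
  show "AE x in M. norm (u x) \<le> norm (1 + \<bar>u x\<bar> powr p)"
  proof (intro AE_I2)
    fix x
    have "\<bar>u x\<bar> \<le> 1 + \<bar>u x\<bar> powr p"
    proof (cases "\<bar>u x\<bar> \<le> 1")
      case False
      then have "\<bar>u x\<bar> powr 1 \<le> \<bar>u x\<bar> powr p" using p by (intro powr_mono) auto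
      then show ?thesis using False by simp
    qed (simp add: add_increasing2)
    then show "norm (u x) \<le> norm (1 + \<bar>u x\<bar> powr p)" by simp
  qed
qed measurable

text \<open>The numerator of the Besov integrand on pairs as close as points of adjacent cells of
  level \<open>m\<close> (\<open>adj_dist\<close>).\<close>

definition G :: "nat \<Rightarrow> real^'n \<Rightarrow> real^'n \<Rightarrow> ennreal" where
  "G m x y = (if dist x y \<le> 4 * (1/2) ^ m then ennreal (\<bar>u y - u x\<bar> powr p) else 0)"

lemma G_measurable [measurable]: "case_prod (G m) \<in> borel_measurable (M \<Otimes>\<^sub>M M)"
  unfolding G_def by measurable

text \<open>On these pairs both factors of the Besov denominator are bounded above, by the distance
  and by \<open>ball_measure_upper\<close>, so the integrand dominates \<open>G m\<close> divided by
  a constant \<kappa>.\<close>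

lemma G_bound_ex:
  "\<exists>C>0. \<forall>m. (\<integral>\<^sup>+x. \<integral>\<^sup>+y. G m x y \<partial>M \<partial>M) \<le> ennreal (C * ((1 / N) * 2 powr (- \<alpha>)) ^ m)"
proof -
  obtain C where C: "0 < C" "\<forall>m x. \<forall>r::real. x \<in> X \<longrightarrow> r \<le> 4 * (1/2) ^ m \<longrightarrow>
      emeasure M (ball x r \<inter> X) \<le> ennreal (C * (1 / N) ^ m)"
    by (rule ball_measure_upper) blast
  define E where "E = enn2real (besov_energy p \<theta> M u)"
  have E: "besov_energy p \<theta> M u = ennreal E" "0 \<le> E" using u by (auto simp: E_def besov_def)
  define D where "D = 4 powr \<alpha> * C"
  have D: "0 < D" using C(1) by (simp add: D_def)
  have "(\<integral>\<^sup>+x. \<integral>\<^sup>+y. G m x y \<partial>M \<partial>M) \<le> ennreal (D * (E + 1) * ((1 / N) * 2 powr (- \<alpha>)) ^ m)" for m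
  proof -
    define \<kappa> where "\<kappa> = D * ((1 / N) * 2 powr (- \<alpha>)) ^ m"
    have \<kappa>: "0 < \<kappa>" using D N_pos by (simp add: \<kappa>_def)
    define F where "F x y = (if x = y then 0 else ennreal (\<bar>u y - u x\<bar> powr p) /
              (ennreal (dist x y powr (\<theta> * p)) * emeasure M (ball x (dist x y) \<inter> space M)))" for x y
    have pt: "ennreal (1 / \<kappa>) * G m x y \<le> F x y" if "x \<in> space M" for x y
    proof (cases "x \<noteq> y \<and> dist x y \<le> 4 * (1/2) ^ m")
      case True
      have "dist x y powr \<alpha> \<le> (4 * (1/2) ^ m) powr \<alpha>" using True alpha_pos by (intro powr_mono2) auto
      also have "\<dots> = 4 powr \<alpha> * (2 powr (- \<alpha>)) ^ m"
        by (simp add: powr_mult realpow_powr powr_minus powr_divide inverse_eq_divide)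
      finally have "ennreal (dist x y powr \<alpha>) * emeasure M (ball x (dist x y) \<inter> space M)
          \<le> ennreal (4 powr \<alpha> * (2 powr (- \<alpha>)) ^ m) * ennreal (C * (1 / N) ^ m)"
        using C(2) True that unfolding space_M by (intro mult_mono ennreal_leI) auto
      also have "\<dots> = ennreal \<kappa>"
        using C(1) N_pos by (simp add: \<kappa>_def D_def power_mult_distrib power_divide mult_ac flip: ennreal_mult)
      finally have "ennreal (\<bar>u y - u x\<bar> powr p) \<le> ennreal \<kappa> * F x y"
        using True \<kappa> unfolding F_def \<alpha>_def[symmetric] by (auto intro!: ennreal_le_mult_divide)
      then have "ennreal (1 / \<kappa>) * ennreal (\<bar>u y - u x\<bar> powr p) \<le> ennreal (1 / \<kappa>) * (ennreal \<kappa> * F x y)"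
        by (intro mult_left_mono) auto
      also have "\<dots> = F x y"
        using \<kappa> by (simp add: mult.assoc[symmetric] flip: ennreal_mult)
      finally show ?thesis using True by (simp add: G_def)
    next
      case False
      then show ?thesis using p by (auto simp: G_def)
    qed
    have "ennreal (1 / \<kappa>) * (\<integral>\<^sup>+x. \<integral>\<^sup>+y. G m x y \<partial>M \<partial>M) = (\<integral>\<^sup>+x. \<integral>\<^sup>+y. ennreal (1 / \<kappa>) * G m x y \<partial>M \<partial>M)"
      by (rule nn_integral2_cmult[symmetric]) measurable
    also have "\<dots> \<le> (\<integral>\<^sup>+x. \<integral>\<^sup>+y. F x y \<partial>M \<partial>M)" by (intro nn_integral_mono pt)
    also have "\<dots> = ennreal E" using E(1) unfolding besov_energy_def F_def .
    finally have "ennreal \<kappa> * (ennreal (1 / \<kappa>) * (\<integral>\<^sup>+x. \<integral>\<^sup>+y. G m x y \<partial>M \<partial>M)) \<le> ennreal \<kappa> * ennreal E"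
      by (intro mult_left_mono) auto
    then have "(\<integral>\<^sup>+x. \<integral>\<^sup>+y. G m x y \<partial>M \<partial>M) \<le> ennreal (\<kappa> * E)"
      using \<kappa> E(2) by (simp add: mult.assoc[symmetric] flip: ennreal_mult)
    also have "\<dots> \<le> ennreal (D * (E + 1) * ((1 / N) * 2 powr (- \<alpha>)) ^ m)"
    proof (rule ennreal_leI)
      have "\<kappa> * E \<le> \<kappa> * (E + 1)" using \<kappa> by simp
      then show "\<kappa> * E \<le> D * (E + 1) * ((1 / N) * 2 powr (- \<alpha>)) ^ m" by (simp add: \<kappa>_def mult_ac)
    qed
    finally show ?thesis .
  qed
  \<comment> \<open>\<open>E + 1\<close> keeps the constant positive when the energy is
    zero.\<close>
  then show ?thesis using D E(2) by (intro exI[of _ "D * (E + 1)"]) auto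
qed

definition CG where
  "CG = (SOME C. 0 < C \<and> (\<forall>m. (\<integral>\<^sup>+x. \<integral>\<^sup>+y. G m x y \<partial>M \<partial>M) \<le> ennreal (C * ((1 / N) * 2 powr (- \<alpha>)) ^ m)))"

lemma CG_pos: "0 < CG"
  and G_bound: "(\<integral>\<^sup>+x. \<integral>\<^sup>+y. G m x y \<partial>M \<partial>M) \<le> ennreal (CG * ((1 / N) * 2 powr (- \<alpha>)) ^ m)"
  using someI_ex[OF G_bound_ex, folded CG_def] by auto

definition J :: "(real^'n) set \<Rightarrow> (real^'n) set \<Rightarrow> ennreal" where
  "J A B = (\<integral>\<^sup>+x. \<integral>\<^sup>+y. (if x \<in> A \<and> y \<in> B then ennreal (\<bar>u y - u x\<bar> powr p) else 0) \<partial>M \<partial>M)"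

lemma J_le_G:
  assumes "\<And>x y. x \<in> A \<Longrightarrow> y \<in> B \<Longrightarrow> dist x y \<le> 4 * (1/2) ^ m"
  shows "J A B \<le> (\<integral>\<^sup>+x. \<integral>\<^sup>+y. G m x y \<partial>M \<partial>M)"
  unfolding J_def G_def using assms by (intro nn_integral_mono) auto

text \<open>A point lies in at most \<open>2 * N\<^sup>2\<close> cells, so a pair of points is
  counted at most the square of this, and adjacency puts the pair in the support of
  \<open>G m\<close>.\<close>

lemma sum_J_le:
  assumes P: "P \<subseteq> cells m \<times> cells m" and adj: "\<And>\<iota> \<kappa>. (\<iota>, \<kappa>) \<in> P \<Longrightarrow> adj \<iota> \<kappa>"
  shows "(\<Sum>(\<iota>, \<kappa>)\<in>P. J (cset \<iota>) (cset \<kappa>)) \<le> ennreal ((2 * N\<^sup>2)\<^sup>2 * (CG * ((1 / N) * 2 powr (- \<alpha>)) ^ m))"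
proof -
  have finP: "finite P" using P by (rule finite_subset) (simp add: finite_cells)
  have cs: "cset (fst i) \<in> sets M" "cset (snd i) \<in> sets M" if "i \<in> P" for i
    using that P cset_sets by (auto simp: mem_Times_iff)
  define F where "F i x y = (if x \<in> cset (fst i) \<and> y \<in> cset (snd i) then ennreal (\<bar>u y - u x\<bar> powr p) else 0)" for i x y
  have Fm: "case_prod (F i) \<in> borel_measurable (M \<Otimes>\<^sub>M M)" if "i \<in> P" for i
  proof -
    note cs[OF that, measurable]
    show ?thesis unfolding F_def by measurable
  qed
  have Fm1: "F i x \<in> borel_measurable M" if "i \<in> P" "x \<in> space M" for i x
    using measurable_Pair2[OF Fm[OF that(1)] that(2)] by simp
  have "(\<Sum>(\<iota>, \<kappa>)\<in>P. J (cset \<iota>) (cset \<kappa>)) = (\<Sum>i\<in>P. \<integral>\<^sup>+x. \<integral>\<^sup>+y. F i x y \<partial>M \<partial>M)"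
    unfolding J_def F_def by (intro sum.cong) auto
  also have "\<dots> = (\<integral>\<^sup>+x. (\<Sum>i\<in>P. \<integral>\<^sup>+y. F i x y \<partial>M) \<partial>M)"
    by (intro nn_integral_sum[symmetric] M.borel_measurable_nn_integral Fm)
  also have "\<dots> = (\<integral>\<^sup>+x. \<integral>\<^sup>+y. (\<Sum>i\<in>P. F i x y) \<partial>M \<partial>M)"
    by (intro nn_integral_cong nn_integral_sum[symmetric] Fm1)
  also have "\<dots> \<le> (\<integral>\<^sup>+x. \<integral>\<^sup>+y. ennreal ((2 * N\<^sup>2)\<^sup>2) * G m x y \<partial>M \<partial>M)"
  proof (intro nn_integral_mono)
    fix x y
    define P' where "P' = {i\<in>P. x \<in> cset (fst i) \<and> y \<in> cset (snd i)}"
    have "(\<Sum>i\<in>P. F i x y) = (\<Sum>i\<in>P'. ennreal (\<bar>u y - u x\<bar> powr p))"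
      unfolding P'_def F_def using finP by (intro sum.mono_neutral_cong_right) auto
    also have "\<dots> = ennreal (real (card P')) * ennreal (\<bar>u y - u x\<bar> powr p)"
      by (simp add: ennreal_of_nat_eq_real_of_nat)
    also have "\<dots> \<le> ennreal ((2 * N\<^sup>2)\<^sup>2) * G m x y"
    proof (cases "P' = {}")
      case False
      then obtain \<iota> \<kappa> where i: "(\<iota>, \<kappa>) \<in> P" "x \<in> cset \<iota>" "y \<in> cset \<kappa>" by (auto simp: P'_def)
      then have "dist x y \<le> 4 * (1/2) ^ m" using P adj by (intro adj_dist[of \<iota> m \<kappa>]) auto
      then have Geq: "G m x y = ennreal (\<bar>u y - u x\<bar> powr p)" by (simp add: G_def)
      have "card P' \<le> card ({\<iota>\<in>cells m. x \<in> cset \<iota>} \<times> {\<iota>\<in>cells m. y \<in> cset \<iota>})"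
        using P by (intro card_mono) (auto simp: P'_def finite_cells)
      then have "real (card P') \<le> real (card {\<iota>\<in>cells m. x \<in> cset \<iota>}) * real (card {\<iota>\<in>cells m. y \<in> cset \<iota>})"
        by (simp add: card_cartesian_product flip: of_nat_mult)
      also have "\<dots> \<le> (2 * N\<^sup>2) * (2 * N\<^sup>2)" by (intro mult_mono card_cells_containing) auto
      finally show ?thesis unfolding Geq by (intro mult_right_mono ennreal_leI) (auto simp: power2_eq_square)
    qed simp
    finally show "(\<Sum>i\<in>P. F i x y) \<le> ennreal ((2 * N\<^sup>2)\<^sup>2) * G m x y" .
  qed
  also have "\<dots> = ennreal ((2 * N\<^sup>2)\<^sup>2) * (\<integral>\<^sup>+x. \<integral>\<^sup>+y. G m x y \<partial>M \<partial>M)"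
    by (rule nn_integral2_cmult) measurable
  also have "\<dots> \<le> ennreal ((2 * N\<^sup>2)\<^sup>2) * ennreal (CG * ((1 / N) * 2 powr (- \<alpha>)) ^ m)"
    by (intro mult_left_mono G_bound) auto
  also have "\<dots> = ennreal ((2 * N\<^sup>2)\<^sup>2 * (CG * ((1 / N) * 2 powr (- \<alpha>)) ^ m))"
    using CG_pos N_pos by (simp flip: ennreal_mult)
  finally show ?thesis .
qed

definition mean :: "(real^'n) set \<Rightarrow> real" where
  "mean A = (\<integral>x\<in>A. u x \<partial>M) / measure M A"

lemma mean_diff_le:
  assumes A: "A \<in> sets M" "0 < measure M A"
  shows "ennreal (\<bar>mean A - t\<bar> powr p) \<le>
    ennreal (2 powr p / measure M A) * (\<integral>\<^sup>+x. (if x \<in> A then ennreal (\<bar>u x - t\<bar> powr p) else 0) \<partial>M)"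
proof -
  have int: "integrable M (\<lambda>x. u x - t)" using u_integrable by simp
  have iA: "set_integrable M A u" "set_integrable M A (\<lambda>x. t)" "set_integrable M A (\<lambda>x. \<bar>u x - t\<bar> powr p)"
    using A u_integrable diff_p_integrable unfolding set_integrable_def
    by (auto intro!: integrable_mult_indicator simp del: real_scaleR_def)
  have "(\<integral>x\<in>A. u x - t \<partial>M) / measure M A = mean A - t"
    using A iA by (simp add: set_integral_diff(2) set_integral_const mean_def diff_divide_distrib)
  then have "\<bar>mean A - t\<bar> powr p * measure M A \<le> 2 powr p * (\<integral>x\<in>A. \<bar>u x - t\<bar> powr p \<partial>M)"
    using mean_powr_le[OF finite_measure_M A int diff_p_integrable p] by simp
  then have "\<bar>mean A - t\<bar> powr p \<le> 2 powr p / measure M A * (\<integral>x\<in>A. \<bar>u x - t\<bar> powr p \<partial>M)"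
    using A by (simp add: field_simps)
  then have "ennreal (\<bar>mean A - t\<bar> powr p) \<le> ennreal (2 powr p / measure M A) * ennreal (\<integral>x\<in>A. \<bar>u x - t\<bar> powr p \<partial>M)"
    by (simp add: ennreal_leI flip: ennreal_mult')
  also have "ennreal (\<integral>x\<in>A. \<bar>u x - t\<bar> powr p \<partial>M) = (\<integral>\<^sup>+x. ennreal (indicator A x *\<^sub>R \<bar>u x - t\<bar> powr p) \<partial>M)"
    unfolding set_lebesgue_integral_def
    using iA(3) by (intro nn_integral_eq_integral[symmetric]) (auto simp: set_integrable_def)
  also have "\<dots> = (\<integral>\<^sup>+x. (if x \<in> A then ennreal (\<bar>u x - t\<bar> powr p) else 0) \<partial>M)"
    by (intro nn_integral_cong) (auto simp: indicator_def)
  finally show ?thesis .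
qed

text \<open>Jensen's inequality up to a constant, once in each variable.\<close>

lemma mean_mean_le:
  assumes A: "A \<in> sets M" "0 < measure M A" and B: "B \<in> sets M" "0 < measure M B"
  shows "ennreal (\<bar>mean A - mean B\<bar> powr p) \<le> ennreal (4 powr p / (measure M A * measure M B)) * J A B"
proof -
  note A(1)[measurable] B(1)[measurable]
  define cA cB where "cA = ennreal (2 powr p / measure M A)" and "cB = ennreal (2 powr p / measure M B)"
  define F where "F x y = (if x \<in> A \<and> y \<in> B then ennreal (\<bar>u y - u x\<bar> powr p) else 0)" for x y
  have Fm [measurable]: "case_prod F \<in> borel_measurable (M \<Otimes>\<^sub>M M)" unfolding F_def by measurable
  have "ennreal (\<bar>mean A - mean B\<bar> powr p) \<le> cA * (\<integral>\<^sup>+x. (if x \<in> A then ennreal (\<bar>u x - mean B\<bar> powr p) else 0) \<partial>M)"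
    unfolding cA_def by (rule mean_diff_le[OF A])
  also have "\<dots> \<le> cA * (\<integral>\<^sup>+x. cB * (\<integral>\<^sup>+y. F x y \<partial>M) \<partial>M)"
  proof (intro mult_left_mono nn_integral_mono)
    fix x
    show "(if x \<in> A then ennreal (\<bar>u x - mean B\<bar> powr p) else 0) \<le> cB * (\<integral>\<^sup>+y. F x y \<partial>M)"
    proof (cases "x \<in> A")
      case True
      have "ennreal (\<bar>u x - mean B\<bar> powr p) = ennreal (\<bar>mean B - u x\<bar> powr p)" by (simp add: abs_minus_commute)
      also have "\<dots> \<le> cB * (\<integral>\<^sup>+y. (if y \<in> B then ennreal (\<bar>u y - u x\<bar> powr p) else 0) \<partial>M)"
        unfolding cB_def by (rule mean_diff_le[OF B])
      finally show ?thesis using True by (simp add: F_def)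
    qed simp
  qed simp
  also have "\<dots> = cA * (cB * (\<integral>\<^sup>+x. \<integral>\<^sup>+y. F x y \<partial>M \<partial>M))" by (simp add: nn_integral_cmult)
  also have "(\<integral>\<^sup>+x. \<integral>\<^sup>+y. F x y \<partial>M \<partial>M) = J A B" unfolding J_def F_def ..
  also have "cA * (cB * J A B) = (cA * cB) * J A B" by (simp add: mult.assoc)
  also have "cA * cB = ennreal (4 powr p / (measure M A * measure M B))"
  proof -
    have "2 powr p * 2 powr p = (4::real) powr p" by (simp flip: powr_mult)
    then show ?thesis unfolding cA_def cB_def by (simp flip: ennreal_mult')
  qed
  finally show ?thesis .
qed

lemma measure_cset_pos: "\<iota> \<in> cells m \<Longrightarrow> 0 < measure M (cset \<iota>)"
  using muK_pos N_pos by (simp add: measure_cset)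

text \<open>Each factor \<open>N ^ m\<close> is the reciprocal mass of a cell, up to
  \<open>muK\<close>; the remaining factor is the bound on the integral of
  \<open>G m\<close>.\<close>

lemma lam_power: "N ^ m * (N ^ m * ((1 / N) * 2 powr (- \<alpha>)) ^ m) = lam ^ m"
  using N_pos by (simp add: lam_def power_mult_distrib power_divide)

text \<open>The case \<open>l = m\<close> compares cells sharing a point, and
  \<open>l = Suc m\<close> compares successive levels at a point, which makes averages converge when
  \<open>lam < 1\<close>.\<close>

lemma cell_mean_diff:
  obtains C where "0 < C"
    "\<And>m l \<iota> \<kappa>. \<iota> \<in> cells m \<Longrightarrow> \<kappa> \<in> cells l \<Longrightarrow> l = m \<or> l = Suc m \<Longrightarrow> cset \<iota> \<inter> cset \<kappa> \<noteq> {} \<Longrightarrow>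
       \<bar>mean (cset \<iota>) - mean (cset \<kappa>)\<bar> \<le> C * (lam powr (1 / p)) ^ m"
proof -
  define C where "C = 4 powr p * N / (muK * muK) * CG"
  have C: "0 < C" using N_pos muK_pos CG_pos by (simp add: C_def)
  show thesis
  proof (rule that[of "C powr (1 / p)"])
    fix m l \<iota> \<kappa> assume \<iota>: "\<iota> \<in> cells m" and \<kappa>: "\<kappa> \<in> cells l" and l: "l = m \<or> l = Suc m" and ne: "cset \<iota> \<inter> cset \<kappa> \<noteq> {}"
    obtain z where z: "z \<in> cset \<iota>" "z \<in> cset \<kappa>" using ne by auto
    have d: "dist x y \<le> 4 * (1/2) ^ m" if "x \<in> cset \<iota>" "y \<in> cset \<kappa>" for x y
    proof -
      have "dist x z \<le> 2 * (1/2) ^ m" "dist y z \<le> 2 * (1/2) ^ l"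
        using cset_dist \<iota> \<kappa> z that by auto
      moreover have "(1/2::real) ^ l \<le> (1/2) ^ m" using l by auto
      ultimately show ?thesis using dist_triangle2[of x y z] by linarith
    qed
    have mul: "measure M (cset \<iota>) * measure M (cset \<kappa>) \<ge> muK * muK / N * ((1 / N) ^ m * (1 / N) ^ m)"
    proof -
      have "(1 / N) ^ l \<ge> 1 / N * (1 / N) ^ m" using l N_ge by (auto simp: field_simps)
      then have "(muK * (1 / N) ^ m) * (muK * (1 / N) ^ l) \<ge> (muK * (1 / N) ^ m) * (muK * (1 / N * (1 / N) ^ m))"
        using muK_pos N_pos by (intro mult_left_mono) auto
      then show ?thesis using \<iota> \<kappa> by (simp add: measure_cset mult_ac)
    qed
    have "ennreal (\<bar>mean (cset \<iota>) - mean (cset \<kappa>)\<bar> powr p) \<le>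
        ennreal (4 powr p / (measure M (cset \<iota>) * measure M (cset \<kappa>))) * J (cset \<iota>) (cset \<kappa>)"
      using \<iota> \<kappa> by (intro mean_mean_le cset_sets measure_cset_pos)
    also have "\<dots> \<le> ennreal (4 powr p / (muK * muK / N * ((1 / N) ^ m * (1 / N) ^ m))) * ennreal (CG * ((1 / N) * 2 powr (- \<alpha>)) ^ m)"
    proof (intro mult_mono ennreal_leI)
      show "4 powr p / (measure M (cset \<iota>) * measure M (cset \<kappa>)) \<le> 4 powr p / (muK * muK / N * ((1 / N) ^ m * (1 / N) ^ m))"
        using mul N_pos muK_pos measure_cset_pos[OF \<iota>] measure_cset_pos[OF \<kappa>]
        by (intro divide_left_mono mul mult_pos_pos) auto
      show "J (cset \<iota>) (cset \<kappa>) \<le> ennreal (CG * ((1 / N) * 2 powr (- \<alpha>)) ^ m)"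
        using J_le_G[of "cset \<iota>" "cset \<kappa>" m] d G_bound[of m] by (meson order_trans)
    qed auto
    also have "\<dots> = ennreal (4 powr p / (muK * muK / N * ((1 / N) ^ m * (1 / N) ^ m)) * (CG * ((1 / N) * 2 powr (- \<alpha>)) ^ m))"
      using N_pos muK_pos CG_pos by (simp flip: ennreal_mult)
    also have "4 powr p / (muK * muK / N * ((1 / N) ^ m * (1 / N) ^ m)) * (CG * ((1 / N) * 2 powr (- \<alpha>)) ^ m)
        = C * (N ^ m * (N ^ m * ((1 / N) * 2 powr (- \<alpha>)) ^ m))"
      using N_pos muK_pos by (simp add: C_def power_divide)
    also have "\<dots> = C * lam ^ m" by (simp only: lam_power)
    finally have "\<bar>mean (cset \<iota>) - mean (cset \<kappa>)\<bar> powr p \<le> C * lam ^ m"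
      using C lam_pos by simp
    then have "(\<bar>mean (cset \<iota>) - mean (cset \<kappa>)\<bar> powr p) powr (1 / p) \<le> (C * lam ^ m) powr (1 / p)"
      using p by (intro powr_mono2) auto
    also have "\<dots> = C powr (1 / p) * (lam powr (1 / p)) ^ m"
      by (simp only: powr_mult realpow_powr)
    finally show "\<bar>mean (cset \<iota>) - mean (cset \<kappa>)\<bar> \<le> C powr (1 / p) * (lam powr (1 / p)) ^ m"
      using p by (simp add: powr_powr)
  qed (use C in simp)
qed

lemma sum_mean_diff:
  obtains C where "0 < C"
    "\<And>m. (\<Sum>\<iota>\<in>cells m. \<Sum>\<kappa>\<in>{\<kappa>\<in>cells m. adj \<iota> \<kappa>}. \<bar>mean (cset \<iota>) - mean (cset \<kappa>)\<bar> powr p) \<le> C * lam ^ m"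
proof -
  define C where "C = 4 powr p / (muK * muK) * ((2 * N\<^sup>2)\<^sup>2 * CG)"
  have C: "0 < C" using N_pos muK_pos CG_pos by (simp add: C_def)
  have "(\<Sum>\<iota>\<in>cells m. \<Sum>\<kappa>\<in>{\<kappa>\<in>cells m. adj \<iota> \<kappa>}. \<bar>mean (cset \<iota>) - mean (cset \<kappa>)\<bar> powr p) \<le> C * lam ^ m" for m
  proof -
    let ?P = "Sigma (cells m) (\<lambda>\<iota>. {\<kappa>\<in>cells m. adj \<iota> \<kappa>})"
    define cc where "cc = 4 powr p / (muK * muK * ((1 / N) ^ m * (1 / N) ^ m))"
    have "ennreal (\<Sum>\<iota>\<in>cells m. \<Sum>\<kappa>\<in>{\<kappa>\<in>cells m. adj \<iota> \<kappa>}. \<bar>mean (cset \<iota>) - mean (cset \<kappa>)\<bar> powr p)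
        = ennreal (\<Sum>(\<iota>, \<kappa>)\<in>?P. \<bar>mean (cset \<iota>) - mean (cset \<kappa>)\<bar> powr p)"
      by (subst sum.Sigma) (auto simp: finite_cells)
    also have "\<dots> = (\<Sum>i\<in>?P. ennreal (\<bar>mean (cset (fst i)) - mean (cset (snd i))\<bar> powr p))"
      by (simp add: case_prod_unfold)
    also have "\<dots> \<le> (\<Sum>i\<in>?P. ennreal cc * J (cset (fst i)) (cset (snd i)))"
    proof (rule sum_mono)
      fix i assume "i \<in> ?P"
      then have i: "fst i \<in> cells m" "snd i \<in> cells m" by auto
      show "ennreal (\<bar>mean (cset (fst i)) - mean (cset (snd i))\<bar> powr p) \<le> ennreal cc * J (cset (fst i)) (cset (snd i))"
        using mean_mean_le[OF cset_sets[OF i(1)] measure_cset_pos[OF i(1)] cset_sets[OF i(2)] measure_cset_pos[OF i(2)]]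
        by (simp add: measure_cset[OF i(1)] measure_cset[OF i(2)] cc_def mult_ac)
    qed
    also have "\<dots> = ennreal cc * (\<Sum>(\<iota>, \<kappa>)\<in>?P. J (cset \<iota>) (cset \<kappa>))"
      by (simp add: sum_distrib_left case_prod_unfold)
    also have "\<dots> \<le> ennreal cc * ennreal ((2 * N\<^sup>2)\<^sup>2 * (CG * ((1 / N) * 2 powr (- \<alpha>)) ^ m))"
      by (intro mult_left_mono sum_J_le) auto
    also have "\<dots> = ennreal (cc * ((2 * N\<^sup>2)\<^sup>2 * (CG * ((1 / N) * 2 powr (- \<alpha>)) ^ m)))"
      using N_pos muK_pos CG_pos by (simp add: cc_def flip: ennreal_mult)
    also have "cc * ((2 * N\<^sup>2)\<^sup>2 * (CG * ((1 / N) * 2 powr (- \<alpha>)) ^ m)) = C * (N ^ m * (N ^ m * ((1 / N) * 2 powr (- \<alpha>)) ^ m))"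
      using N_pos muK_pos by (simp add: C_def cc_def power_divide)
    also have "\<dots> = C * lam ^ m" by (simp only: lam_power)
    finally show ?thesis using C lam_pos by (simp add: sum_nonneg)
  qed
  then show thesis using that C by blast
qed

text \<open>A vertex lies in several cells, so a choice is made; averages over the different
  candidates are compared through adjacency.\<close>

definition cell_at :: "nat \<Rightarrow> real^'n \<Rightarrow> bool \<times> nat list" where
  "cell_at m x = (SOME \<iota>. \<iota> \<in> cells m \<and> x \<in> cset \<iota>)"

lemma cell_at: "x \<in> X \<Longrightarrow> cell_at m x \<in> cells m \<and> x \<in> cset (cell_at m x)"
  unfolding cell_at_def by (rule someI_ex) (metis X_cellE)

definition avg :: "nat \<Rightarrow> real^'n \<Rightarrow> real" where
  "avg m x = mean (cset (cell_at m x))"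

lemma cmap_append: "cmap (s, w @ v) x = cmap (s, w) (word_map q v x)"
  by (simp add: cmap_def word_map_append)

lemma vertex_in_X: "\<iota> \<in> cells m \<Longrightarrow> a \<le> n \<Longrightarrow> cmap \<iota> (q a) \<in> X"
  using vertex_in_cset cset_subset_X by blast

text \<open>The cell chosen for a vertex is adjacent to every cell having that vertex, so the
  discrete energy is dominated by the sum over adjacent cells in
  \<open>sum_mean_diff\<close>.\<close>

lemma En_avg:
  obtains C where "0 < C" "\<And>l m \<iota>. \<iota> \<in> cells l \<Longrightarrow> En m (\<lambda>x. avg (l + m) (cmap \<iota> x)) \<le> C * lam ^ (l + m)"
proof -
  obtain C where C: "0 < C"
    "\<forall>m. (\<Sum>\<iota>\<in>cells m. \<Sum>\<kappa>\<in>{\<kappa>\<in>cells m. adj \<iota> \<kappa>}. \<bar>mean (cset \<iota>) - mean (cset \<kappa>)\<bar> powr p) \<le> C * lam ^ m"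
    by (rule sum_mean_diff) blast
  have "En m (\<lambda>x. avg (l + m) (cmap \<iota> x)) \<le> (2 * 2 powr p * (N * N) * C) * lam ^ (l + m)" if \<iota>: "\<iota> \<in> cells l" for l m \<iota>
  proof -
    define D where "D \<kappa> = (\<Sum>\<kappa>'\<in>{\<kappa>'\<in>cells (l + m). adj \<kappa> \<kappa>'}. \<bar>mean (cset \<kappa>) - mean (cset \<kappa>')\<bar> powr p)" for \<kappa>
    have D0: "0 \<le> D \<kappa>" for \<kappa> unfolding D_def by (intro sum_nonneg) auto
    define e where "e w = (fst \<iota>, snd \<iota> @ w)" for w
    have e: "e w \<in> cells (l + m)" if "w \<in> words n m" for w
      using \<iota> that by (auto simp: e_def cells_def words_append)
    have near: "\<bar>avg (l + m) (cmap (e w) (q a)) - mean (cset (e w))\<bar> powr p \<le> D (e w)" if w: "w \<in> words n m" and a: "a \<le> n" for w a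
    proof -
      let ?v = "cmap (e w) (q a)"
      have c: "cell_at (l + m) ?v \<in> cells (l + m)" "?v \<in> cset (cell_at (l + m) ?v)"
        using cell_at[OF vertex_in_X[OF e[OF w] a]] by auto
      then have "adj (e w) (cell_at (l + m) ?v)"
        using adj_if_common_point[OF e[OF w] _ vertex_in_cset[OF a]] by blast
      then have "\<bar>mean (cset (e w)) - mean (cset (cell_at (l + m) ?v))\<bar> powr p \<le> D (e w)"
        unfolding D_def using c
        by (intro member_le_sum[of "cell_at (l + m) ?v" _ "\<lambda>\<kappa>'. \<bar>mean (cset (e w)) - mean (cset \<kappa>')\<bar> powr p"])
          (auto simp: finite_cells)
      then show ?thesis by (simp add: avg_def abs_minus_commute)
    qed
    have "En m (\<lambda>x. avg (l + m) (cmap \<iota> x)) \<le> (\<Sum>w\<in>words n m. \<Sum>a\<le>n. \<Sum>b\<le>n. 2 powr p * (2 * D (e w)))"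
      unfolding En_def
    proof (intro sum_mono)
      fix w a b assume w: "w \<in> words n m" and ab: "a \<in> {..n}" "b \<in> {..n}"
      have ce: "cmap \<iota> (word_map q w x) = cmap (e w) x" for x
        unfolding e_def by (simp add: cmap_append)
      let ?f = "\<lambda>a. avg (l + m) (cmap (e w) (q a))" and ?c = "mean (cset (e w))"
      have "\<bar>?f a - ?f b\<bar> powr p \<le> 2 powr p * (\<bar>?f a - ?c\<bar> powr p + \<bar>?f b - ?c\<bar> powr p)"
        using powr_abs_diff_le[of p "?f a" "?f b" ?c] p by (simp add: abs_minus_commute[of ?c])
      also have "\<dots> \<le> 2 powr p * (D (e w) + D (e w))" using ab by (intro mult_left_mono add_mono near w) auto
      finally show "\<bar>avg (l + m) (cmap \<iota> (word_map q w (q a))) - avg (l + m) (cmap \<iota> (word_map q w (q b)))\<bar> powr p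
          \<le> 2 powr p * (2 * D (e w))" by (simp add: ce)
    qed
    also have "\<dots> = (2 * 2 powr p * (N * N)) * (\<Sum>w\<in>words n m. D (e w))"
      by (simp only: sum_const_N) (simp add: sum_distrib_left mult_ac)
    also have "(\<Sum>w\<in>words n m. D (e w)) = (\<Sum>\<kappa>\<in>e ` words n m. D \<kappa>)"
      by (subst sum.reindex) (auto simp: e_def inj_on_def)
    also have "\<dots> \<le> (\<Sum>\<kappa>\<in>cells (l + m). D \<kappa>)"
      using e D0 by (intro sum_mono2) (auto simp: finite_cells)
    also have "\<dots> \<le> C * lam ^ (l + m)" using C(2) unfolding D_def by blast
    finally show ?thesis using N_pos by (simp add: mult_ac)
  qed
  moreover have "0 < 2 * 2 powr p * (N * N) * C" using C(1) N_pos by simp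
  ultimately show thesis using that by blast
qed

text \<open>Normalising \<open>f\<close> to the values 0 and 1 and moving the two vertices to
  \<open>q 0\<close> and \<open>q 1\<close> by a symmetry gives a competitor for the conductance.
  The inverse permutation is used because \<open>perm_map \<tau>\<close> acts on the
  argument.\<close>

lemma vertex_diff_le_conductance:
  assumes "a \<le> n" "b \<le> n"
  shows "\<bar>f (q a) - f (q b)\<bar> powr p * c m \<le> En m f / 2"
proof (cases "f (q a) = f (q b)")
  case True
  then show ?thesis using p by (simp add: En_nonneg)
next
  case False
  then have "a \<noteq> b" by auto
  from exists_perm[OF assms this] obtain \<sigma> where \<sigma>: "bij_betw \<sigma> {..n} {..n}" "\<sigma> a = 1" "\<sigma> b = 0" .
  define \<tau> where "\<tau> = the_inv_into {..n} \<sigma>"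
  have \<tau>: "bij_betw \<tau> {..n} {..n}" unfolding \<tau>_def by (rule bij_betw_the_inv_into[OF \<sigma>(1)])
  have inj: "inj_on \<sigma> {..n}" using \<sigma>(1) by (simp add: bij_betw_def)
  have \<tau>1: "\<tau> 1 = a" unfolding \<tau>_def using the_inv_into_f_f[OF inj, of a] assms \<sigma>(2) by simp
  have \<tau>0: "\<tau> 0 = b" unfolding \<tau>_def using the_inv_into_f_f[OF inj, of b] assms \<sigma>(3) by simp
  define d where "d = f (q a) - f (q b)"
  have d: "d \<noteq> 0" using False by (simp add: d_def)
  have "c m \<le> En m (\<lambda>x. (1 / d) * f (perm_map \<tau> x) + (- f (q b) / d)) / 2"
    using d one_le_n by (intro conductance_le) (simp_all add: perm_map_q \<tau>0 \<tau>1 d_def diff_divide_distrib[symmetric] del: q_0 One_nat_def)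
  also have "En m (\<lambda>x. (1 / d) * f (perm_map \<tau> x) + (- f (q b) / d)) = \<bar>1 / d\<bar> powr p * En m f"
    by (simp only: En_affine En_perm_map[OF \<tau>])
  also have "\<bar>1 / d\<bar> powr p = 1 / \<bar>d\<bar> powr p" by (simp add: powr_divide abs_divide)
  finally show ?thesis using d by (simp add: d_def field_simps)
qed

section \<open>Constancy above the threshold\<close>

lemma ae_constant_above:
  assumes lr: "lam * \<rho> < 1"
  shows "ae_constant M u"
proof -
  have lam1: "lam < 1" 
  proof -
    have "lam * 1 \<le> lam * \<rho>" using lam_pos rho_gt_1 by (intro mult_left_mono) auto
    then show ?thesis using lr by simp
  qed
  define \<mu> where "\<mu> = lam powr (1 / p)"
  have \<mu>: "0 < \<mu>" "\<mu> < 1"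
    using lam_pos lam1 p powr_less_mono2[of "1 / p" lam 1] by (auto simp: \<mu>_def)
  obtain C where C: "0 < C" "\<forall>m l \<iota> \<kappa>. \<iota> \<in> cells m \<longrightarrow> \<kappa> \<in> cells l \<longrightarrow> l = m \<or> l = Suc m \<longrightarrow> cset \<iota> \<inter> cset \<kappa> \<noteq> {} \<longrightarrow>
       \<bar>mean (cset \<iota>) - mean (cset \<kappa>)\<bar> \<le> C * \<mu> ^ m"
    unfolding \<mu>_def by (rule cell_mean_diff) blast
  have step: "\<bar>avg (Suc m) x - avg m x\<bar> \<le> C * \<mu> ^ m" if "x \<in> X" for x m
    using C(2)[rule_format, of "cell_at m x" m "cell_at (Suc m) x" "Suc m"]
      cell_at[OF that, of m] cell_at[OF that, of "Suc m"]
    by (auto simp: avg_def abs_minus_commute)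
  have summ: "summable (\<lambda>i. C * \<mu> ^ (i + m))" for m
    using \<mu> by (intro summable_mult) (simp add: power_add summable_mult2 summable_geometric)
  \<comment> \<open>A substitute for point values: averages over the chosen cells around
    \<open>x\<close> form a Cauchy sequence with geometric rate \<mu>.\<close>
  define L where "L x = lim (\<lambda>m. avg m x)" for x
  have L: "(\<lambda>m. avg m x) \<longlonglongrightarrow> L x \<and> (\<forall>m. \<bar>L x - avg m x\<bar> \<le> C / (1 - \<mu>) * \<mu> ^ m)" if x: "x \<in> X" for x
  proof -
    have tel: "\<bar>avg (m + j) x - avg m x\<bar> \<le> C / (1 - \<mu>) * \<mu> ^ m" for m j
    proof -
      have "\<bar>avg (m + j) x - avg m x\<bar> \<le> (\<Sum>i<j. C * \<mu> ^ (i + m))"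
      proof (induction j)
        case (Suc j)
        have "\<bar>avg (Suc (m + j)) x - avg (m + j) x\<bar> \<le> C * \<mu> ^ (m + j)" by (rule step[OF x])
        then show ?case using Suc by (simp add: add.commute)
      qed simp
      also have "\<dots> \<le> (\<Sum>i. C * \<mu> ^ (i + m))"
        using C(1) \<mu> by (intro sum_le_suminf summ) auto
      also have "\<dots> = (\<Sum>i. (C * \<mu> ^ m) * \<mu> ^ i)" by (simp add: power_add mult_ac)
      also have "\<dots> = C * \<mu> ^ m * (\<Sum>i. \<mu> ^ i)"
        using \<mu> by (intro suminf_mult summable_geometric) auto
      also have "\<dots> = C / (1 - \<mu>) * \<mu> ^ m" using \<mu> by (simp add: suminf_geometric)
      finally show ?thesis .
    qed
    have "(\<lambda>m. C / (1 - \<mu>) * \<mu> ^ m) \<longlonglongrightarrow> C / (1 - \<mu>) * 0"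
      using \<mu> by (intro tendsto_mult tendsto_const LIMSEQ_power_zero) auto
    then have z: "(\<lambda>m. C / (1 - \<mu>) * \<mu> ^ m) \<longlonglongrightarrow> 0" by simp
    have "Cauchy (\<lambda>m. avg m x)"
    proof (rule CauchyI')
      fix e :: real assume "0 < e"
      then have "eventually (\<lambda>m. C / (1 - \<mu>) * \<mu> ^ m < e) sequentially" using z order_tendstoD(2) by blast
      then obtain m0 where m0: "\<And>m. m0 \<le> m \<Longrightarrow> C / (1 - \<mu>) * \<mu> ^ m < e" by (auto simp: eventually_sequentially)
      show "\<exists>M. \<forall>m\<ge>M. \<forall>n>m. dist (avg m x) (avg n x) < e"
      proof (intro exI[of _ m0] allI impI)
        fix m j assume "m0 \<le> m" "m < j"
        then show "dist (avg m x) (avg j x) < e"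
          using tel[of m "j - m"] m0[of m] by (simp add: dist_real_def abs_minus_commute)
      qed
    qed
    then have lim: "(\<lambda>m. avg m x) \<longlonglongrightarrow> L x"
      unfolding L_def by (simp add: Cauchy_convergent convergent_LIMSEQ_iff[symmetric])
    have "\<bar>L x - avg m x\<bar> \<le> C / (1 - \<mu>) * \<mu> ^ m" for m
    proof (rule LIMSEQ_le_const2)
      show "(\<lambda>j. \<bar>avg (j + m) x - avg m x\<bar>) \<longlonglongrightarrow> \<bar>L x - avg m x\<bar>"
        using LIMSEQ_ignore_initial_segment[OF lim, of m] by (intro tendsto_intros)
      show "\<exists>N. \<forall>j\<ge>N. \<bar>avg (j + m) x - avg m x\<bar> \<le> C / (1 - \<mu>) * \<mu> ^ m"
        using tel[of m] by (auto simp: add.commute)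
    qed
    then show ?thesis using lim by blast
  qed
  obtain C2 where C2: "0 < C2" "\<forall>l m \<iota>. \<iota> \<in> cells l \<longrightarrow> En m (\<lambda>x. avg (l + m) (cmap \<iota> x)) \<le> C2 * lam ^ (l + m)"
    by (rule En_avg) blast
  \<comment> \<open>The energy of the averages is \<open>O(lam ^ m)\<close>, while a difference at
    two vertices costs at least a multiple of \<open>(1 / \<rho>) ^ m\<close>; since
    \<open>lam * \<rho> < 1\<close>, the difference tends to 0.\<close>
  have same_cell: "L (cmap \<iota> (q a)) = L (cmap \<iota> (q b))" if \<iota>: "\<iota> \<in> cells l" and ab: "a \<le> n" "b \<le> n" for l \<iota> a b
  proof -
    define d where "d m = avg (l + m) (cmap \<iota> (q a)) - avg (l + m) (cmap \<iota> (q b))" for m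
    have "d \<longlonglongrightarrow> L (cmap \<iota> (q a)) - L (cmap \<iota> (q b))"
      unfolding d_def
      using L[OF vertex_in_X[OF \<iota> ab(1)]] L[OF vertex_in_X[OF \<iota> ab(2)]]
      by (intro tendsto_diff) (auto simp: add.commute[of l] intro: LIMSEQ_ignore_initial_segment)
    moreover have "d \<longlonglongrightarrow> 0"
    proof -
      have bound: "\<bar>d m\<bar> powr p \<le> ext_const * C2 * lam ^ l / 2 * (lam * \<rho>) ^ m" if m: "0 < m" for m
      proof -
        have "\<bar>d m\<bar> powr p * c m \<le> En m (\<lambda>x. avg (l + m) (cmap \<iota> x)) / 2"
          unfolding d_def by (rule vertex_diff_le_conductance[OF ab])
        also have "\<dots> \<le> C2 * lam ^ (l + m) / 2" by (intro divide_right_mono C2(2)[rule_format, OF \<iota>]) auto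
        finally have "ext_const * c m * \<bar>d m\<bar> powr p \<le> ext_const * (C2 * lam ^ (l + m) / 2)"
          using ext_const_pos by (simp add: mult_ac)
        moreover have "(1 / \<rho>) ^ m * \<bar>d m\<bar> powr p \<le> ext_const * c m * \<bar>d m\<bar> powr p"
          by (intro mult_right_mono rho_lower[OF m]) auto
        ultimately have "(1 / \<rho>) ^ m * \<bar>d m\<bar> powr p \<le> ext_const * (C2 * lam ^ (l + m) / 2)" by linarith
        then show ?thesis using rho_pos by (simp add: field_simps power_mult_distrib power_add power_divide)
      qed
      have "(\<lambda>m. ext_const * C2 * lam ^ l / 2 * (lam * \<rho>) ^ m) \<longlonglongrightarrow> ext_const * C2 * lam ^ l / 2 * 0"
        using lr lam_pos rho_pos by (intro tendsto_mult tendsto_const LIMSEQ_power_zero) auto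
      then have z: "(\<lambda>m. ext_const * C2 * lam ^ l / 2 * (lam * \<rho>) ^ m) \<longlonglongrightarrow> 0" by simp
      have "eventually (\<lambda>m. \<bar>d m\<bar> powr p \<le> ext_const * C2 * lam ^ l / 2 * (lam * \<rho>) ^ m) sequentially"
        using eventually_gt_at_top[of 0] by (rule eventually_mono) (rule bound)
      then have "(\<lambda>m. \<bar>d m\<bar> powr p) \<longlonglongrightarrow> 0"
        by (intro real_tendsto_sandwich[OF _ _ tendsto_const z]) auto
      then have "(\<lambda>m. (\<bar>d m\<bar> powr p) powr (1 / p)) \<longlonglongrightarrow> 0 powr (1 / p)"
        using p by (intro tendsto_powr2 tendsto_const) auto
      then have "(\<lambda>m. \<bar>d m\<bar>) \<longlonglongrightarrow> 0" using p by (simp add: powr_powr)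
      then show ?thesis by (simp add: tendsto_rabs_zero_iff)
    qed
    ultimately show ?thesis using LIMSEQ_unique by force
  qed
  define a0 where "a0 = L 0"
  \<comment> \<open>The subcell for the last letter \<open>i\<close> contains the vertex of index
    \<open>i\<close> of its parent, so the value is inherited. At the root, both halves contain
    \<open>0\<close>, where \<open>a0\<close> is taken.\<close>
  have Lv: "set w \<subseteq> {..n} \<Longrightarrow> a \<le> n \<Longrightarrow> L (cmap (s, w) (q a)) = a0" for s w a
  proof (induction w arbitrary: a rule: rev_induct)
    case Nil
    have "(s, []) \<in> cells 0" by (simp add: cells_def words_0)
    moreover have "cmap (s, []) (q 0) = 0" by (simp add: cmap_def)
    ultimately show ?case using same_cell[of "(s, [])" 0 a 0] Nil by (simp add: a0_def)
  next
    case (snoc i w)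
    have "(s, w @ [i]) \<in> cells (length (w @ [i]))" using snoc.prems by (auto simp: cells_def words_def)
    then have "L (cmap (s, w @ [i]) (q a)) = L (cmap (s, w @ [i]) (q i))"
      using snoc.prems by (intro same_cell) auto
    also have "cmap (s, w @ [i]) (q i) = cmap (s, w) (q i)" by (simp add: cmap_append gasket_map_q)
    finally show ?case using snoc by simp
  qed
  define C3 where "C3 = C + C / (1 - \<mu>)"
  have C3: "0 < C3" using C(1) \<mu> by (simp add: C3_def add_pos_pos)
  have mean_near: "\<bar>mean (cset \<iota>) - a0\<bar> \<le> C3 * \<mu> ^ m" if \<iota>: "\<iota> \<in> cells m" for \<iota> m
  proof -
    let ?v = "cmap \<iota> (q 0)"
    have v: "?v \<in> X" "?v \<in> cset \<iota>" using vertex_in_X[OF \<iota>, of 0] vertex_in_cset[of 0 \<iota>] by auto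
    have "\<bar>mean (cset \<iota>) - avg m ?v\<bar> \<le> C * \<mu> ^ m"
      unfolding avg_def using C(2)[rule_format, of \<iota> m "cell_at m ?v" m] \<iota> cell_at[OF v(1), of m] v(2) by auto
    moreover have "\<bar>L ?v - avg m ?v\<bar> \<le> C / (1 - \<mu>) * \<mu> ^ m" using L[OF v(1)] by blast
    moreover have "L ?v = a0" using Lv[of "snd \<iota>" 0 "fst \<iota>"] \<iota> by (auto simp: cells_def words_def)
    ultimately show ?thesis unfolding C3_def distrib_right by linarith
  qed
  define I where "I = (\<integral>\<^sup>+x. ennreal (\<bar>u x - a0\<bar> powr p) \<partial>M)"
  \<comment> \<open>In each cell \<open>u - a0\<close> is split at the cell mean. The oscillation
    about the mean totals \<open>O((2 powr (- \<alpha>)) ^ m)\<close>, after the reciprocal mass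
    cancels \<open>1 / N\<close>; the distance of the means from \<open>a0\<close> is
    \<open>O(\<mu> ^ m)\<close>.\<close>
  define B where "B m = 2 powr p * (2 powr p / muK * ((2 * N\<^sup>2)\<^sup>2 * CG) * (2 powr (- \<alpha>)) ^ m
      + 2 * muK * C3 powr p * (\<mu> powr p) ^ m)" for m
  have "I \<le> ennreal (B m)" for m
  proof -
    have cs [measurable]: "cset \<iota> \<in> sets M" if "\<iota> \<in> cells m" for \<iota> using cset_sets that .
    have "I \<le> (\<integral>\<^sup>+x. (\<Sum>\<iota>\<in>cells m. if x \<in> cset \<iota> then ennreal (\<bar>u x - a0\<bar> powr p) else 0) \<partial>M)"
      unfolding I_def
    proof (rule nn_integral_mono)
      fix x assume "x \<in> space M"
      then obtain \<iota> where \<iota>: "\<iota> \<in> cells m" "x \<in> cset \<iota>" using X_cellE unfolding space_M by metis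
      show "ennreal (\<bar>u x - a0\<bar> powr p) \<le> (\<Sum>\<iota>\<in>cells m. if x \<in> cset \<iota> then ennreal (\<bar>u x - a0\<bar> powr p) else 0)"
        using member_le_sum[of \<iota> "cells m" "\<lambda>\<iota>. if x \<in> cset \<iota> then ennreal (\<bar>u x - a0\<bar> powr p) else 0"] \<iota>
        by (simp add: finite_cells)
    qed
    also have "\<dots> = (\<Sum>\<iota>\<in>cells m. \<integral>\<^sup>+x. (if x \<in> cset \<iota> then ennreal (\<bar>u x - a0\<bar> powr p) else 0) \<partial>M)"
      by (intro nn_integral_sum) measurable
    also have "\<dots> \<le> (\<Sum>\<iota>\<in>cells m. ennreal (2 powr p) * (ennreal (2 powr p / (muK * (1 / N) ^ m)) * J (cset \<iota>) (cset \<iota>)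
        + ennreal (muK * (1 / N) ^ m * (C3 powr p * (\<mu> powr p) ^ m))))"
    proof (rule sum_mono)
      fix \<iota> assume \<iota>: "\<iota> \<in> cells m"
      note cs[OF \<iota>, measurable]
      let ?g = "\<lambda>x. if x \<in> cset \<iota> then ennreal (2 powr p / (muK * (1 / N) ^ m)) *
          (\<integral>\<^sup>+y. (if y \<in> cset \<iota> then ennreal (\<bar>u y - u x\<bar> powr p) else 0) \<partial>M) else 0"
      let ?h = "\<lambda>x. if x \<in> cset \<iota> then ennreal (C3 powr p * (\<mu> powr p) ^ m) else 0"
      have "(\<integral>\<^sup>+x. (if x \<in> cset \<iota> then ennreal (\<bar>u x - a0\<bar> powr p) else 0) \<partial>M)
          \<le> (\<integral>\<^sup>+x. ennreal (2 powr p) * (?g x + ?h x) \<partial>M)"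
      proof (rule nn_integral_mono)
        fix x
        show "(if x \<in> cset \<iota> then ennreal (\<bar>u x - a0\<bar> powr p) else 0) \<le> ennreal (2 powr p) * (?g x + ?h x)"
        proof (cases "x \<in> cset \<iota>")
          case True
          have "\<bar>u x - a0\<bar> powr p \<le> 2 powr p * (\<bar>mean (cset \<iota>) - u x\<bar> powr p + \<bar>mean (cset \<iota>) - a0\<bar> powr p)"
            using powr_abs_diff_le[of p "u x" a0 "mean (cset \<iota>)"] p by (simp add: abs_minus_commute[of "u x"])
          also have "\<dots> \<le> 2 powr p * (\<bar>mean (cset \<iota>) - u x\<bar> powr p + (C3 * \<mu> ^ m) powr p)"
            using p mean_near[OF \<iota>] by (intro mult_left_mono add_left_mono powr_mono2) auto
          also have "(C3 * \<mu> ^ m) powr p = C3 powr p * (\<mu> powr p) ^ m"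
            by (simp only: powr_mult realpow_powr)
          finally have "ennreal (\<bar>u x - a0\<bar> powr p) \<le>
              ennreal (2 powr p * (\<bar>mean (cset \<iota>) - u x\<bar> powr p + C3 powr p * (\<mu> powr p) ^ m))"
            by (rule ennreal_leI)
          also have "\<dots> = ennreal (2 powr p) * (ennreal (\<bar>mean (cset \<iota>) - u x\<bar> powr p) + ennreal (C3 powr p * (\<mu> powr p) ^ m))"
          proof -
            have nn: "0 \<le> \<bar>mean (cset \<iota>) - u x\<bar> powr p" "0 \<le> C3 powr p * (\<mu> powr p) ^ m" by auto
            show ?thesis by (simp only: ennreal_mult[OF _ add_nonneg_nonneg[OF nn]] ennreal_plus[OF nn] powr_ge_zero)
          qed
          also have "\<dots> \<le> ennreal (2 powr p) * (?g x + ?h x)"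
            using mean_diff_le[OF cs[OF \<iota>] measure_cset_pos[OF \<iota>], of "u x"] True measure_cset[OF \<iota>]
            by (intro mult_left_mono add_mono) auto
          finally show ?thesis using True by simp
        qed simp
      qed
      also have "\<dots> = ennreal (2 powr p) * ((\<integral>\<^sup>+x. ?g x \<partial>M) + (\<integral>\<^sup>+x. ?h x \<partial>M))"
        by (subst nn_integral_cmult, measurable) (subst nn_integral_add, measurable)
      also have "(\<integral>\<^sup>+x. ?h x \<partial>M) = (\<integral>\<^sup>+x. ennreal (C3 powr p * (\<mu> powr p) ^ m) * indicator (cset \<iota>) x \<partial>M)"
        by (intro nn_integral_cong) (auto simp: indicator_def)
      also have "\<dots> = ennreal (C3 powr p * (\<mu> powr p) ^ m) * emeasure M (cset \<iota>)"
        using cs[OF \<iota>] by (rule nn_integral_cmult_indicator)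
      also have "\<dots> = ennreal (muK * (1 / N) ^ m * (C3 powr p * (\<mu> powr p) ^ m))"
        using muK_pos N_pos by (simp add: emeasure_cset[OF \<iota>] mult_ac flip: ennreal_mult)
      also have "(\<integral>\<^sup>+x. ?g x \<partial>M) = (\<integral>\<^sup>+x. ennreal (2 powr p / (muK * (1 / N) ^ m)) *
          (\<integral>\<^sup>+y. (if x \<in> cset \<iota> \<and> y \<in> cset \<iota> then ennreal (\<bar>u y - u x\<bar> powr p) else 0) \<partial>M) \<partial>M)"
        by (intro nn_integral_cong) auto
      also have "\<dots> = ennreal (2 powr p / (muK * (1 / N) ^ m)) * J (cset \<iota>) (cset \<iota>)"
        unfolding J_def by (rule nn_integral_cmult) measurable
      finally show "(\<integral>\<^sup>+x. (if x \<in> cset \<iota> then ennreal (\<bar>u x - a0\<bar> powr p) else 0) \<partial>M) \<le>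
          ennreal (2 powr p) * (ennreal (2 powr p / (muK * (1 / N) ^ m)) * J (cset \<iota>) (cset \<iota>)
            + ennreal (muK * (1 / N) ^ m * (C3 powr p * (\<mu> powr p) ^ m)))" .
    qed
    also have "\<dots> = ennreal (2 powr p) * (ennreal (2 powr p / (muK * (1 / N) ^ m)) * (\<Sum>\<iota>\<in>cells m. J (cset \<iota>) (cset \<iota>))
        + ennreal (real (card (cells m)) * (muK * (1 / N) ^ m * (C3 powr p * (\<mu> powr p) ^ m))))"
    proof -
      define t where "t = muK * (1 / N) ^ m * (C3 powr p * (\<mu> powr p) ^ m)"
      have "0 \<le> t" using muK_pos N_pos by (simp add: t_def)
      then have "of_nat (card (cells m)) * ennreal t = ennreal (real (card (cells m)) * t)"
        by (simp add: ennreal_of_nat_eq_real_of_nat ennreal_mult)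
      then show ?thesis unfolding t_def[symmetric]
        by (simp only: sum_distrib_left[symmetric] sum.distrib sum_constant)
    qed
    also have "(\<Sum>\<iota>\<in>cells m. J (cset \<iota>) (cset \<iota>)) = (\<Sum>(\<iota>, \<kappa>)\<in>(\<lambda>\<iota>. (\<iota>, \<iota>)) ` cells m. J (cset \<iota>) (cset \<kappa>))"
      by (subst sum.reindex) (auto simp: inj_on_def)
    also have "ennreal (2 powr p) * (ennreal (2 powr p / (muK * (1 / N) ^ m)) * \<dots>
        + ennreal (real (card (cells m)) * (muK * (1 / N) ^ m * (C3 powr p * (\<mu> powr p) ^ m))))
      \<le> ennreal (2 powr p) * (ennreal (2 powr p / (muK * (1 / N) ^ m)) * ennreal ((2 * N\<^sup>2)\<^sup>2 * (CG * ((1 / N) * 2 powr (- \<alpha>)) ^ m))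
        + ennreal (real (card (cells m)) * (muK * (1 / N) ^ m * (C3 powr p * (\<mu> powr p) ^ m))))"
      by (intro mult_left_mono add_right_mono sum_J_le) (auto simp: adj_refl)
    also have "\<dots> = ennreal (2 powr p * (2 powr p / (muK * (1 / N) ^ m) * ((2 * N\<^sup>2)\<^sup>2 * (CG * ((1 / N) * 2 powr (- \<alpha>)) ^ m))
        + real (card (cells m)) * (muK * (1 / N) ^ m * (C3 powr p * (\<mu> powr p) ^ m))))"
    proof -
      have *: "ennreal a * (ennreal b * ennreal d + ennreal e) = ennreal (a * (b * d + e))"
        if "0 \<le> a" "0 \<le> b" "0 \<le> d" "0 \<le> e" for a b d e
        using that by (simp add: ennreal_mult)
      show ?thesis using muK_pos N_pos CG_pos by (intro *) auto
    qed
    also have "2 powr p * (2 powr p / (muK * (1 / N) ^ m) * ((2 * N\<^sup>2)\<^sup>2 * (CG * ((1 / N) * 2 powr (- \<alpha>)) ^ m))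
        + real (card (cells m)) * (muK * (1 / N) ^ m * (C3 powr p * (\<mu> powr p) ^ m))) = B m"
      using muK_pos N_pos by (simp add: B_def card_cells power_divide power_mult_distrib)
    finally show ?thesis .
  qed
  moreover have "B \<longlonglongrightarrow> 0"
  proof -
    have "2 powr (- \<alpha>) < (1::real)" using alpha_pos by (simp add: powr_less_one)
    moreover have "\<mu> powr p < 1" using \<mu> p powr_less_mono2[of p \<mu> 1] by auto
    ultimately have "B \<longlonglongrightarrow> 2 powr p * (2 powr p / muK * ((2 * N\<^sup>2)\<^sup>2 * CG) * 0 + 2 * muK * C3 powr p * 0)"
      unfolding B_def by (intro tendsto_intros LIMSEQ_power_zero) auto
    then show ?thesis by simp
  qed
  ultimately have "I \<le> ennreal 0"
    by (intro LIMSEQ_le_const[OF tendsto_ennrealI]) auto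
  then have "I = 0" by simp
  then have "AE x in M. ennreal (\<bar>u x - a0\<bar> powr p) = 0"
    unfolding I_def by (subst (asm) nn_integral_0_iff_AE) measurable
  then have "AE x in M. u x = a0" by (rule AE_mp) (auto intro!: AE_I2)
  then show ?thesis by (auto simp: ae_constant_def)
qed

end

section \<open>Besov functions below the critical exponent\<close>

text \<open>Only the values of \<open>g j\<close> at the vertices of level \<open>m * (i0 + j)\<close> matter; \<open>g (Suc j)\<close> is obtained from them by lemma \<open>refine\<close>.\<close>

locale refinement = gasket_energy k q n N p
  for k :: "'n::finite" and q :: "nat \<Rightarrow> real^'n" and n :: nat and N p :: real +
  fixes m i0 :: nat and f :: "real^'n \<Rightarrow> real" and g :: "nat \<Rightarrow> real^'n \<Rightarrow> real"
  assumes m: "0 < m" and tau_less: "ext_const * c m < 1"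
    and g_0: "g 0 = f"
    and g_range: "\<And>j \<iota> x lo hi. \<iota> \<in> cells (m * (i0 + j)) \<Longrightarrow> x \<in> K \<Longrightarrow>
      (\<And>a. a \<le> n \<Longrightarrow> lo \<le> g j (cmap \<iota> (q a)) \<and> g j (cmap \<iota> (q a)) \<le> hi) \<Longrightarrow>
      lo \<le> g (Suc j) (cmap \<iota> x) \<and> g (Suc j) (cmap \<iota> x) \<le> hi"
    and g_energy: "\<And>j \<iota>. \<iota> \<in> cells (m * (i0 + j)) \<Longrightarrow>
      En m (\<lambda>x. g (Suc j) (cmap \<iota> x)) \<le> ext_const * c m * En 0 (\<lambda>x. g j (cmap \<iota> x))"
begin

definition \<tau> where "\<tau> = ext_const * c m"

definition lev where "lev j = m * (i0 + j)"

definition E where "E j \<iota> = En 0 (\<lambda>x. g j (cmap \<iota> x))"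

definition S where "S j = (\<Sum>\<iota>\<in>cells (lev j). E j \<iota>)"

lemma tau: "0 < \<tau>" "\<tau> < 1"
  using ext_const_pos conductance_pos tau_less by (auto simp: \<tau>_def)

lemma E_nonneg: "0 \<le> E j \<iota>"
  by (simp add: E_def En_nonneg)

lemma S_nonneg: "0 \<le> S j"
  unfolding S_def by (intro sum_nonneg E_nonneg)

lemma lev_Suc: "lev (Suc j) = lev j + m"
  by (simp add: lev_def)

lemma lev_ge: "j \<le> lev j"
proof -
  have "1 * j \<le> m * (i0 + j)" using m by (intro mult_mono) auto
  then show ?thesis by (simp add: lev_def)
qed

lemma sum_cells_add:
  "(\<Sum>\<kappa>\<in>cells (l + j). F \<kappa> :: real) = (\<Sum>\<iota>\<in>cells l. \<Sum>w\<in>words n j. F (fst \<iota>, snd \<iota> @ w))"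
proof -
  have *: "(\<Sum>\<iota>\<in>UNIV \<times> words n l. f \<iota>) = (\<Sum>s\<in>UNIV. \<Sum>w\<in>words n l. f (s, w))" for f :: "bool \<times> nat list \<Rightarrow> real" and l
    by (simp only: sum.cartesian_product) simp
  show ?thesis unfolding cells_def * by (simp add: sum_words_add)
qed

lemma S_Suc: "S (Suc j) \<le> \<tau> * S j"
proof -
  have "S (Suc j) = (\<Sum>\<iota>\<in>cells (lev j). \<Sum>w\<in>words n m. En 0 (\<lambda>x. g (Suc j) (cmap (fst \<iota>, snd \<iota> @ w) x)))"
    unfolding S_def E_def lev_Suc by (rule sum_cells_add)
  also have "\<dots> = (\<Sum>\<iota>\<in>cells (lev j). En m (\<lambda>x. g (Suc j) (cmap \<iota> x)))"
  proof (intro sum.cong refl)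
    fix \<iota>
    show "(\<Sum>w\<in>words n m. En 0 (\<lambda>x. g (Suc j) (cmap (fst \<iota>, snd \<iota> @ w) x))) = En m (\<lambda>x. g (Suc j) (cmap \<iota> x))"
      using En_add[of m 0 "\<lambda>x. g (Suc j) (cmap \<iota> x)"] by (simp add: cmap_append_fst)
  qed
  also have "\<dots> \<le> (\<Sum>\<iota>\<in>cells (lev j). \<tau> * E j \<iota>)"
    unfolding \<tau>_def E_def lev_def by (intro sum_mono g_energy)
  also have "\<dots> = \<tau> * S j" by (simp add: S_def sum_distrib_left)
  finally show ?thesis .
qed

lemma S_le: "S j \<le> \<tau> ^ j * S 0"
proof (induction j)
  case (Suc j)
  have "S (Suc j) \<le> \<tau> * S j" by (rule S_Suc)
  also have "\<dots> \<le> \<tau> * (\<tau> ^ j * S 0)" using Suc tau by (intro mult_left_mono) auto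
  finally show ?case by (simp add: mult_ac)
qed simp

lemma E_le: "\<iota> \<in> cells (lev j) \<Longrightarrow> E j \<iota> \<le> \<tau> ^ j * S 0"
  using member_le_sum[of \<iota> "cells (lev j)" "E j"] E_nonneg S_le[of j] by (simp add: S_def finite_cells)

text \<open>The maximum principle iterated through subcells. The index starts at
  \<open>Suc j\<close> because \<open>g j\<close> is controlled only at the vertices of level
  \<open>lev j\<close>.\<close>

lemma g_range_later:
  assumes "\<iota> \<in> cells (lev j)" "x \<in> K"
    and "\<And>a. a \<le> n \<Longrightarrow> lo \<le> g j (cmap \<iota> (q a)) \<and> g j (cmap \<iota> (q a)) \<le> hi"
  shows "lo \<le> g (Suc (j + d)) (cmap \<iota> x) \<and> g (Suc (j + d)) (cmap \<iota> x) \<le> hi"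
  using assms
proof (induction d arbitrary: j \<iota> x)
  case 0
  then show ?case using g_range[of \<iota> j x lo hi] by (simp add: lev_def)
next
  case (Suc d)
  obtain w x' where w: "w \<in> words n m" "x' \<in> K" "x = word_map q w x'"
    using Suc.prems(2) K_words[of m] by blast
  let ?\<kappa> = "(fst \<iota>, snd \<iota> @ w)"
  have \<kappa>: "?\<kappa> \<in> cells (lev (Suc j))"
    using Suc.prems(1) w(1) by (auto simp: lev_Suc cells_def words_append)
  have c: "cmap ?\<kappa> y = cmap \<iota> (word_map q w y)" for y by (simp add: cmap_def word_map_append)
  have "lo \<le> g (Suc (Suc j + d)) (cmap ?\<kappa> x') \<and> g (Suc (Suc j + d)) (cmap ?\<kappa> x') \<le> hi"
  proof (rule Suc.IH[OF \<kappa> w(2)])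
    fix a assume "a \<le> n"
    then have "word_map q w (q a) \<in> K" using w(1) by (intro word_map_K q_in_K) (auto simp: words_def)
    then show "lo \<le> g (Suc j) (cmap ?\<kappa> (q a)) \<and> g (Suc j) (cmap ?\<kappa> (q a)) \<le> hi"
      unfolding c using Suc.prems by (intro g_range) (auto simp: lev_def)
  qed
  then show ?case by (simp add: c w(3))
qed

text \<open>The extreme vertex values are attained at two vertices, and their difference is one term
  of the energy of the cell.\<close>

lemma vertex_range:
  "\<exists>lo hi. (\<forall>a\<le>n. lo \<le> g j (cmap \<iota> (q a)) \<and> g j (cmap \<iota> (q a)) \<le> hi) \<and> (hi - lo) powr p \<le> E j \<iota> \<and> lo \<le> hi"
proof -
  let ?V = "(\<lambda>a. g j (cmap \<iota> (q a))) ` {..n}"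
  have ne: "finite ?V" "?V \<noteq> {}" by auto
  obtain a where "a \<in> {..n}" and a': "Min ?V = g j (cmap \<iota> (q a))" using Min_in[OF ne] by (rule imageE) blast
  then have a: "a \<le> n" by simp
  obtain b where "b \<in> {..n}" and b': "Max ?V = g j (cmap \<iota> (q b))" using Max_in[OF ne] by (rule imageE) blast
  then have b: "b \<le> n" by simp
  have le: "Min ?V \<le> Max ?V" using ne by (meson Max_in Min_le)
  show ?thesis
  proof (rule exI[of _ "Min ?V"], rule exI[of _ "Max ?V"], intro conjI allI impI)
    fix a assume "a \<le> n"
    then show "Min ?V \<le> g j (cmap \<iota> (q a))" "g j (cmap \<iota> (q a)) \<le> Max ?V"
      by (auto intro!: Min_le Max_ge)
  next
    have "(Max ?V - Min ?V) powr p = \<bar>g j (cmap \<iota> (q b)) - g j (cmap \<iota> (q a))\<bar> powr p"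
      using le a' b' by simp
    also have "\<dots> \<le> E j \<iota>"
      unfolding E_def using vertex_pair_le_En_0[OF b a, of "\<lambda>x. g j (cmap \<iota> x)"] .
    finally show "(Max ?V - Min ?V) powr p \<le> E j \<iota>" .
  qed (rule le)
qed

section \<open>The limit function and its continuity\<close>

definition v where "v x = lim (\<lambda>i. g i x)"

lemma tau_tendsto: "(\<lambda>j. C * (\<tau> ^ j * S 0)) \<longlonglongrightarrow> 0"
proof -
  have "(\<lambda>j. C * (\<tau> ^ j * S 0)) \<longlonglongrightarrow> C * (0 * S 0)"
    using tau by (intro tendsto_mult tendsto_const LIMSEQ_power_zero) auto
  then show ?thesis by simp
qed

lemma small_level:
  assumes "0 < e"
  obtains j where "\<And>\<iota>. \<iota> \<in> cells (lev j) \<Longrightarrow> E j \<iota> < e"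
proof -
  have "eventually (\<lambda>j. 1 * (\<tau> ^ j * S 0) < e) sequentially"
    using tau_tendsto[of 1] assms by (rule order_tendstoD(2))
  then obtain j where "\<tau> ^ j * S 0 < e" by (auto simp: eventually_sequentially)
  then show thesis using that[of j] E_le[of _ j] by fastforce
qed

text \<open>Once the energy of a cell containing \<open>x\<close> is small, all later values at
  \<open>x\<close> are trapped between its extreme vertex values.\<close>

lemma g_tendsto_v: "x \<in> X \<Longrightarrow> (\<lambda>i. g i x) \<longlonglongrightarrow> v x"
proof -
  assume x: "x \<in> X"
  have "Cauchy (\<lambda>i. g i x)"
    unfolding Cauchy_def
  proof (intro allI impI)
    fix e :: real assume e: "0 < e"
    obtain j where j: "\<And>\<iota>. \<iota> \<in> cells (lev j) \<Longrightarrow> E j \<iota> < e powr p" using small_level[of "e powr p"] e by auto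
    obtain \<iota> where \<iota>: "\<iota> \<in> cells (lev j)" "x \<in> cset \<iota>" using X_cellE[OF x] .
    then obtain x' where x': "x' \<in> K" "x = cmap \<iota> x'" by (auto simp: cset_def)
    obtain lo hi where r: "\<forall>a\<le>n. lo \<le> g j (cmap \<iota> (q a)) \<and> g j (cmap \<iota> (q a)) \<le> hi"
      "(hi - lo) powr p \<le> E j \<iota>" "lo \<le> hi" using vertex_range by blast
    have "(hi - lo) powr p < e powr p" using r(2) j[OF \<iota>(1)] by simp
    then have hl: "hi - lo < e" using e p r(3) by (metis diff_ge_0_iff_ge less_imp_le not_less powr_mono2 zero_less_one less_trans)
    show "\<exists>M. \<forall>i\<ge>M. \<forall>l\<ge>M. dist (g i x) (g l x) < e"
    proof (intro exI[of _ "Suc j"] allI impI)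
      fix i l assume "Suc j \<le> i" "Suc j \<le> l"
      then obtain d d' where "i = Suc (j + d)" "l = Suc (j + d')" by (metis add_Suc le_Suc_ex)
      then have "lo \<le> g i x \<and> g i x \<le> hi" "lo \<le> g l x \<and> g l x \<le> hi"
        using g_range_later[OF \<iota>(1) x'(1) r(1)[rule_format]] x'(2) by auto
      then show "dist (g i x) (g l x) < e" using hl by (auto simp: dist_real_def)
    qed
  qed
  then show ?thesis unfolding v_def by (simp add: Cauchy_convergent convergent_LIMSEQ_iff[symmetric])
qed

lemma v_range:
  assumes "\<iota> \<in> cells (lev j)" "x \<in> cset \<iota>"
    and r: "\<And>a. a \<le> n \<Longrightarrow> lo \<le> g j (cmap \<iota> (q a)) \<and> g j (cmap \<iota> (q a)) \<le> hi"
  shows "lo \<le> v x \<and> v x \<le> hi"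
proof -
  obtain x' where x': "x' \<in> K" "x = cmap \<iota> x'" using assms(2) by (auto simp: cset_def)
  have "lo \<le> g i x \<and> g i x \<le> hi" if i: "Suc j \<le> i" for i
  proof -
    obtain d where "i = Suc (j + d)" using i by (metis add_Suc le_Suc_ex)
    then show ?thesis using g_range_later[OF assms(1) x'(1) r] x'(2) by simp
  qed
  moreover have "(\<lambda>i. g i x) \<longlonglongrightarrow> v x"
    using g_tendsto_v assms cset_subset_X by blast
  ultimately show ?thesis by (meson LIMSEQ_le_const LIMSEQ_le_const2)
qed

lemma v_osc:
  assumes "\<iota> \<in> cells (lev j)" "x \<in> cset \<iota>" "y \<in> cset \<iota>"
  shows "\<bar>v x - v y\<bar> powr p \<le> E j \<iota>"
proof -
  obtain lo hi where r: "\<forall>a\<le>n. lo \<le> g j (cmap \<iota> (q a)) \<and> g j (cmap \<iota> (q a)) \<le> hi"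
    "(hi - lo) powr p \<le> E j \<iota>" using vertex_range by blast
  have "\<bar>v x - v y\<bar> powr p \<le> (hi - lo) powr p"
    using v_range[OF assms(1,2) r(1)[rule_format]] v_range[OF assms(1,3) r(1)[rule_format]] p by (intro powr_mono2) auto
  then show ?thesis using r(2) by linarith
qed

lemma v_osc_adj:
  assumes "\<iota> \<in> cells (lev j)" "\<kappa> \<in> cells (lev j)" "adj \<iota> \<kappa>" "x \<in> cset \<iota>" "y \<in> cset \<kappa>"
  shows "\<bar>v x - v y\<bar> powr p \<le> 2 powr p * (E j \<iota> + E j \<kappa>)"
proof -
  obtain a b where ab: "a \<le> n" "b \<le> n" "cmap \<iota> (q a) = cmap \<kappa> (q b)" using assms(3) by (auto simp: adj_def)
  define z where "z = cmap \<iota> (q a)"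
  have z: "z \<in> cset \<iota>" "z \<in> cset \<kappa>"
    using vertex_in_cset[OF ab(1), of \<iota>] vertex_in_cset[OF ab(2), of \<kappa>] ab(3) by (auto simp: z_def)
  have "\<bar>v x - v y\<bar> powr p \<le> 2 powr p * (\<bar>v x - v z\<bar> powr p + \<bar>v z - v y\<bar> powr p)"
    using p by (intro powr_abs_diff_le) auto
  also have "\<dots> \<le> 2 powr p * (E j \<iota> + E j \<kappa>)"
    using assms z by (intro mult_left_mono add_mono v_osc) auto
  finally show ?thesis .
qed

lemma continuous_v: "continuous_on X v"
  unfolding continuous_on_iff
proof (intro ballI allI impI)
  fix x and e :: real assume x: "x \<in> X" and e: "0 < e"
  obtain cs where cs: "0 < cs" "\<forall>m \<iota> \<kappa>. \<forall>x y::real^'n. \<iota> \<in> cells m \<longrightarrow> \<kappa> \<in> cells m \<longrightarrow> x \<in> cset \<iota> \<longrightarrow> y \<in> cset \<kappa> \<longrightarrow>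
        dist x y < cs * (1/2) ^ m \<longrightarrow> adj \<iota> \<kappa>"
    by (rule cells_separation) blast
  \<comment> \<open>Chosen so that \<open>2 powr p * (e' + e') = e powr p\<close> in the estimate
    across two adjacent cells.\<close>
  define e' where "e' = e powr p / (2 * 2 powr p)"
  have "0 < e'" using e by (simp add: e'_def)
  then obtain j where j: "\<And>\<iota>. \<iota> \<in> cells (lev j) \<Longrightarrow> E j \<iota> < e'" using small_level by blast
  show "\<exists>d>0. \<forall>x'\<in>X. dist x' x < d \<longrightarrow> dist (v x') (v x) < e"
  proof (intro exI[of _ "cs * (1/2) ^ lev j"] conjI ballI impI)
    show "0 < cs * (1/2) ^ lev j" using cs(1) by simp
    fix y assume y: "y \<in> X" "dist y x < cs * (1/2) ^ lev j"
    obtain \<iota> where \<iota>: "\<iota> \<in> cells (lev j)" "x \<in> cset \<iota>" using X_cellE[OF x] .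
    obtain \<kappa> where \<kappa>: "\<kappa> \<in> cells (lev j)" "y \<in> cset \<kappa>" using X_cellE[OF y(1)] .
    have "adj \<kappa> \<iota>" using cs(2) \<iota> \<kappa> y(2) by blast
    then have "\<bar>v y - v x\<bar> powr p \<le> 2 powr p * (E j \<kappa> + E j \<iota>)" using \<iota> \<kappa> by (intro v_osc_adj)
    also have "\<dots> < 2 powr p * (e' + e')" using j \<iota> \<kappa> by (intro mult_strict_left_mono add_strict_mono) auto
    also have "\<dots> = e powr p" by (simp add: e'_def)
    finally have "\<bar>v y - v x\<bar> powr p < e powr p" .
    then have "\<bar>v y - v x\<bar> < e"
      using e p powr_mono2[of p e "\<bar>v y - v x\<bar>"] by (meson abs_ge_zero less_imp_le not_less zero_less_one less_trans)
    then show "dist (v y) (v x) < e" by (simp add: dist_real_def)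
  qed
qed

text \<open>Each cell occurs in at most \<open>2 * N\<^sup>2\<close> pairs on either side, by
  \<open>card_adj\<close> and the symmetry of adjacency.\<close>

lemma sum_adj_E_le:
  "(\<Sum>\<iota>\<in>cells (lev j). \<Sum>\<kappa>\<in>{\<kappa>\<in>cells (lev j). adj \<iota> \<kappa>}. E j \<iota> + E j \<kappa>) \<le> 4 * N\<^sup>2 * S j"
proof -
  have le: "(\<Sum>\<iota>\<in>cells (lev j). \<Sum>\<kappa>\<in>{\<kappa>\<in>cells (lev j). adj \<iota> \<kappa>}. E j \<iota>) \<le> 2 * N\<^sup>2 * S j"
  proof -
    have "(\<Sum>\<iota>\<in>cells (lev j). \<Sum>\<kappa>\<in>{\<kappa>\<in>cells (lev j). adj \<iota> \<kappa>}. E j \<iota>)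
        = (\<Sum>\<iota>\<in>cells (lev j). real (card {\<kappa>\<in>cells (lev j). adj \<iota> \<kappa>}) * E j \<iota>)" by simp
    also have "\<dots> \<le> (\<Sum>\<iota>\<in>cells (lev j). 2 * N\<^sup>2 * E j \<iota>)"
      by (intro sum_mono mult_right_mono card_adj E_nonneg)
    finally show ?thesis by (simp add: S_def sum_distrib_left)
  qed
  have "(\<Sum>\<iota>\<in>cells (lev j). \<Sum>\<kappa>\<in>{\<kappa>\<in>cells (lev j). adj \<iota> \<kappa>}. E j \<kappa>)
      = (\<Sum>\<kappa>\<in>cells (lev j). \<Sum>\<iota>\<in>{\<iota>\<in>cells (lev j). adj \<iota> \<kappa>}. E j \<kappa>)"
    by (rule sum.swap_restrict) (auto simp: finite_cells)
  also have "\<dots> = (\<Sum>\<kappa>\<in>cells (lev j). \<Sum>\<iota>\<in>{\<iota>\<in>cells (lev j). adj \<kappa> \<iota>}. E j \<kappa>)"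
    using adj_sym by (intro sum.cong) blast+
  finally show ?thesis using le by (simp add: sum.distrib)
qed

text \<open>A combination of indicators of products of cells that dominates
  \<open>\<bar>v y - v x\<bar> powr p\<close> on adjacent cells of level \<open>lev j\<close>; its
  double integral is a finite sum.\<close>

definition H where
  "H j x y = (\<Sum>\<iota>\<in>cells (lev j). \<Sum>\<kappa>\<in>{\<kappa>\<in>cells (lev j). adj \<iota> \<kappa>}.
     ennreal (2 powr p * (E j \<iota> + E j \<kappa>)) * (indicator (cset \<iota>) x * indicator (cset \<kappa>) y))"

lemma H_ge:
  assumes "\<iota> \<in> cells (lev j)" "\<kappa> \<in> cells (lev j)" "adj \<iota> \<kappa>" "x \<in> cset \<iota>" "y \<in> cset \<kappa>"
  shows "ennreal (\<bar>v y - v x\<bar> powr p) \<le> H j x y"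
proof -
  let ?F = "\<lambda>\<iota> \<kappa>. ennreal (2 powr p * (E j \<iota> + E j \<kappa>)) * (indicator (cset \<iota>) x * indicator (cset \<kappa>) y)"
  have "ennreal (\<bar>v y - v x\<bar> powr p) \<le> ?F \<iota> \<kappa>"
    using v_osc_adj[OF assms] assms(4,5) by (simp add: abs_minus_commute ennreal_leI)
  also have "\<dots> \<le> (\<Sum>\<kappa>\<in>{\<kappa>\<in>cells (lev j). adj \<iota> \<kappa>}. ?F \<iota> \<kappa>)"
    using assms by (intro member_le_sum[of \<kappa> _ "?F \<iota>"]) (auto simp: finite_cells)
  also have "\<dots> \<le> H j x y"
    unfolding H_def using assms
    by (intro member_le_sum[of \<iota> _ "\<lambda>\<iota>. \<Sum>\<kappa>\<in>{\<kappa>\<in>cells (lev j). adj \<iota> \<kappa>}. ?F \<iota> \<kappa>"]) (auto simp: finite_cells)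
  finally show ?thesis .
qed

lemma H_measurable [measurable]: "case_prod (H j) \<in> borel_measurable (M \<Otimes>\<^sub>M M)"
proof -
  have cs [measurable]: "cset \<iota> \<in> sets M" if "\<iota> \<in> cells (lev j)" for \<iota> using cset_sets that .
  show ?thesis
    unfolding H_def split_def
    by (intro borel_measurable_sum borel_measurable_times borel_measurable_const
        measurable_compose[OF measurable_fst borel_measurable_indicator]
        measurable_compose[OF measurable_snd borel_measurable_indicator] cs) auto
qed

lemma H_integral:
  "(\<integral>\<^sup>+x. \<integral>\<^sup>+y. H j x y \<partial>M \<partial>M) \<le> ennreal (2 powr p * (4 * N\<^sup>2) * (muK * muK) * ((1 / N) ^ lev j * (1 / N) ^ lev j) * (\<tau> ^ j * S 0))"
proof -
  let ?\<mu> = "muK * (1 / N) ^ lev j"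
  have \<mu>: "0 \<le> ?\<mu>" using muK_pos N_pos by simp
  have cs: "cset \<iota> \<in> sets M" if "\<iota> \<in> cells (lev j)" for \<iota> using cset_sets that .
  let ?e = "\<lambda>\<iota> \<kappa>. 2 powr p * (E j \<iota> + E j \<kappa>)"
  have e: "0 \<le> ?e \<iota> \<kappa>" for \<iota> \<kappa> using E_nonneg by simp
  have in1: "(\<integral>\<^sup>+y. H j x y \<partial>M) = (\<Sum>\<iota>\<in>cells (lev j). \<Sum>\<kappa>\<in>{\<kappa>\<in>cells (lev j). adj \<iota> \<kappa>}.
      ennreal (?e \<iota> \<kappa> * ?\<mu>) * indicator (cset \<iota>) x)" for x
  proof -
    have "(\<integral>\<^sup>+y. H j x y \<partial>M) = (\<Sum>\<iota>\<in>cells (lev j). \<Sum>\<kappa>\<in>{\<kappa>\<in>cells (lev j). adj \<iota> \<kappa>}.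
        \<integral>\<^sup>+y. (ennreal (?e \<iota> \<kappa>) * indicator (cset \<iota>) x) * indicator (cset \<kappa>) y \<partial>M)"
      unfolding H_def mult.assoc[symmetric]
      by (subst nn_integral_sum, use cs in measurable) (intro sum.cong refl nn_integral_sum, use cs in measurable)
    also have "\<dots> = (\<Sum>\<iota>\<in>cells (lev j). \<Sum>\<kappa>\<in>{\<kappa>\<in>cells (lev j). adj \<iota> \<kappa>}.
        ennreal (?e \<iota> \<kappa> * ?\<mu>) * indicator (cset \<iota>) x)"
    proof (intro sum.cong refl)
      fix \<iota> \<kappa> assume "\<iota> \<in> cells (lev j)" "\<kappa> \<in> {\<kappa>\<in>cells (lev j). adj \<iota> \<kappa>}"
      then have "(\<integral>\<^sup>+y. (ennreal (?e \<iota> \<kappa>) * indicator (cset \<iota>) x) * indicator (cset \<kappa>) y \<partial>M)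
          = (ennreal (?e \<iota> \<kappa>) * indicator (cset \<iota>) x) * ennreal ?\<mu>"
        using cs by (subst nn_integral_cmult_indicator) (auto simp: emeasure_cset)
      also have "\<dots> = (ennreal (?e \<iota> \<kappa>) * ennreal ?\<mu>) * indicator (cset \<iota>) x" by (simp only: ac_simps)
      also have "ennreal (?e \<iota> \<kappa>) * ennreal ?\<mu> = ennreal (?e \<iota> \<kappa> * ?\<mu>)" by (rule ennreal_mult[OF e \<mu>, symmetric])
      finally show "(\<integral>\<^sup>+y. (ennreal (?e \<iota> \<kappa>) * indicator (cset \<iota>) x) * indicator (cset \<kappa>) y \<partial>M)
          = ennreal (?e \<iota> \<kappa> * ?\<mu>) * indicator (cset \<iota>) x" .
    qed
    finally show ?thesis .
  qed
  have "(\<integral>\<^sup>+x. \<integral>\<^sup>+y. H j x y \<partial>M \<partial>M) = (\<Sum>\<iota>\<in>cells (lev j). \<Sum>\<kappa>\<in>{\<kappa>\<in>cells (lev j). adj \<iota> \<kappa>}.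
      \<integral>\<^sup>+x. ennreal (?e \<iota> \<kappa> * ?\<mu>) * indicator (cset \<iota>) x \<partial>M)"
    unfolding in1
    by (subst nn_integral_sum, use cs in measurable) (intro sum.cong refl nn_integral_sum, use cs in measurable)
  also have "\<dots> = (\<Sum>\<iota>\<in>cells (lev j). \<Sum>\<kappa>\<in>{\<kappa>\<in>cells (lev j). adj \<iota> \<kappa>}. ennreal (?e \<iota> \<kappa> * ?\<mu> * ?\<mu>))"
  proof (intro sum.cong refl)
    fix \<iota> \<kappa> assume \<iota>: "\<iota> \<in> cells (lev j)"
    have "(\<integral>\<^sup>+x. ennreal (?e \<iota> \<kappa> * ?\<mu>) * indicator (cset \<iota>) x \<partial>M) = ennreal (?e \<iota> \<kappa> * ?\<mu>) * ennreal ?\<mu>"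
      using cs[OF \<iota>] by (subst nn_integral_cmult_indicator) (auto simp: emeasure_cset[OF \<iota>])
    also have "\<dots> = ennreal (?e \<iota> \<kappa> * ?\<mu> * ?\<mu>)" by (rule ennreal_mult[symmetric, OF mult_nonneg_nonneg[OF e \<mu>] \<mu>])
    finally show "(\<integral>\<^sup>+x. ennreal (?e \<iota> \<kappa> * ?\<mu>) * indicator (cset \<iota>) x \<partial>M) = ennreal (?e \<iota> \<kappa> * ?\<mu> * ?\<mu>)" .
  qed
  also have "\<dots> = ennreal (\<Sum>\<iota>\<in>cells (lev j). \<Sum>\<kappa>\<in>{\<kappa>\<in>cells (lev j). adj \<iota> \<kappa>}. ?e \<iota> \<kappa> * ?\<mu> * ?\<mu>)"
    using mult_nonneg_nonneg[OF mult_nonneg_nonneg[OF e \<mu>] \<mu>] by (simp add: sum_nonneg)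
  finally have eq: "(\<integral>\<^sup>+x. \<integral>\<^sup>+y. H j x y \<partial>M \<partial>M)
      = ennreal (\<Sum>\<iota>\<in>cells (lev j). \<Sum>\<kappa>\<in>{\<kappa>\<in>cells (lev j). adj \<iota> \<kappa>}. ?e \<iota> \<kappa> * ?\<mu> * ?\<mu>)" .
  have "(\<Sum>\<iota>\<in>cells (lev j). \<Sum>\<kappa>\<in>{\<kappa>\<in>cells (lev j). adj \<iota> \<kappa>}. ?e \<iota> \<kappa> * ?\<mu> * ?\<mu>)
      = 2 powr p * (?\<mu> * ?\<mu>) * (\<Sum>\<iota>\<in>cells (lev j). \<Sum>\<kappa>\<in>{\<kappa>\<in>cells (lev j). adj \<iota> \<kappa>}. E j \<iota> + E j \<kappa>)"
    by (simp add: sum_distrib_left mult_ac)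
  also have "\<dots> \<le> 2 powr p * (?\<mu> * ?\<mu>) * (4 * N\<^sup>2 * (\<tau> ^ j * S 0))"
  proof (rule mult_left_mono)
    have "4 * N\<^sup>2 * S j \<le> 4 * N\<^sup>2 * (\<tau> ^ j * S 0)" by (intro mult_left_mono S_le) auto
    then show "(\<Sum>\<iota>\<in>cells (lev j). \<Sum>\<kappa>\<in>{\<kappa>\<in>cells (lev j). adj \<iota> \<kappa>}. E j \<iota> + E j \<kappa>) \<le> 4 * N\<^sup>2 * (\<tau> ^ j * S 0)"
      using sum_adj_E_le[of j] by linarith
  qed (use \<mu> in simp)
  also have "\<dots> = 2 powr p * (4 * N\<^sup>2) * (muK * muK) * ((1 / N) ^ lev j * (1 / N) ^ lev j) * (\<tau> ^ j * S 0)"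
    by (simp only: mult_ac)
  finally show ?thesis unfolding eq by (rule ennreal_leI)
qed

text \<open>Pairs are sorted by distance into the scales \<open>lev j\<close>. At each scale the
  kernel is bounded by a constant and the numerator by \<open>H j\<close>, and the resulting series
  is geometric with ratio \<open>\<tau> / lam ^ m\<close>.\<close>

lemma v_besov:
  assumes \<theta>: "0 < \<theta>" and tl: "\<tau> < (N * 2 powr (- (\<theta> * p))) ^ m"
  shows "v \<in> besov p \<theta> M"
proof -
  define \<alpha> where "\<alpha> = \<theta> * p"
  have \<alpha>: "0 < \<alpha>" using \<theta> p by (simp add: \<alpha>_def)
  define lam where "lam = N * 2 powr (- \<alpha>)"
  have lam: "0 < lam" using N_pos by (simp add: lam_def)
  obtain cs where cs: "0 < cs" "\<forall>m \<iota> \<kappa>. \<forall>x y::real^'n. \<iota> \<in> cells m \<longrightarrow> \<kappa> \<in> cells m \<longrightarrow> x \<in> cset \<iota> \<longrightarrow> y \<in> cset \<kappa> \<longrightarrow>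
        dist x y < cs * (1/2) ^ m \<longrightarrow> adj \<iota> \<kappa>"
    by (rule cells_separation) blast
  obtain h where h: "(1/2) ^ h < cs / 2" using real_arch_pow_inv[of "cs / 2" "1/2"] cs(1) by auto
  obtain B where B: "0 < B" "\<forall>x\<in>X. \<bar>v x\<bar> \<le> B" using continuous_bounded_X[OF continuous_v] by blast
  \<comment> \<open>A lower bound for the Besov denominator at distance at least
    \<open>cs * (1/2) ^ l\<close>: by the choice of \<open>h\<close> the ball contains a cell of
    level \<open>l + h\<close>.\<close>
  define kb where "kb l = (cs * (1/2) ^ l) powr \<alpha> * (muK * (1 / N) ^ (l + h))" for l :: nat
  have kb: "0 < kb l" for l using cs(1) muK_pos N_pos by (simp add: kb_def)
  have halfp: "((1/2) ^ l) powr \<alpha> = (2 powr (- \<alpha>)) ^ l" for l :: nat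
    by (simp add: realpow_powr powr_minus powr_divide inverse_eq_divide)
  have kernel: "ennreal t / (ennreal (dist x y powr \<alpha>) * emeasure M (ball x (dist x y) \<inter> space M)) \<le> ennreal (t / kb l)"
    if x: "x \<in> X" and d: "cs * (1/2) ^ l \<le> dist x y" and t: "0 \<le> t" for x y l t
  proof -
    have "2 * (1/2) ^ (l + h) < cs * (1/2) ^ l" using h by (simp add: power_add)
    then have "ennreal (muK * (1 / N) ^ (l + h)) \<le> emeasure M (ball x (dist x y) \<inter> space M)"
      unfolding space_M using d by (intro ball_measure_lower[OF x]) simp
    moreover have "ennreal ((cs * (1/2) ^ l) powr \<alpha>) \<le> ennreal (dist x y powr \<alpha>)"
      using d cs(1) \<alpha> by (intro ennreal_leI powr_mono2) auto
    ultimately have "ennreal ((cs * (1/2) ^ l) powr \<alpha>) * ennreal (muK * (1 / N) ^ (l + h))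
        \<le> ennreal (dist x y powr \<alpha>) * emeasure M (ball x (dist x y) \<inter> space M)" by (intro mult_mono) auto
    then have le: "ennreal (kb l) \<le> ennreal (dist x y powr \<alpha>) * emeasure M (ball x (dist x y) \<inter> space M)"
      using muK_pos N_pos by (simp add: kb_def ennreal_mult)
    show ?thesis
    proof (cases "ennreal (dist x y powr \<alpha>) * emeasure M (ball x (dist x y) \<inter> space M)")
      case (real d)
      then have "kb l \<le> d" using le by simp
      then show ?thesis using kb[of l] t real(2) by (simp add: divide_ennreal real(1) frac_le ennreal_leI)
    qed simp
  qed
  \<comment> \<open>Covers the pairs that are far apart, where boundedness of \<open>v\<close> is
    enough.\<close>
  define T0 where "T0 = (2 * B) powr p / kb (lev 0)"
  define F where "F x y = (if x = y then 0 else ennreal (\<bar>v y - v x\<bar> powr p) /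
            (ennreal (dist x y powr (\<theta> * p)) * emeasure M (ball x (dist x y) \<inter> space M)))" for x y
  have pt: "F x y \<le> ennreal T0 + (\<Sum>j. ennreal (1 / kb (lev (Suc j))) * H j x y)"
    if xy: "x \<in> space M" "y \<in> space M" for x y
  proof (cases "x = y")
    case False
    have x: "x \<in> X" and y: "y \<in> X" using xy by (auto simp: space_M)
    have ex: "\<exists>j. cs * (1/2) ^ lev j \<le> dist x y"
    proof -
      obtain l where l: "(1/2) ^ l < dist x y / cs" using real_arch_pow_inv[of "dist x y / cs" "1/2"] cs(1) False by auto
      have "(1/2::real) ^ lev l \<le> (1/2) ^ l" using lev_ge by (intro power_decreasing) auto
      then have "(1/2) ^ lev l \<le> dist x y / cs" using l by linarith
      then show ?thesis using cs(1) by (intro exI[of _ l]) (simp add: field_simps)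
    qed
    \<comment> \<open>The first scale resolving the pair. If \<open>j = Suc i\<close>, the points
      are still close at level \<open>lev i\<close>, so they lie in adjacent cells there.\<close>
    define j where "j = (LEAST j. cs * (1/2) ^ lev j \<le> dist x y)"
    have j: "cs * (1/2) ^ lev j \<le> dist x y" unfolding j_def by (rule LeastI_ex[OF ex])
    show ?thesis
    proof (cases j)
      case 0
      have "\<bar>v y - v x\<bar> powr p \<le> (2 * B) powr p" using bspec[OF B(2) x] bspec[OF B(2) y] p by (intro powr_mono2) auto
      then have "\<bar>v y - v x\<bar> powr p / kb (lev 0) \<le> T0"
        unfolding T0_def using kb[of "lev 0"] by (intro divide_right_mono) auto
      moreover have "F x y \<le> ennreal (\<bar>v y - v x\<bar> powr p / kb (lev 0))"
        unfolding F_def \<alpha>_def[symmetric] using kernel[OF x j[unfolded 0]] False by auto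
      ultimately have "F x y \<le> ennreal T0" using order_trans ennreal_leI by blast
      then show ?thesis by (rule order_trans) simp
    next
      case (Suc i)
      have "\<not> cs * (1/2) ^ lev i \<le> dist x y"
        using not_less_Least[of i "\<lambda>j. cs * (1/2) ^ lev j \<le> dist x y"] Suc by (simp add: j_def)
      then have di: "dist x y < cs * (1/2) ^ lev i" by simp
      obtain \<iota> where \<iota>: "\<iota> \<in> cells (lev i)" "x \<in> cset \<iota>" using X_cellE[OF x] .
      obtain \<kappa> where \<kappa>: "\<kappa> \<in> cells (lev i)" "y \<in> cset \<kappa>" using X_cellE[OF y] .
      have "adj \<iota> \<kappa>" using cs(2) \<iota> \<kappa> di by blast
      have "F x y \<le> ennreal (\<bar>v y - v x\<bar> powr p / kb (lev (Suc i)))"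
        unfolding F_def \<alpha>_def[symmetric] using kernel[OF x j[unfolded Suc]] False by auto
      also have "\<dots> = ennreal (1 / kb (lev (Suc i))) * ennreal (\<bar>v y - v x\<bar> powr p)"
        using kb[of "lev (Suc i)"] by (simp flip: ennreal_mult)
      also have "\<dots> \<le> ennreal (1 / kb (lev (Suc i))) * H i x y"
        by (intro mult_left_mono H_ge[OF \<iota>(1) \<kappa>(1) \<open>adj \<iota> \<kappa>\<close> \<iota>(2) \<kappa>(2)]) simp
      also have "\<dots> = (\<Sum>j\<in>{i}. ennreal (1 / kb (lev (Suc j))) * H j x y)" by simp
      also have "\<dots> \<le> (\<Sum>j. ennreal (1 / kb (lev (Suc j))) * H j x y)" by (intro sum_le_suminf) auto
      finally show ?thesis by (rule order_trans) simp
    qed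
  qed (simp add: F_def)
  define W where "W j = (1 / kb (lev (Suc j))) *
      (2 powr p * (4 * N\<^sup>2) * (muK * muK) * ((1 / N) ^ lev j * (1 / N) ^ lev j) * (\<tau> ^ j * S 0))" for j
  have W0: "0 \<le> W j" for j using kb[of "lev (Suc j)"] muK_pos N_pos S_nonneg tau by (auto simp: W_def)
  have Wsum: "summable W"
  proof -
    \<comment> \<open>Everything independent of \<open>j\<close>; evaluating the kernel at
      \<open>lev (Suc j)\<close> but \<open>H\<close> at \<open>lev j\<close> costs only the
      constant powers of exponent \<open>m\<close> and \<open>h\<close>.\<close>
    define Z where "Z = 1 / (cs powr \<alpha> * (2 powr (- \<alpha>)) ^ m * muK * (1 / N) ^ (m + h)) *
      (2 powr p * (4 * N\<^sup>2) * (muK * muK) * S 0) * (1 / lam) ^ lev 0"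
    have "W = (\<lambda>j. Z * (\<tau> / lam ^ m) ^ j)"
    proof
      fix j
      define P where "P = 2 powr (- \<alpha>)"
      have P: "0 < P" by (simp add: P_def)
      have lp: "lam = N * P" by (simp add: lam_def P_def)
      have l1: "lev (Suc j) = lev j + m" "lev j = lev 0 + m * j" by (auto simp: lev_def algebra_simps)
      have kbe: "kb (lev (Suc j)) = cs powr \<alpha> * P ^ (lev j + m) * (muK * (1 / N) ^ (lev j + m + h))"
        using cs(1) by (simp add: kb_def powr_mult halfp l1(1) P_def)
      have "W j = 1 / (cs powr \<alpha> * P ^ m * muK * (1 / N) ^ (m + h)) * (2 powr p * (4 * N\<^sup>2) * (muK * muK) * S 0)
          * ((1 / (N * P)) ^ lev j) * \<tau> ^ j"
        unfolding W_def kbe using N_pos P muK_pos cs(1)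
        by (simp add: power_add power_divide power_mult_distrib field_simps)
      also have "(1 / (N * P)) ^ lev j = (1 / lam) ^ lev 0 * (1 / lam ^ m) ^ j"
        unfolding l1(2) lp by (simp add: power_add power_mult power_divide)
      finally show "W j = Z * (\<tau> / lam ^ m) ^ j" by (simp add: Z_def P_def power_divide)
    qed
    moreover have "summable (\<lambda>j. Z * (\<tau> / lam ^ m) ^ j)"
    proof -
      have "\<tau> / lam ^ m < 1" using tl lam by (simp add: lam_def \<alpha>_def)
      moreover have "0 \<le> \<tau> / lam ^ m" using tau lam by simp
      ultimately show ?thesis by (intro summable_mult summable_geometric) auto
    qed
    ultimately show ?thesis by simp
  qed
  have Hm1: "H j x \<in> borel_measurable M" if "x \<in> space M" for j x
    using measurable_Pair2[OF H_measurable that] by simp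
  have "besov_energy p \<theta> M v = (\<integral>\<^sup>+x. \<integral>\<^sup>+y. F x y \<partial>M \<partial>M)" by (simp add: besov_energy_def F_def)
  also have "\<dots> \<le> (\<integral>\<^sup>+x. \<integral>\<^sup>+y. ennreal T0 + (\<Sum>j. ennreal (1 / kb (lev (Suc j))) * H j x y) \<partial>M \<partial>M)"
    by (intro nn_integral_mono pt)
  also have "\<dots> = (\<integral>\<^sup>+x. (ennreal T0 * emeasure M (space M) + (\<Sum>j. ennreal (1 / kb (lev (Suc j))) * (\<integral>\<^sup>+y. H j x y \<partial>M))) \<partial>M)"
  proof (rule nn_integral_cong)
    fix x assume x: "x \<in> space M"
    note [measurable] = Hm1[OF x]
    show "(\<integral>\<^sup>+y. ennreal T0 + (\<Sum>j. ennreal (1 / kb (lev (Suc j))) * H j x y) \<partial>M)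
        = ennreal T0 * emeasure M (space M) + (\<Sum>j. ennreal (1 / kb (lev (Suc j))) * (\<integral>\<^sup>+y. H j x y \<partial>M))"
      by (subst nn_integral_add) (auto simp: nn_integral_suminf nn_integral_cmult)
  qed
  also have "\<dots> = ennreal T0 * emeasure M (space M) * emeasure M (space M)
      + (\<Sum>j. ennreal (1 / kb (lev (Suc j))) * (\<integral>\<^sup>+x. \<integral>\<^sup>+y. H j x y \<partial>M \<partial>M))"
    by (subst nn_integral_add) (auto simp: nn_integral_suminf nn_integral_cmult)
  also have "\<dots> \<le> ennreal T0 * emeasure M (space M) * emeasure M (space M) + (\<Sum>j. ennreal (W j))"
  proof (intro add_left_mono suminf_le)
    fix j
    have "ennreal (1 / kb (lev (Suc j))) * (\<integral>\<^sup>+x. \<integral>\<^sup>+y. H j x y \<partial>M \<partial>M) \<le> ennreal (1 / kb (lev (Suc j))) *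
      ennreal (2 powr p * (4 * N\<^sup>2) * (muK * muK) * ((1 / N) ^ lev j * (1 / N) ^ lev j) * (\<tau> ^ j * S 0))"
      by (intro mult_left_mono H_integral) simp
    also have "\<dots> = ennreal (W j)"
      unfolding W_def using kb[of "lev (Suc j)"] muK_pos N_pos S_nonneg tau by (intro ennreal_mult[symmetric]) auto
    finally show "ennreal (1 / kb (lev (Suc j))) * (\<integral>\<^sup>+x. \<integral>\<^sup>+y. H j x y \<partial>M \<partial>M) \<le> ennreal (W j)" .
  qed auto
  also have "\<dots> < \<infinity>"
  proof -
    have "(\<Sum>j. ennreal (W j)) \<noteq> top" using Wsum W0 by (rule ennreal_suminf_neq_top)
    moreover have "emeasure M (space M) \<noteq> top" by simp
    ultimately show ?thesis by (simp add: ennreal_mult_less_top less_top[symmetric] ennreal_mult_eq_top_iff)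
  qed
  finally show ?thesis using continuous_Lp[OF continuous_v] by (simp add: besov_def)
qed

end

context gasket_energy
begin

text \<open>The refinement starts from the values of \<open>f\<close> at the vertices of a level
  whose cells are so small that \<open>f\<close> varies by less than \<open>e\<close> on each; the
  maximum principle then keeps \<open>v\<close> within \<open>e\<close> of \<open>f\<close>.\<close>

lemma besov_approx:
  assumes \<theta>: "0 < \<theta>" and lr: "1 < N * 2 powr (- (\<theta> * p)) * \<rho>"
    and f: "continuous_on X f" and e: "0 < e"
  obtains v where "v \<in> besov p \<theta> M" "continuous_on X v" "\<forall>x\<in>X. \<bar>v x - f x\<bar> \<le> e"
proof -
  define lam where "lam = N * 2 powr (- (\<theta> * p))"
  have lam: "0 < lam" using N_pos by (simp add: lam_def)
  \<comment> \<open>\<open>lam\<close> may exceed 1: the comparison with 1 gives convergence and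
    continuity, the one with \<open>lam\<close> finite Besov energy.\<close>
  have "1 / \<rho> < min 1 lam"
    using lr rho_gt_1 rho_pos by (simp add: lam_def field_simps)
  then obtain m where m: "0 < m" "ext_const * c m < min 1 lam ^ m" by (rule rho_approx)
  have "min 1 lam ^ m \<le> 1" "min 1 lam ^ m \<le> lam ^ m"
    using lam by (auto intro!: power_le_one power_mono)
  then have tl: "ext_const * c m < 1" "ext_const * c m < lam ^ m" using m(2) by auto
  have "uniformly_continuous_on X f" using f compact_X by (rule compact_uniformly_continuous)
  then obtain d where d: "0 < d" "\<And>x y. x \<in> X \<Longrightarrow> y \<in> X \<Longrightarrow> dist y x < d \<Longrightarrow> dist (f y) (f x) < e"
    using e unfolding uniformly_continuous_on_def by metis
  obtain i0 where i0: "(1/2) ^ i0 < d / 2" using real_arch_pow_inv[of "d / 2" "1/2"] d(1) by auto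
  have "\<forall>j f. \<exists>g. (\<forall>\<iota>\<in>cells (m * (i0 + j)). \<forall>x\<in>K. \<forall>lo hi. (\<forall>a\<le>n. lo \<le> f (cmap \<iota> (q a)) \<and> f (cmap \<iota> (q a)) \<le> hi) \<longrightarrow>
       lo \<le> g (cmap \<iota> x) \<and> g (cmap \<iota> x) \<le> hi) \<and>
     (\<forall>\<iota>\<in>cells (m * (i0 + j)). En m (\<lambda>x. g (cmap \<iota> x)) \<le> ext_const * c m * En 0 (\<lambda>x. f (cmap \<iota> x)))"
  proof (intro allI)
    fix j and f :: "real^'n \<Rightarrow> real"
    show "\<exists>g. (\<forall>\<iota>\<in>cells (m * (i0 + j)). \<forall>x\<in>K. \<forall>lo hi. (\<forall>a\<le>n. lo \<le> f (cmap \<iota> (q a)) \<and> f (cmap \<iota> (q a)) \<le> hi) \<longrightarrow>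
       lo \<le> g (cmap \<iota> x) \<and> g (cmap \<iota> x) \<le> hi) \<and>
     (\<forall>\<iota>\<in>cells (m * (i0 + j)). En m (\<lambda>x. g (cmap \<iota> x)) \<le> ext_const * c m * En 0 (\<lambda>x. f (cmap \<iota> x)))"
      by (rule refine[of "m * (i0 + j)" f m]) blast
  qed
  then obtain step where step:
    "\<And>j f \<iota> x lo hi. \<iota> \<in> cells (m * (i0 + j)) \<Longrightarrow> x \<in> K \<Longrightarrow> \<forall>a\<le>n. lo \<le> f (cmap \<iota> (q a)) \<and> f (cmap \<iota> (q a)) \<le> hi \<Longrightarrow>
       lo \<le> step j f (cmap \<iota> x) \<and> step j f (cmap \<iota> x) \<le> hi"
    "\<And>j f \<iota>. \<iota> \<in> cells (m * (i0 + j)) \<Longrightarrow> En m (\<lambda>x. step j f (cmap \<iota> x)) \<le> ext_const * c m * En 0 (\<lambda>x. f (cmap \<iota> x))"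
    by metis
  define g where "g = rec_nat f step"
  have g0: "g 0 = f" and gS: "g (Suc j) = step j (g j)" for j by (simp_all add: g_def)
  interpret refinement k q n N p m i0 f g
  proof
    show "lo \<le> g (Suc j) (cmap \<iota> x) \<and> g (Suc j) (cmap \<iota> x) \<le> hi"
      if "\<iota> \<in> cells (m * (i0 + j))" "x \<in> K" "\<And>a. a \<le> n \<Longrightarrow> lo \<le> g j (cmap \<iota> (q a)) \<and> g j (cmap \<iota> (q a)) \<le> hi"
      for j \<iota> x lo hi
      unfolding gS using step(1)[OF that(1,2)] that(3) by blast
    show "En m (\<lambda>x. g (Suc j) (cmap \<iota> x)) \<le> ext_const * c m * En 0 (\<lambda>x. g j (cmap \<iota> x))"
      if "\<iota> \<in> cells (m * (i0 + j))" for j \<iota>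
      unfolding gS by (rule step(2)[OF that])
  qed (use m tl g0 in auto)
  show thesis
  proof (rule that[of v])
    show "v \<in> besov p \<theta> M" using v_besov[OF \<theta>] tl(2) by (simp add: \<tau>_def lam_def)
    show "continuous_on X v" by (rule continuous_v)
    show "\<forall>x\<in>X. \<bar>v x - f x\<bar> \<le> e"
    proof
      fix x assume x: "x \<in> X"
      obtain \<iota> where \<iota>: "\<iota> \<in> cells (lev 0)" "x \<in> cset \<iota>" using X_cellE[OF x] .
      have small: "2 * (1/2) ^ lev 0 < d"
      proof -
        have "1 * i0 \<le> m * i0" using m(1) by (intro mult_right_mono) auto
        then have "(1/2::real) ^ lev 0 \<le> (1/2) ^ i0" by (intro power_decreasing) (auto simp: lev_def)
        then show ?thesis using i0 by linarith
      qed
      have "f x - e \<le> v x \<and> v x \<le> f x + e"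
      proof (rule v_range[OF \<iota>])
        fix a assume a: "a \<le> n"
        have z: "cmap \<iota> (q a) \<in> cset \<iota>" by (rule vertex_in_cset[OF a])
        have "dist (cmap \<iota> (q a)) x < d" using cset_dist[OF \<iota>(1) z \<iota>(2)] small by linarith
        then have "dist (f (cmap \<iota> (q a))) (f x) < e" using d(2)[OF x] z cset_subset_X[OF \<iota>(1)] by blast
        then show "f x - e \<le> g 0 (cmap \<iota> (q a)) \<and> g 0 (cmap \<iota> (q a)) \<le> f x + e"
          unfolding g0 by (auto simp: dist_real_def)
      qed
      then show "\<bar>v x - f x\<bar> \<le> e" by auto
    qed
  qed
qed

subsection \<open>Density\<close>

lemma indicator_approx:
  assumes A: "A \<in> sets M" and e: "0 < e"
  obtains h where "continuous_on X h" "(\<integral>x. \<bar>indicator A x - h x\<bar> powr p \<partial>M) \<le> e"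
proof -
  \<comment> \<open>The push-forward to the whole space is a finite Borel measure, to which inner
    and outer regularity apply.\<close>
  define M' where "M' = distr M borel (\<lambda>x. x)"
  have em': "emeasure M' B = emeasure M (B \<inter> X)" if "B \<in> sets borel" for B
    unfolding M'_def using that by (subst emeasure_distr) (auto simp: space_M)
  have M': "sets M' = sets borel" "emeasure M' (space M') \<noteq> \<infinity>"
    using em'[of UNIV] M.emeasure_finite[of X] by (auto simp: M'_def)
  interpret M': finite_measure M' by (rule finite_measureI) (rule M'(2))
  have Ab: "A \<in> sets borel" using A closed_X unfolding sets_M by (subst (asm) sets_restrict_space_iff) auto
  have fin: "emeasure M' A \<noteq> \<infinity>" by simp
  have "\<exists>C. C \<subseteq> A \<and> compact C \<and> emeasure M' A < emeasure M' C + ennreal (e / 2)"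
  proof -
    have "emeasure M' A < emeasure M' A + ennreal (e / 2)" using fin e by (simp add: ennreal_add_left_cancel_less less_top[symmetric])
    also have "emeasure M' A = (SUP C\<in>{C. C \<subseteq> A \<and> compact C}. emeasure M' C)"
      using inner_regular[OF M'(1,2) Ab] .
    finally have "(SUP C\<in>{C. C \<subseteq> A \<and> compact C}. emeasure M' C) < (SUP C\<in>{C. C \<subseteq> A \<and> compact C}. emeasure M' C) + ennreal (e / 2)" .
    also have "\<dots> = (SUP C\<in>{C. C \<subseteq> A \<and> compact C}. emeasure M' C + ennreal (e / 2))"
      by (rule ennreal_SUP_add_left[symmetric]) auto
    finally obtain C where "C \<subseteq> A" "compact C"
      "(SUP C\<in>{C. C \<subseteq> A \<and> compact C}. emeasure M' C) < emeasure M' C + ennreal (e / 2)"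
      by (auto simp: less_SUP_iff)
    then show ?thesis using inner_regular[OF M'(1,2) Ab] by auto
  qed
  then obtain C where C: "C \<subseteq> A" "compact C" "emeasure M' A < emeasure M' C + ennreal (e / 2)" by auto
  have "(INF U\<in>{U. A \<subseteq> U \<and> open U}. emeasure M' U) < emeasure M' A + ennreal (e / 2)"
    unfolding outer_regular[OF M'(1,2) Ab, symmetric]
    using fin e by (simp add: ennreal_add_left_cancel_less less_top[symmetric])
  then obtain U where U: "A \<subseteq> U" "open U" "emeasure M' U < emeasure M' A + ennreal (e / 2)"
    by (auto simp: INF_less_iff)
  have Cs: "C \<in> sets M'" and Us: "U \<in> sets M'" using C U M'(1) by (auto intro: borel_compact)
  have mUC: "measure M' (U - C) \<le> e"
  proof -
    have "measure M' A < measure M' C + e / 2" "measure M' U < measure M' A + e / 2"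
      using C(3) U(3) e by (simp_all add: M'.emeasure_eq_measure ennreal_less_iff flip: ennreal_plus)
    moreover have "measure M' (U - C) = measure M' U - measure M' C"
      using C U Cs Us by (intro M'.finite_measure_Diff) auto
    ultimately show ?thesis by linarith
  qed
  have "closed C" "closed (- U)" "C \<inter> - U = {}" using C U compact_imp_closed by auto
  then obtain h :: "real^'n \<Rightarrow> real" where h: "continuous_on UNIV h" "\<And>x. h x \<in> closed_segment 1 0"
    "\<And>x. x \<in> C \<Longrightarrow> h x = 1" "\<And>x. x \<in> - U \<Longrightarrow> h x = 0"
    using Urysohn[of C "- U" 1 "0::real"] by metis
  have h01: "0 \<le> h x" "h x \<le> 1" for x using h(2)[of x] by (auto simp: closed_segment_eq_real_ivl)
  have pt: "\<bar>indicator A x - h x\<bar> powr p \<le> indicator (U - C) x" for x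
  proof (cases "x \<in> U - C")
    case True
    have "\<bar>indicator A x - h x\<bar> powr p \<le> 1 powr p"
      using h01[of x] p by (intro powr_mono2) (auto simp: indicator_def)
    then show ?thesis using True by simp
  next
    case False
    then have "indicator A x = h x" using h(3,4) C(1) U(1) by (cases "x \<in> C") (auto simp: indicator_def)
    then show ?thesis using False by simp
  qed
  have hX: "continuous_on X h" using h(1) continuous_on_subset by blast
  have UCs: "(U - C) \<inter> X \<in> sets M" using Cs Us M'(1) closed_X by (intro sets_MI) auto
  have "(\<integral>x. \<bar>indicator A x - h x\<bar> powr p \<partial>M) \<le> (\<integral>x. indicator ((U - C) \<inter> X) x \<partial>M)"
  proof (rule integral_mono)
    show "integrable M (\<lambda>x. \<bar>indicator A x - h x\<bar> powr p)"
      by (rule Lp_diff_integrable[OF indicator_Lp[OF A] continuous_Lp[OF hX]])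
    show "integrable M (indicator ((U - C) \<inter> X) :: _ \<Rightarrow> real)"
      using UCs by (simp add: M.emeasure_eq_measure)
    show "\<bar>indicator A x - h x\<bar> powr p \<le> indicator ((U - C) \<inter> X) x" if "x \<in> space M" for x
      using pt[of x] that by (simp add: space_M indicator_def)
  qed
  also have "\<dots> = measure M ((U - C) \<inter> X)" using UCs sets.sets_into_space[OF UCs] by (simp add: Int_absorb2)
  also have "\<dots> = measure M' (U - C)" unfolding measure_def using Cs Us M'(1) by (subst em') auto
  finally show thesis using that[OF hX] mUC by linarith
qed

lemma simple_approx:
  assumes s: "simple_function M (s :: real^'n \<Rightarrow> real)" and e: "0 < e"
  obtains h where "continuous_on X h" "(\<integral>x. \<bar>s x - h x\<bar> powr p \<partial>M) \<le> e"
proof -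
  define I where "I = s ` space M"
  have I: "finite I" using s by (simp add: I_def simple_function_def)
  define S where "S y = s -` {y} \<inter> space M" for y
  have Ss: "S y \<in> sets M" for y unfolding S_def using s by (simp add: simple_functionD)
  \<comment> \<open>The summand 1 keeps \<open>C\<close> positive when \<open>s\<close>
    vanishes.\<close>
  define C where "C = real (card I) powr p * (\<Sum>y\<in>I. \<bar>y\<bar> powr p) + 1"
  have C: "0 < C" unfolding C_def by (intro add_nonneg_pos mult_nonneg_nonneg sum_nonneg) auto
  have "\<exists>h. continuous_on X h \<and> (\<integral>x. \<bar>indicator (S y) x - h x\<bar> powr p \<partial>M) \<le> e / C" for y
    using indicator_approx[OF Ss[of y], of "e / C"] e C by (metis divide_pos_pos)
  then obtain h where h: "\<And>y. continuous_on X (h y)" "\<And>y. (\<integral>x. \<bar>indicator (S y) x - h y x\<bar> powr p \<partial>M) \<le> e / C"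
    by metis
  have sx: "s x = (\<Sum>y\<in>I. y * indicator (S y) x)" if "x \<in> space M" for x
  proof -
    have "(\<Sum>y\<in>I. y * indicator (S y) x) = (\<Sum>y\<in>I. if y = s x then y else 0)"
      using that by (intro sum.cong) (auto simp: S_def indicator_def)
    then show ?thesis using I that by (simp add: I_def)
  qed
  have int: "integrable M (\<lambda>x. \<bar>indicator (S y) x - h y x\<bar> powr p)" for y
    by (rule Lp_diff_integrable[OF indicator_Lp[OF Ss] continuous_Lp[OF h(1)]])
  have pt: "\<bar>s x - (\<Sum>y\<in>I. y * h y x)\<bar> powr p \<le> real (card I) powr p * (\<Sum>y\<in>I. \<bar>y\<bar> powr p * \<bar>indicator (S y) x - h y x\<bar> powr p)"
    if "x \<in> space M" for x
  proof -
    have "s x - (\<Sum>y\<in>I. y * h y x) = (\<Sum>y\<in>I. y * (indicator (S y) x - h y x))"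
      using sx[OF that] by (simp add: right_diff_distrib sum_subtractf)
    then have "\<bar>s x - (\<Sum>y\<in>I. y * h y x)\<bar> \<le> (\<Sum>y\<in>I. \<bar>y * (indicator (S y) x - h y x)\<bar>)"
      by (simp add: sum_abs)
    then have "\<bar>s x - (\<Sum>y\<in>I. y * h y x)\<bar> powr p \<le> (\<Sum>y\<in>I. \<bar>y * (indicator (S y) x - h y x)\<bar>) powr p"
      using p by (intro powr_mono2) auto
    also have "\<dots> \<le> real (card I) powr p * (\<Sum>y\<in>I. \<bar>y * (indicator (S y) x - h y x)\<bar> powr p)"
      using p I by (intro powr_sum_le) auto
    finally show ?thesis by (simp add: abs_mult powr_mult)
  qed
  have hc: "continuous_on X (\<lambda>x. \<Sum>y\<in>I. y * h y x)" by (intro continuous_intros h)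
  have "(\<integral>x. \<bar>s x - (\<Sum>y\<in>I. y * h y x)\<bar> powr p \<partial>M)
      \<le> (\<integral>x. real (card I) powr p * (\<Sum>y\<in>I. \<bar>y\<bar> powr p * \<bar>indicator (S y) x - h y x\<bar> powr p) \<partial>M)"
  proof (rule Bochner_Integration.integral_mono')
    show "integrable M (\<lambda>x. real (card I) powr p * (\<Sum>y\<in>I. \<bar>y\<bar> powr p * \<bar>indicator (S y) x - h y x\<bar> powr p))"
      using int by auto
  qed (use pt in \<open>auto intro!: mult_nonneg_nonneg sum_nonneg\<close>)
  also have "\<dots> = real (card I) powr p * (\<Sum>y\<in>I. \<bar>y\<bar> powr p * (\<integral>x. \<bar>indicator (S y) x - h y x\<bar> powr p \<partial>M))"
    using int by simp
  also have "\<dots> \<le> real (card I) powr p * (\<Sum>y\<in>I. \<bar>y\<bar> powr p * (e / C))"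
    by (intro mult_left_mono sum_mono h) auto
  also have "\<dots> = (C - 1) * (e / C)"
  proof -
    have C1: "C - 1 = real (card I) powr p * (\<Sum>y\<in>I. \<bar>y\<bar> powr p)" by (simp add: C_def)
    show ?thesis unfolding C1 by (simp only: sum_distrib_right mult.assoc)
  qed
  also have "\<dots> \<le> e" using C e by (simp add: field_simps)
  finally show thesis using that[OF hc] by blast
qed

lemma continuous_dense_Lp:
  assumes f: "f \<in> Lp_fun p M" and e: "0 < e"
  obtains h where "continuous_on X h" "(\<integral>x. \<bar>f x - h x\<bar> powr p \<partial>M) \<le> e"
proof -
  have fm [measurable]: "f \<in> borel_measurable M" and fi: "integrable M (\<lambda>x. \<bar>f x\<bar> powr p)" using f by (auto simp: Lp_fun_def)
  obtain F where F: "\<And>i. simple_function M (F i)" "\<And>x. x \<in> space M \<Longrightarrow> (\<lambda>i. F i x) \<longlonglongrightarrow> f x"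
    "\<And>i x. x \<in> space M \<Longrightarrow> dist (F i x) 0 \<le> 2 * dist (f x) 0"
    using borel_measurable_implies_sequence_metric[OF fm, of 0] by metis
  have Fm [measurable]: "F i \<in> borel_measurable M" for i using F(1) by (rule borel_measurable_simple_function)
  have "(\<lambda>i. \<integral>x. \<bar>f x - F i x\<bar> powr p \<partial>M) \<longlonglongrightarrow> (\<integral>x. 0 \<partial>M)"
  proof (rule integral_dominated_convergence[where w = "\<lambda>x. 3 powr p * \<bar>f x\<bar> powr p"])
    show "AE x in M. (\<lambda>i. \<bar>f x - F i x\<bar> powr p) \<longlonglongrightarrow> 0"
    proof (intro AE_I2)
      fix x assume x: "x \<in> space M"
      have "(\<lambda>i. \<bar>f x - F i x\<bar>) \<longlonglongrightarrow> \<bar>f x - f x\<bar>" by (intro tendsto_intros F(2)[OF x])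
      then have "(\<lambda>i. \<bar>f x - F i x\<bar> powr p) \<longlonglongrightarrow> 0 powr p"
        using p by (intro tendsto_powr2 tendsto_const) auto
      then show "(\<lambda>i. \<bar>f x - F i x\<bar> powr p) \<longlonglongrightarrow> 0" using p by simp
    qed
    show "AE x in M. norm (\<bar>f x - F i x\<bar> powr p) \<le> 3 powr p * \<bar>f x\<bar> powr p" for i
    proof (intro AE_I2)
      fix x assume x: "x \<in> space M"
      have "\<bar>f x - F i x\<bar> powr p \<le> (3 * \<bar>f x\<bar>) powr p"
        using F(3)[OF x, of i] p by (intro powr_mono2) (auto simp: dist_real_def)
      then show "norm (\<bar>f x - F i x\<bar> powr p) \<le> 3 powr p * \<bar>f x\<bar> powr p" by (simp add: powr_mult)
    qed
  qed (use fi in auto)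
  then have lim: "(\<lambda>i. \<integral>x. \<bar>f x - F i x\<bar> powr p \<partial>M) \<longlonglongrightarrow> 0" by simp
  define e' where "e' = e / (2 * 2 powr p)"
  have e': "0 < e'" using e by (simp add: e'_def)
  have "eventually (\<lambda>i. (\<integral>x. \<bar>f x - F i x\<bar> powr p \<partial>M) < e') sequentially"
    using order_tendstoD(2)[OF lim e'] .
  then obtain i where i: "(\<integral>x. \<bar>f x - F i x\<bar> powr p \<partial>M) < e'" by (auto simp: eventually_sequentially)
  obtain h where h: "continuous_on X h" "(\<integral>x. \<bar>F i x - h x\<bar> powr p \<partial>M) \<le> e'"
    using simple_approx[OF F(1) e'] by metis
  have "F i \<in> Lp_fun p M"
  proof -
    have "integrable M (\<lambda>x. \<bar>F i x\<bar> powr p)"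
    proof (rule Bochner_Integration.integrable_bound)
      show "integrable M (\<lambda>x. 2 powr p * \<bar>f x\<bar> powr p)" using fi by simp
      show "AE x in M. norm (\<bar>F i x\<bar> powr p) \<le> norm (2 powr p * \<bar>f x\<bar> powr p)"
      proof (intro AE_I2)
        fix x assume x: "x \<in> space M"
        have "\<bar>F i x\<bar> powr p \<le> (2 * \<bar>f x\<bar>) powr p"
          using F(3)[OF x, of i] p by (intro powr_mono2) (auto simp: dist_real_def)
        then show "norm (\<bar>F i x\<bar> powr p) \<le> norm (2 powr p * \<bar>f x\<bar> powr p)" by (simp add: powr_mult)
      qed
    qed measurable
    then show ?thesis by (simp add: Lp_fun_def)
  qed
  then have "(\<integral>x. \<bar>f x - h x\<bar> powr p \<partial>M) \<le> 2 powr p * (e' + e')"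
    using Lp_triangle[OF f _ continuous_Lp[OF h(1)], of "F i"] i h(2)
    by (smt (verit) mult_left_mono powr_ge_zero)
  also have "\<dots> = e" by (simp add: e'_def)
  finally show thesis using that[OF h(1)] by blast
qed

lemma dense_below:
  assumes \<theta>: "0 < \<theta>" and lr: "1 < N * 2 powr (- (\<theta> * p)) * \<rho>"
  shows "dense_in_Lp p M (besov p \<theta> M)"
  unfolding dense_in_Lp_def
proof (intro ballI allI impI)
  fix f and e :: real assume f: "f \<in> Lp_fun p M" and e: "0 < e"
  \<comment> \<open>Two errors of size \<open>d\<close> add up to
    \<open>2 powr p * (d + d) = (e / 2) powr p\<close>; the half leaves room for the strict
    inequality.\<close>
  define d where "d = (e / 2) powr p / (2 * 2 powr p)"
  have d: "0 < d" using e by (simp add: d_def)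
  obtain h where h: "continuous_on X h" "(\<integral>x. \<bar>f x - h x\<bar> powr p \<partial>M) \<le> d"
    using continuous_dense_Lp[OF f d] .
  \<comment> \<open>A uniform error \<open>d'\<close> costs at most
    \<open>d' powr p * (2 * muK) = d\<close> on the whole space.\<close>
  define d' where "d' = (d / (2 * muK)) powr (1 / p)"
  have d': "0 < d'" using d muK_pos by (simp add: d'_def)
  obtain v where v: "v \<in> besov p \<theta> M" "continuous_on X v" "\<forall>x\<in>X. \<bar>v x - h x\<bar> \<le> d'"
    using besov_approx[OF \<theta> lr h(1) d'] .
  have "(\<integral>x. \<bar>h x - v x\<bar> powr p \<partial>M) \<le> (\<integral>x. d' powr p \<partial>M)"
  proof (rule integral_mono)
    show "integrable M (\<lambda>x. \<bar>h x - v x\<bar> powr p)"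
      by (rule Lp_diff_integrable[OF continuous_Lp[OF h(1)] continuous_Lp[OF v(2)]])
    show "\<bar>h x - v x\<bar> powr p \<le> d' powr p" if "x \<in> space M" for x
      using v(3) that p by (intro powr_mono2) (auto simp: space_M abs_minus_commute)
  qed simp
  also have "\<dots> = d / (2 * muK) * measure M X"
    using d muK_pos p by (simp add: d'_def powr_powr space_M)
  also have "\<dots> \<le> d / (2 * muK) * (2 * muK)"
  proof (rule mult_left_mono)
    show "measure M X \<le> 2 * muK"
      using emeasure_X muK_pos by (simp add: M.emeasure_eq_measure)
  qed (use d muK_pos in simp)
  also have "\<dots> = d" using muK_pos by simp
  finally have hv: "(\<integral>x. \<bar>h x - v x\<bar> powr p \<partial>M) \<le> d" .
  have "(\<integral>x. \<bar>f x - v x\<bar> powr p \<partial>M) \<le> 2 powr p * ((\<integral>x. \<bar>f x - h x\<bar> powr p \<partial>M) + (\<integral>x. \<bar>h x - v x\<bar> powr p \<partial>M))"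
    by (rule Lp_triangle[OF f continuous_Lp[OF h(1)] continuous_Lp[OF v(2)]])
  also have "\<dots> \<le> 2 powr p * (d + d)" using h(2) hv by (intro mult_left_mono add_mono) auto
  also have "\<dots> = (e / 2) powr p" by (simp add: d_def)
  finally have "(\<integral>x. \<bar>f x - v x\<bar> powr p \<partial>M) powr (1 / p) \<le> ((e / 2) powr p) powr (1 / p)"
    using p by (intro powr_mono2 Bochner_Integration.integral_nonneg) auto
  also have "\<dots> = e / 2" using e p by (simp add: powr_powr)
  finally have "Lp_norm p M (\<lambda>x. f x - v x) < e" using e by (simp add: Lp_norm_def)
  then show "\<exists>u\<in>besov p \<theta> M. Lp_norm p M (\<lambda>x. f x - u x) < e" using v(1) by blast
qed

text \<open>The indicator of a cell of level 1 is at distance at least 1/2 from any constant, either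
  on the cell or on its complement, and both have mass at least \<open>r\<close>. This bounds the
  second exponent from above, and below the threshold it turns density into the existence of
  non-constant functions.\<close>

lemma constants_not_dense:
  assumes D: "D \<subseteq> Lp_fun p M" "\<And>u. u \<in> D \<Longrightarrow> ae_constant M u"
  shows "\<not> dense_in_Lp p M D"
proof
  assume dense: "dense_in_Lp p M D"
  define \<iota> where "\<iota> = (False, [0::nat])"
  have \<iota>: "\<iota> \<in> cells 1" by (simp add: \<iota>_def cells_def words_def)
  have \<iota>0: "(False, []) \<in> cells 0" by (simp add: cells_def words_def)
  define B where "B = cset \<iota>"
  have Bs: "B \<in> sets M" and mB: "measure M B = muK * (1 / N)"
    using cset_sets[OF \<iota>] measure_cset[OF \<iota>] by (auto simp: B_def)
  have X: "X \<in> sets M" using closed_X by (intro sets_MI) auto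
  have "muK \<le> measure M X"
    using M.finite_measure_mono[OF cset_subset_X[OF \<iota>0] X] measure_cset[OF \<iota>0] by simp
  moreover have "measure M (X - B) = measure M X - measure M B"
    using X Bs cset_subset_X[OF \<iota>] by (intro M.finite_measure_Diff) (auto simp: B_def)
  ultimately have mXB: "muK - muK * (1 / N) \<le> measure M (X - B)" using mB by simp
  define r where "r = min (muK * (1 / N)) (muK - muK * (1 / N))"
  have "1 / N < 1" using N_ge by simp
  then have "muK * (1 / N) < muK * 1" using muK_pos by (intro mult_strict_left_mono)
  then have r: "0 < r" using muK_pos N_pos by (simp add: r_def)
  define e where "e = ((1/2) powr p * r) powr (1 / p)"
  have e: "0 < e" using r by (simp add: e_def)
  have ind: "indicator B \<in> Lp_fun p M" by (rule indicator_Lp[OF Bs])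
  obtain u where u: "u \<in> D" "Lp_norm p M (\<lambda>x. indicator B x - u x) < e"
    using dense ind e unfolding dense_in_Lp_def by blast
  obtain t where t: "AE x in M. u x = t" using D(2)[OF u(1)] by (auto simp: ae_constant_def)
  have [measurable]: "u \<in> borel_measurable M" using D(1) u(1) by (auto simp: Lp_fun_def)
  define Y where "Y = (if t \<le> 1/2 then B else X - B)"
  have Y: "Y \<in> sets M" "r \<le> measure M Y" using Bs X mB mXB by (auto simp: Y_def r_def)
  have "(1/2) powr p * r \<le> (1/2) powr p * measure M Y" using Y(2) by (intro mult_left_mono) auto
  also have "\<dots> = (\<integral>x. (1/2) powr p * indicator Y x \<partial>M)"
    using Y(1) sets.sets_into_space[OF Y(1)] by (simp add: Int_absorb2)
  also have "\<dots> \<le> (\<integral>x. \<bar>indicator B x - u x\<bar> powr p \<partial>M)"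
  proof (rule integral_mono_AE)
    show "integrable M (\<lambda>x. (1/2) powr p * indicator Y x :: real)"
      using Y(1) by (simp add: M.emeasure_eq_measure)
    show "integrable M (\<lambda>x. \<bar>indicator B x - u x\<bar> powr p)"
      using Lp_diff_integrable[OF ind] D(1) u(1) by blast
    show "AE x in M. (1/2) powr p * indicator Y x \<le> \<bar>indicator B x - u x\<bar> powr p"
      using t
    proof (rule AE_mp, intro AE_I2 impI)
      fix x assume x: "x \<in> space M" "u x = t"
      show "(1/2) powr p * indicator Y x \<le> \<bar>indicator B x - u x\<bar> powr p"
      proof (cases "x \<in> Y")
        case True
        then have "(1/2) \<le> \<bar>indicator B x - u x\<bar>" using x(2) by (auto simp: Y_def indicator_def split: if_splits)
        then have "(1/2) powr p \<le> \<bar>indicator B x - u x\<bar> powr p" using p by (intro powr_mono2) auto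
        then show ?thesis using True by simp
      qed simp
    qed
  qed
  finally have "e \<le> (\<integral>x. \<bar>indicator B x - u x\<bar> powr p \<partial>M) powr (1 / p)"
    unfolding e_def using r p by (intro powr_mono2) auto
  then show False using u(2) by (simp add: Lp_norm_def)
qed

lemma besov_subset_Lp: "besov p \<theta> M \<subseteq> Lp_fun p M"
  by (auto simp: besov_def)

section \<open>The two critical exponents\<close>

lemma walk_dim_cmp:
  "N * 2 powr (- (\<theta> * p)) * \<rho> < 1 \<longleftrightarrow> walk_dim q p / p < \<theta>"
  "1 < N * 2 powr (- (\<theta> * p)) * \<rho> \<longleftrightarrow> \<theta> < walk_dim q p / p"
proof -
  have w: "walk_dim q p = log 2 (N * \<rho>)" by (simp add: walk_dim_def log_def N_def n_def)
  have Nr: "0 < N * \<rho>" using N_pos rho_pos by simp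
  have e: "N * 2 powr (- (\<theta> * p)) * \<rho> = N * \<rho> / 2 powr (\<theta> * p)" by (simp add: powr_minus field_simps)
  show "N * 2 powr (- (\<theta> * p)) * \<rho> < 1 \<longleftrightarrow> walk_dim q p / p < \<theta>"
    unfolding e w using Nr p by (simp add: log_less_iff field_simps)
  show "1 < N * 2 powr (- (\<theta> * p)) * \<rho> \<longleftrightarrow> \<theta> < walk_dim q p / p"
    unfolding e w using Nr p by (simp add: less_log_iff field_simps)
qed

lemma walk_dim_pos: "0 < walk_dim q p / p"
proof -
  have "1 * 1 < N * \<rho>" using N_ge rho_gt_1 by (intro mult_strict_mono) auto
  then show ?thesis using walk_dim_cmp(2)[of 0] by simp
qed

lemma SUP_exponents:
  assumes sub: "\<And>\<theta>. \<theta> \<in> S \<Longrightarrow> \<theta> \<le> T" and sup: "\<And>\<theta>. 0 < \<theta> \<Longrightarrow> \<theta> < T \<Longrightarrow> \<theta> \<in> S" and T: "0 < (T::real)"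
  shows "(SUP \<theta>\<in>S. ereal \<theta>) = ereal T"
proof (rule antisym)
  show "(SUP \<theta>\<in>S. ereal \<theta>) \<le> ereal T" by (rule SUP_least) (simp add: sub)
  show "ereal T \<le> (SUP \<theta>\<in>S. ereal \<theta>)"
    unfolding le_SUP_iff
  proof (intro allI impI)
    fix y assume "y < ereal T"
    \<comment> \<open>\<open>y\<close> may be negative or minus infinity, but only positive
      exponents are known to lie in \<open>S\<close>.\<close>
    then have "max y 0 < ereal T" using T by simp
    then obtain z where z: "max y 0 < ereal z" "ereal z < ereal T" using ereal_dense2 by blast
    then have "z \<in> S" using sup by simp
    then show "\<exists>i\<in>S. y < ereal i" using z by auto
  qed
qed

lemma critical_exponents:
  "crit_exp p M = ereal (walk_dim q p / p) \<and> crit_exp_dense p M = ereal (walk_dim q p / p)"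
proof -
  have above: "ae_constant M u" if "walk_dim q p / p < \<theta>" "u \<in> besov p \<theta> M" for \<theta> u
  proof -
    have "0 < \<theta>" using that walk_dim_pos by linarith
    then interpret besov_fun k q n N p \<theta> u using that by unfold_locales
    show ?thesis
      using walk_dim_cmp(1)[of \<theta>] that(1) by (intro ae_constant_above) (simp add: lam_def \<alpha>_def)
  qed
  have below: "dense_in_Lp p M (besov p \<theta> M)" if "0 < \<theta>" "\<theta> < walk_dim q p / p" for \<theta>
    using dense_below[OF that(1)] walk_dim_cmp(2)[of \<theta>] that(2) by simp
  have not_dense: "\<not> dense_in_Lp p M (besov p \<theta> M)" if "\<forall>u\<in>besov p \<theta> M. ae_constant M u" for \<theta>
    using constants_not_dense[OF besov_subset_Lp] that by blast
  have nonconst: "\<exists>u\<in>besov p \<theta> M. \<not> ae_constant M u" if "0 < \<theta>" "\<theta> < walk_dim q p / p" for \<theta>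
    using below[OF that] not_dense by blast
  show ?thesis
    unfolding crit_exp_def crit_exp_dense_def
    using above below not_dense nonconst walk_dim_pos
    by (intro conjI SUP_exponents) (auto simp: not_less[symmetric])
qed

end

theorem theorem3p9:
  fixes k :: "'n::finite" and q :: "nat \<Rightarrow> real^'n" and p :: real
  assumes "CARD('n) \<ge> 2"
    and "gasket_simplex k q"
    and "1 < p"
  shows "crit_exp p (double_gasket_measure k q) = ereal (walk_dim q p / p) \<and>
         crit_exp_dense p (double_gasket_measure k q) = ereal (walk_dim q p / p)"
proof -
  interpret gasket_energy k q "CARD('n)" "real CARD('n) + 1" p
    using assms by unfold_locales auto
  show ?thesis using critical_exponents by (simp add: M_def)
qed

end
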